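(* Let $\Omega$ be the chair tiling space in its arrow version. Let $H_5$ be the 2-element group generated by reflection of $\mathbb{R}^2$ about the $x$ axis and $H_6$ the 2-element group generated by reflection about the $y$ axis. For a group $H$ let $\Omega_H=\{T\in\Omega: hT=T\text{ for all }h\in H\}$, with the subspace topology. Then $\Omega_{H_5}$ and $\Omega_{H_6}$ are homeomorphic (rotation by 90 degrees takes each to the other), $\Omega_{H_5}$ is connected and is homeomorphic to the dyadic solenoid $\mathrm{Sol}_2=\varprojlim(\mathbb{R}/\mathbb{Z},\times 2)$, and consequently $\check H^1(\Omega_{H_5})\cong\mathbb{Z}[1/2]$.
   Context: Arrow version of the chair tiling: the tiles are closed unit squares with sides parallel to the coordinate axes, meeting full edge to full edge, each labeled by an arrow pointing NE, NW, SW or SE. The substitution $\sigma$ scales a tile linearly by 2 about the origin and replaces the resulting $2\times 2$ square by four labeled unit squares. For an NE tile the four labels are: top-left SE, top-right NE, bottom-left NE, bottom-right NW. The substitution of the other three tiles is obtained from this one by rotating or reflecting the whole picture (positions and arrows). $\sigma$ extends to patches and tilings tile by tile. $\Omega$ is the set of all such labeled tilings of $\mathbb{R}^2$ (the tile vertices need not lie in $\mathbb{Z}^2$) such that every finite patch is a translate of a subpatch of $\sigma^n(t)$ for some tile $t$ and some $n\ge 0$. The topology on $\Omega$ is the usual tiling topology: two tilings are $\epsilon$-close if, after translating each by a vector of length at most $\epsilon$, they agree on the ball of radius $1/\epsilon$ about the origin. The group $O(2,\mathbb{Z})$ acts on $\Omega$ by acting on the plane about the origin, moving the tiles and transforming their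 arrows accordingly (for example, the counterclockwise rotation by 90 degrees sends an NE arrow to an NW arrow, and reflection about the $x$ axis interchanges NE with SE and NW with SW). $\check H^*$ denotes Čech cohomology with integer coefficients, and $\mathbb{Z}[1/2]=\varinjlim(\mathbb{Z},\times 2)$ is the additive group of dyadic rationals. *)

theory Defs
  imports "HOL-Analysis.Analysis" "HOL-Algebra.Generated_Groups"
begin

section \<open>Labeled unit squares and tilings\<close>

datatype arrow = NE | NW | SW | SE

fun arrow_dir :: "arrow \<Rightarrow> real^2" where
  "arrow_dir NE = vector [1, 1]"
| "arrow_dir NW = vector [-1, 1]"
| "arrow_dir SW = vector [-1, -1]"
| "arrow_dir SE = vector [1, -1]"

text \<open>A tile is given by the centre of its square and its label.\<close>

type_synonym tile = "(real^2) \<times> arrow"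

definition tile_supp :: "tile \<Rightarrow> (real^2) set" where
  "tile_supp t = cbox (fst t - vec (1/2)) (fst t + vec (1/2))"

text \<open>The face condition says that two distinct tiles are disjoint or share a vertex or a
  full edge.\<close>

definition is_tiling :: "tile set \<Rightarrow> bool" where
  "is_tiling T \<longleftrightarrow>
     (\<Union>t\<in>T. tile_supp t) = UNIV \<and>
     (\<forall>s\<in>T. \<forall>t\<in>T. s \<noteq> t \<longrightarrow>
        interior (tile_supp s) \<inter> interior (tile_supp t) = {} \<and>
        (tile_supp s \<inter> tile_supp t) face_of tile_supp s \<and>
        (tile_supp s \<inter> tile_supp t) face_of tile_supp t)"

definition translate :: "real^2 \<Rightarrow> tile set \<Rightarrow> tile set" where
  "translate v P = (\<lambda>(c, a). (c + v, a)) ` P"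

section \<open>The chair substitution\<close>

text \<open>\<open>sub_label a q\<close> is the label of the quarter in position \<open>q\<close> (\<open>NE\<close> = top-right, etc.) of an
  inflated tile labeled \<open>a\<close>.\<close>

fun sub_label :: "arrow \<Rightarrow> arrow \<Rightarrow> arrow" where
  "sub_label NE NW = SE" | "sub_label NE NE = NE" | "sub_label NE SW = NE" | "sub_label NE SE = NW"
| "sub_label NW NE = SW" | "sub_label NW NW = NW" | "sub_label NW SE = NW" | "sub_label NW SW = NE"
| "sub_label SW SE = NW" | "sub_label SW SW = SW" | "sub_label SW NE = SW" | "sub_label SW NW = SE"
| "sub_label SE SW = NE" | "sub_label SE SE = SE" | "sub_label SE NW = SE" | "sub_label SE NE = SW"

definition subst_tile :: "tile \<Rightarrow> tile set" where
  "subst_tile t = range (\<lambda>q. (2 *\<^sub>R fst t + (1/2) *\<^sub>R arrow_dir q, sub_label (snd t) q))"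

definition chair_subst :: "tile set \<Rightarrow> tile set" where
  "chair_subst P = (\<Union>t\<in>P. subst_tile t)"

section \<open>The tiling space\<close>

definition chair_tilings :: "tile set set" where
  "chair_tilings = {T. is_tiling T \<and>
     (\<forall>P. P \<subseteq> T \<and> finite P \<longrightarrow>
        (\<exists>t n v Q. Q \<subseteq> (chair_subst ^^ n) {t} \<and> P = translate v Q))}"

definition patch_at :: "real \<Rightarrow> tile set \<Rightarrow> tile set" where
  "patch_at r T = {t \<in> T. tile_supp t \<inter> cball 0 r \<noteq> {}}"

definition tiling_close :: "real \<Rightarrow> tile set \<Rightarrow> tile set \<Rightarrow> bool" where
  "tiling_close \<epsilon> S T \<longleftrightarrow>
     (\<exists>x y. norm x \<le> \<epsilon> \<and> norm y \<le> \<epsilon> \<and>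
        patch_at (1/\<epsilon>) (translate x S) = patch_at (1/\<epsilon>) (translate y T))"

definition chair_space :: "tile set topology" where
  "chair_space = topology (\<lambda>U. U \<subseteq> chair_tilings \<and>
     (\<forall>S\<in>U. \<exists>\<epsilon>>0. \<forall>T\<in>chair_tilings. tiling_close \<epsilon> S T \<longrightarrow> T \<in> U))"

lemma tiling_close_mono:
  assumes "tiling_close d S T" "0 < d" "d \<le> e"
  shows "tiling_close e S T"
proof -
  obtain x y where xy: "norm x \<le> d" "norm y \<le> d"
    and eq: "patch_at (1/d) (translate x S) = patch_at (1/d) (translate y T)"
    using assms(1) by (auto simp: tiling_close_def)
  have "1/e \<le> 1/d" using assms by (simp add: frac_le)
  then have "cball (0::real^2) (1/e) \<subseteq> cball 0 (1/d)" by auto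
  then have sub: "patch_at (1/e) V = {t \<in> patch_at (1/d) V. tile_supp t \<inter> cball 0 (1/e) \<noteq> {}}" for V
    unfolding patch_at_def by blast
  have "patch_at (1/e) (translate x S) = patch_at (1/e) (translate y T)"
    unfolding sub[of "translate x S"] sub[of "translate y T"] eq ..
  then show ?thesis unfolding tiling_close_def using xy assms(3) by (meson order_trans)
qed

lemma openin_chair_space:
  "openin chair_space U \<longleftrightarrow> U \<subseteq> chair_tilings \<and>
     (\<forall>S\<in>U. \<exists>\<epsilon>>0. \<forall>T\<in>chair_tilings. tiling_close \<epsilon> S T \<longrightarrow> T \<in> U)"
proof -
  define L where "L = (\<lambda>U. U \<subseteq> chair_tilings \<and>
     (\<forall>S\<in>U. \<exists>\<epsilon>>0. \<forall>T\<in>chair_tilings. tiling_close \<epsilon> S T \<longrightarrow> T \<in> U))"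
  have "istopology L"
    unfolding istopology_def
  proof (intro conjI allI impI)
    fix U V assume UV: "L U" "L V"
    have "\<exists>\<epsilon>>0. \<forall>T\<in>chair_tilings. tiling_close \<epsilon> S T \<longrightarrow> T \<in> U \<inter> V" if "S \<in> U \<inter> V" for S
    proof -
      obtain d e where "d > 0" "e > 0"
        and d: "\<forall>T\<in>chair_tilings. tiling_close d S T \<longrightarrow> T \<in> U"
        and e: "\<forall>T\<in>chair_tilings. tiling_close e S T \<longrightarrow> T \<in> V"
        using UV \<open>S \<in> U \<inter> V\<close> unfolding L_def by blast
      then show ?thesis
        using tiling_close_mono[of "min d e" S _ d] tiling_close_mono[of "min d e" S _ e]
        by (intro exI[of _ "min d e"]) auto
    qed
    then show "L (U \<inter> V)" using UV unfolding L_def by blast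
  next
    fix K assume K: "\<forall>U\<in>K. L U"
    show "L (\<Union>K)"
      unfolding L_def
    proof (intro conjI ballI)
      show "\<Union>K \<subseteq> chair_tilings" using K unfolding L_def by blast
      fix S assume "S \<in> \<Union>K"
      then obtain U where "U \<in> K" "S \<in> U" by blast
      then obtain e where "e > 0" "\<forall>T\<in>chair_tilings. tiling_close e S T \<longrightarrow> T \<in> U"
        using K unfolding L_def by blast
      then show "\<exists>\<epsilon>>0. \<forall>T\<in>chair_tilings. tiling_close \<epsilon> S T \<longrightarrow> T \<in> \<Union>K"
        using \<open>U \<in> K\<close> by blast
    qed
  qed
  then show ?thesis unfolding chair_space_def by (simp add: L_def topology_inverse')
qed

lemma topspace_chair_space: "topspace chair_space = chair_tilings"
proof -
  have "openin chair_space chair_tilings"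
    by (auto simp: openin_chair_space intro: exI[of _ 1])
  then show ?thesis
    using openin_subset openin_chair_space[of "topspace chair_space"] by blast
qed

section \<open>The action of the integral orthogonal group\<close>

definition O2Z :: "(real^2^2) monoid" where
  "O2Z = \<lparr>carrier = {A. orthogonal_matrix A \<and> (\<forall>i j. A $ i $ j \<in> \<int>)},
          monoid.mult = (**), one = mat 1\<rparr>"

definition act_arrow :: "real^2^2 \<Rightarrow> arrow \<Rightarrow> arrow" where
  "act_arrow A a = (THE b. arrow_dir b = A *v arrow_dir a)"

definition act_tile :: "real^2^2 \<Rightarrow> tile \<Rightarrow> tile" where
  "act_tile A t = (A *v fst t, act_arrow A (snd t))"

definition act_tiling :: "real^2^2 \<Rightarrow> tile set \<Rightarrow> tile set" where
  "act_tiling A T = act_tile A ` T"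

definition fixed_space :: "(real^2^2) set \<Rightarrow> tile set topology" where
  "fixed_space H = subtopology chair_space {T. \<forall>A\<in>H. act_tiling A T = T}"

definition rot90 :: "real^2^2" where
  "rot90 = vector [vector [0, -1], vector [1, 0]]"

definition refl_x :: "real^2^2" where
  "refl_x = vector [vector [1, 0], vector [0, -1]]"

definition refl_y :: "real^2^2" where
  "refl_y = vector [vector [-1, 0], vector [0, 1]]"

definition H5 :: "(real^2^2) set" where "H5 = generate O2Z {refl_x}"

definition H6 :: "(real^2^2) set" where "H6 = generate O2Z {refl_y}"

lemma inj_arrow_dir: "arrow_dir a = arrow_dir b \<longleftrightarrow> a = b"
  by (cases a; cases b) (auto simp: vec_eq_iff forall_2)

lemma act_arrow_eqI: "arrow_dir b = A *v arrow_dir a \<Longrightarrow> act_arrow A a = b"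
  unfolding act_arrow_def by (rule the_equality) (auto simp flip: inj_arrow_dir)

lemma act_arrow_rot90:
  "act_arrow rot90 NE = NW" "act_arrow rot90 NW = SW"
  "act_arrow rot90 SW = SE" "act_arrow rot90 SE = NE"
  by (auto intro!: act_arrow_eqI
      simp: rot90_def vec_eq_iff forall_2 matrix_vector_mult_def sum_2)

lemma act_arrow_refl_x:
  "act_arrow refl_x NE = SE" "act_arrow refl_x SE = NE"
  "act_arrow refl_x NW = SW" "act_arrow refl_x SW = NW"
  by (auto intro!: act_arrow_eqI
      simp: refl_x_def vec_eq_iff forall_2 matrix_vector_mult_def sum_2)

lemma act_arrow_refl_y:
  "act_arrow refl_y NE = NW" "act_arrow refl_y NW = NE"
  "act_arrow refl_y SE = SW" "act_arrow refl_y SW = SE"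
  by (auto intro!: act_arrow_eqI
      simp: refl_y_def vec_eq_iff forall_2 matrix_vector_mult_def sum_2)

text \<open>The table \<open>sub_label\<close> is the one obtained from its \<open>NE\<close> rows by symmetry: rotation and
  reflection generate the whole group.\<close>

lemma sub_label_rot90:
  "sub_label (act_arrow rot90 a) (act_arrow rot90 q) = act_arrow rot90 (sub_label a q)"
  by (cases a; cases q) (simp_all add: act_arrow_rot90)

lemma sub_label_refl_x:
  "sub_label (act_arrow refl_x a) (act_arrow refl_x q) = act_arrow refl_x (sub_label a q)"
  by (cases a; cases q) (simp_all add: act_arrow_refl_x)

lemma generate_involution:
  assumes g: "g ** g = (mat 1 :: real^2^2)" and c: "g \<in> carrier O2Z"
  shows "generate O2Z {g} = {mat 1, g}"
proof
  have inv: "inv\<^bsub>O2Z\<^esub> g = g"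
    unfolding m_inv_def
  proof (rule the_equality)
    fix y assume "y \<in> carrier O2Z \<and> g \<otimes>\<^bsub>O2Z\<^esub> y = \<one>\<^bsub>O2Z\<^esub> \<and> y \<otimes>\<^bsub>O2Z\<^esub> g = \<one>\<^bsub>O2Z\<^esub>"
    then have "g ** y = mat 1" by (simp add: O2Z_def)
    then have "g ** (g ** y) = g" by simp
    then show "y = g" by (simp add: matrix_mul_assoc g)
  qed (use g c in \<open>simp add: O2Z_def\<close>)
  have "A = mat 1 \<or> A = g" if "A \<in> generate O2Z {g}" for A
    using that
  proof induction
    case one then show ?case by (simp add: O2Z_def)
  next
    case (incl h) then show ?case by simp
  next
    case (inv h) then show ?case using \<open>inv\<^bsub>O2Z\<^esub> g = g\<close> by simp
  next
    case (eng h1 h2) then show ?case using g by (auto simp: O2Z_def)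
  qed
  then show "generate O2Z {g} \<subseteq> {mat 1, g}" by blast
  have "mat 1 \<in> generate O2Z {g}" using generate.one[of O2Z "{g}"] by (simp add: O2Z_def)
  then show "{mat 1, g} \<subseteq> generate O2Z {g}" by (auto intro: generate.incl)
qed

lemma H5_eq: "H5 = {mat 1, refl_x}"
  unfolding H5_def
  by (rule generate_involution)
    (auto simp: refl_x_def O2Z_def orthogonal_matrix vec_eq_iff forall_2 matrix_matrix_mult_def
      sum_2 mat_def transpose_def)

lemma H6_eq: "H6 = {mat 1, refl_y}"
  unfolding H6_def
  by (rule generate_involution)
    (auto simp: refl_y_def O2Z_def orthogonal_matrix vec_eq_iff forall_2 matrix_matrix_mult_def
      sum_2 mat_def transpose_def)

section \<open>The dyadic solenoid\<close>

definition RZ_class :: "real \<Rightarrow> real set" where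
  "RZ_class x = {x + of_int k |k. True}"

definition RZ :: "real set topology" where
  "RZ = topology (\<lambda>U. U \<subseteq> range RZ_class \<and> open (RZ_class -` U))"

definition RZ_double :: "real set \<Rightarrow> real set" where
  "RZ_double C = (\<Union>x\<in>C. RZ_class (2 * x))"

definition dyadic_solenoid :: "(nat \<Rightarrow> real set) topology" where
  "dyadic_solenoid =
     subtopology (product_topology (\<lambda>_. RZ) UNIV) {s. \<forall>n. s n = RZ_double (s (Suc n))}"

lemma openin_RZ: "openin RZ U \<longleftrightarrow> U \<subseteq> range RZ_class \<and> open (RZ_class -` U)"
proof -
  have "istopology (\<lambda>U. U \<subseteq> range RZ_class \<and> open (RZ_class -` U))"
    unfolding istopology_def by (auto simp: vimage_Union)
  then show ?thesis unfolding RZ_def by (simp add: topology_inverse')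
qed

lemma topspace_RZ: "topspace RZ = range RZ_class"
proof -
  have "RZ_class -` range RZ_class = UNIV" by auto
  then have "openin RZ (range RZ_class)" by (simp add: openin_RZ)
  then show ?thesis using openin_subset openin_RZ[of "topspace RZ"] by blast
qed

lemma quotient_map_RZ_class: "quotient_map euclideanreal RZ RZ_class"
  unfolding quotient_map_def by (auto simp: topspace_RZ openin_RZ vimage_def)

lemma mem_RZ_class: "y \<in> RZ_class x \<longleftrightarrow> y - x \<in> \<int>"
proof
  assume "y - x \<in> \<int>"
  then obtain k where "y - x = of_int k" by (auto elim: Ints_cases)
  then have "y = x + of_int k" by simp
  then show "y \<in> RZ_class x" unfolding RZ_class_def by blast
qed (auto simp: RZ_class_def)

lemma RZ_class_eq_iff: "RZ_class x = RZ_class y \<longleftrightarrow> x - y \<in> \<int>"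
proof
  assume "RZ_class x = RZ_class y"
  then show "x - y \<in> \<int>" using mem_RZ_class[of x x] mem_RZ_class[of x y] by simp
next
  assume xy: "x - y \<in> \<int>"
  have "z - x \<in> \<int> \<longleftrightarrow> z - y \<in> \<int>" for z
    using Ints_add[OF _ xy, of "z - x"] Ints_diff[OF _ xy, of "z - y"] by auto
  then show "RZ_class x = RZ_class y" by (auto simp: mem_RZ_class)
qed

lemma RZ_double_class: "RZ_double (RZ_class x) = RZ_class (2 * x)"
proof -
  have "RZ_class (2 * y) = RZ_class (2 * x)" if "y \<in> RZ_class x" for y
  proof -
    have "2 * (y - x) \<in> \<int>" using that by (intro Ints_mult) (auto simp: mem_RZ_class)
    then show ?thesis by (simp add: RZ_class_eq_iff algebra_simps)
  qed
  moreover have "x \<in> RZ_class x" by (simp add: mem_RZ_class)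
  ultimately show ?thesis unfolding RZ_double_def by blast
qed

section \<open>Cech cohomology with integer coefficients\<close>

text \<open>Direct limit of groups \<open>G i\<close>, \<open>i \<in> I\<close>, with transition maps \<open>\<phi> i j : G i \<rightarrow> G j\<close> for
  \<open>R i j\<close>, where \<open>(I, R)\<close> is a directed preorder.\<close>

definition dirlim_rel ::
  "'i set \<Rightarrow> ('i \<Rightarrow> 'i \<Rightarrow> bool) \<Rightarrow> ('i \<Rightarrow> 'g monoid) \<Rightarrow> ('i \<Rightarrow> 'i \<Rightarrow> 'g \<Rightarrow> 'g) \<Rightarrow>
    (('i \<times> 'g) \<times> ('i \<times> 'g)) set" where
  "dirlim_rel I R G \<phi> =
     {((i, x), (j, y)) | i x j y.
        i \<in> I \<and> x \<in> carrier (G i) \<and> j \<in> I \<and> y \<in> carrier (G j) \<and>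
        (\<exists>k\<in>I. R i k \<and> R j k \<and> \<phi> i k x = \<phi> j k y)}"

definition direct_limit ::
  "'i set \<Rightarrow> ('i \<Rightarrow> 'i \<Rightarrow> bool) \<Rightarrow> ('i \<Rightarrow> 'g monoid) \<Rightarrow> ('i \<Rightarrow> 'i \<Rightarrow> 'g \<Rightarrow> 'g) \<Rightarrow>
    ('i \<times> 'g) set monoid" where
  "direct_limit I R G \<phi> =
     \<lparr>carrier = (SIGMA i:I. carrier (G i)) // dirlim_rel I R G \<phi>,
      monoid.mult = (\<lambda>A B. \<Union>{dirlim_rel I R G \<phi> `` {(k, \<phi> i k x \<otimes>\<^bsub>G k\<^esub> \<phi> j k y)} | i x j y k.
          (i, x) \<in> A \<and> (j, y) \<in> B \<and> k \<in> I \<and> R i k \<and> R j k}),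
      one = \<Union>{dirlim_rel I R G \<phi> `` {(i, \<one>\<^bsub>G i\<^esub>)} | i. i \<in> I}\<rparr>"

text \<open>Ordered simplices of the nerve of a cover \<open>\<U>\<close>: tuples of members with common point.\<close>

definition nerve_simplices :: "'a set set \<Rightarrow> nat \<Rightarrow> 'a set list set" where
  "nerve_simplices \<U> p = {s. length s = Suc p \<and> set s \<subseteq> \<U> \<and> \<Inter>(set s) \<noteq> {}}"

definition cech_cochains :: "'a set set \<Rightarrow> nat \<Rightarrow> ('a set list \<Rightarrow> int) set" where
  "cech_cochains \<U> p = {c. \<forall>s. s \<notin> nerve_simplices \<U> p \<longrightarrow> c s = 0}"

definition cech_delta ::
  "'a set set \<Rightarrow> nat \<Rightarrow> ('a set list \<Rightarrow> int) \<Rightarrow> 'a set list \<Rightarrow> int" where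
  "cech_delta \<U> p c = (\<lambda>s. if s \<in> nerve_simplices \<U> (Suc p)
      then \<Sum>i\<le>Suc p. (-1) ^ i * c (take i s @ drop (Suc i) s) else 0)"

definition cech_cocycles :: "'a set set \<Rightarrow> nat \<Rightarrow> ('a set list \<Rightarrow> int) monoid" where
  "cech_cocycles \<U> p =
     \<lparr>carrier = {c \<in> cech_cochains \<U> p. cech_delta \<U> p c = (\<lambda>_. 0)},
      monoid.mult = (\<lambda>c d s. c s + d s), one = (\<lambda>_. 0)\<rparr>"

fun cech_coboundaries :: "'a set set \<Rightarrow> nat \<Rightarrow> ('a set list \<Rightarrow> int) set" where
  "cech_coboundaries \<U> 0 = {\<lambda>_. 0}"
| "cech_coboundaries \<U> (Suc p) = cech_delta \<U> p ` cech_cochains \<U> p"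

definition nerve_cohomology :: "nat \<Rightarrow> 'a set set \<Rightarrow> ('a set list \<Rightarrow> int) set monoid" where
  "nerve_cohomology p \<U> = cech_cocycles \<U> p Mod cech_coboundaries \<U> p"

definition open_covers :: "'a topology \<Rightarrow> 'a set set set" where
  "open_covers X = {\<U>. (\<forall>U\<in>\<U>. openin X U) \<and> \<Union>\<U> = topspace X}"

definition refined_by :: "'a set set \<Rightarrow> 'a set set \<Rightarrow> bool" where
  "refined_by \<U> \<V> \<longleftrightarrow> (\<forall>V\<in>\<V>. \<exists>U\<in>\<U>. V \<subseteq> U)"

text \<open>A refinement map is chosen; the induced map in cohomology does not depend on the choice.\<close>

definition refinement_map :: "'a set set \<Rightarrow> 'a set \<Rightarrow> 'a set" where
  "refinement_map \<U> V = (SOME U. U \<in> \<U> \<and> V \<subseteq> U)"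

definition cech_pullback ::
  "nat \<Rightarrow> 'a set set \<Rightarrow> 'a set set \<Rightarrow> ('a set list \<Rightarrow> int) \<Rightarrow> 'a set list \<Rightarrow> int" where
  "cech_pullback p \<U> \<V> c =
     (\<lambda>s. if s \<in> nerve_simplices \<V> p then c (map (refinement_map \<U>) s) else 0)"

definition cech_transition ::
  "nat \<Rightarrow> 'a set set \<Rightarrow> 'a set set \<Rightarrow> ('a set list \<Rightarrow> int) set \<Rightarrow> ('a set list \<Rightarrow> int) set" where
  "cech_transition p \<U> \<V> C =
     (\<Union>c\<in>C. cech_coboundaries \<V> p #>\<^bsub>cech_cocycles \<V> p\<^esub> cech_pullback p \<U> \<V> c)"

definition cech_cohomology ::
  "nat \<Rightarrow> 'a topology \<Rightarrow> ('a set set \<times> ('a set list \<Rightarrow> int) set) set monoid" where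
  "cech_cohomology p X =
     direct_limit (open_covers X) refined_by (nerve_cohomology p) (cech_transition p)"

section \<open>The additive group of dyadic rationals\<close>

definition dyadic_rationals :: "rat monoid" where
  "dyadic_rationals =
     \<lparr>carrier = {of_int m / 2 ^ n | (m::int) (n::nat). True}, monoid.mult = (+), one = 0\<rparr>"

end

theory Submission
  imports Defs
begin

text \<open>
  The substitution rule reads \<open>sub_label a q = a\<close> if \<open>q = a\<close>, and otherwise the arrow opposite to
  \<open>q\<close>.  In a tiling that is symmetric about the horizontal axis, the axis lies on the boundary of
  the supertiles of every level, because a supertile straddling it would have to carry a symmetric
  label.  A tile above the axis whose arrow points down to the axis is excluded by the possible
  vertex stars.  So the rows next to the axis, at every level, alternate between the same two
  labels, and the tiling is determined by the horizontal positions of its supertiles of all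
  levels, that is, by a point of the dyadic solenoid.  Every point occurs, and the resulting
  continuous bijection from the compact solenoid to the Hausdorff space of symmetric tilings is a
  homeomorphism.

  In cohomology, the covers of the solenoid by preimages of short arcs under the \<open>n\<close>-th coordinate
  are cofinal.  Summing a cocycle once around the arcs of level \<open>n\<close> gives an integer which doubles
  from one level to the next.  Dividing it by \<open>2\<^sup>n\<close> gives an invariant with values in \<open>\<int>[1/2]\<close> that
  identifies the direct limit.
\<close>


text \<open>Legality constrains finite patches only, and different patches may come from unrelated
  supertiles, so desubstituting a whole tiling needs a compactness argument over the four possible
  positions of a parent. All tiles of a legal patch differ by integer vectors; a tiling is therefore
  a labelling of one coset of the integer lattice, and an inclusion of such labellings is already an
  equality. The solenoid coordinates have a concrete meaning: coordinate \<open>n\<close> is the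
  class modulo 1 of the left edges of the tiles in the \<open>n\<close>-fold desubstitution. The
  rows next to the axis alternate with period 2, so the labels at level \<open>n\<close> are placed
  by coordinate \<open>n + 1\<close>; this is the index shift in \<open>sol_tiling\<close>. In
  cohomology, the circle of coordinate \<open>n + 1\<close> covers that of coordinate
  \<open>n\<close> twice, which is where the doubling comes from.\<close>

definition int_vec :: "real^2 \<Rightarrow> bool" where
  "int_vec v \<longleftrightarrow> v $ 1 \<in> \<int> \<and> v $ 2 \<in> \<int>"

lemma vec2_eq_iff: "x = y \<longleftrightarrow> x $ 1 = y $ 1 \<and> x $ 2 = y $ 2" for x y :: "'a^2"
  by (simp add: vec_eq_iff forall_2)

lemma int_vec_0 [simp]: "int_vec 0"
  by (simp add: int_vec_def)

lemma int_vec_add: "int_vec u \<Longrightarrow> int_vec v \<Longrightarrow> int_vec (u + v)"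
  by (simp add: int_vec_def)

lemma int_vec_minus: "int_vec u \<Longrightarrow> int_vec (- u)"
  by (simp add: int_vec_def)

lemma int_vec_diff_sym: "int_vec (c - d) \<Longrightarrow> int_vec (d - c)"
  using int_vec_minus[of "c - d"] by simp

lemma int_vec_diff_trans: "int_vec (c - d) \<Longrightarrow> int_vec (d - e) \<Longrightarrow> int_vec (c - e)"
  using int_vec_add[of "c - d" "d - e"] by simp

lemma Ints_less_one: "x \<in> \<int> \<Longrightarrow> \<bar>x\<bar> < 1 \<Longrightarrow> x = 0" for x :: real
  by (metis Ints_0 Ints_eq_abs_less1 diff_zero)

lemma int_vec_small: "int_vec v \<Longrightarrow> \<bar>v $ 1\<bar> < 1 \<Longrightarrow> \<bar>v $ 2\<bar> < 1 \<Longrightarrow> v = 0"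
  by (simp add: int_vec_def vec2_eq_iff Ints_less_one)

lemma arrow_dir_nth [simp]:
  "arrow_dir NE $ 1 = 1" "arrow_dir NE $ 2 = 1" "arrow_dir NW $ 1 = -1" "arrow_dir NW $ 2 = 1"
  "arrow_dir SW $ 1 = -1" "arrow_dir SW $ 2 = -1" "arrow_dir SE $ 1 = 1" "arrow_dir SE $ 2 = -1"
  by simp_all

declare arrow_dir.simps [simp del]

subsection \<open>Patches\<close>

definition patchy :: "tile set \<Rightarrow> bool" where
  "patchy P \<longleftrightarrow> (\<forall>s\<in>P. \<forall>t\<in>P. int_vec (fst s - fst t) \<and> (fst s = fst t \<longrightarrow> s = t))"

lemma patchyD:
  assumes "patchy P" "(c, a) \<in> P" "(d, b) \<in> P"
  shows "int_vec (c - d)" "c = d \<Longrightarrow> a = b"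
  using assms unfolding patchy_def by force+

lemma patchy_subset: "patchy P \<Longrightarrow> Q \<subseteq> P \<Longrightarrow> patchy Q"
  unfolding patchy_def by blast

abbreviation child :: "real^2 \<Rightarrow> arrow \<Rightarrow> real^2" where
  "child c q \<equiv> 2 *\<^sub>R c + (1/2) *\<^sub>R arrow_dir q"

lemma in_chair_subst:
  "(d, l) \<in> chair_subst P \<longleftrightarrow> (\<exists>c a q. (c, a) \<in> P \<and> d = child c q \<and> l = sub_label a q)"
  unfolding chair_subst_def subst_tile_def by force

lemma child_in_subst: "(c, a) \<in> P \<Longrightarrow> (child c q, sub_label a q) \<in> chair_subst P"
  unfolding in_chair_subst by blast

text \<open>Quarter offsets differ by at most 1 in each coordinate, so the parents differ by at most
  1/2; on an integer lattice they coincide.\<close>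

lemma child_unique:
  assumes "int_vec (c - d)" "child c q = child d r"
  shows "c = d" "q = r"
proof -
  have e: "2 * (c$1 - d$1) = (arrow_dir r $ 1 - arrow_dir q $ 1) / 2"
       "2 * (c$2 - d$2) = (arrow_dir r $ 2 - arrow_dir q $ 2) / 2"
    using assms(2) by (simp_all add: vec2_eq_iff)
  have "c - d = 0"
    by (rule int_vec_small[OF assms(1)]; use e in \<open>cases q; cases r; simp\<close>)
  then show "c = d" by simp
  then have "arrow_dir q = arrow_dir r" using assms(2) by simp
  then show "q = r" by (simp add: inj_arrow_dir)
qed

lemma int_vec_child: "int_vec (c - d) \<Longrightarrow> int_vec (child c q - child d r)"
proof -
  assume "int_vec (c - d)"
  then have "2 * (c$1 - d$1) \<in> \<int>" "2 * (c$2 - d$2) \<in> \<int>"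
    by (auto simp: int_vec_def simp del: right_diff_distrib_numeral intro!: Ints_mult)
  moreover have "(arrow_dir q $ i - arrow_dir r $ i) / 2 \<in> \<int>" for i
    using exhaust_2[of i] by (cases q; cases r) auto
  ultimately have "2 * (c$i - d$i) + (arrow_dir q $ i - arrow_dir r $ i) / 2 \<in> \<int>" for i
    using exhaust_2[of i] by (auto simp del: right_diff_distrib_numeral intro!: Ints_add)
  moreover have "(child c q - child d r) $ i = 2 * (c$i - d$i) + (arrow_dir q $ i - arrow_dir r $ i) / 2" for i
    by (simp add: field_simps)
  ultimately show ?thesis
    unfolding int_vec_def by metis
qed

text \<open>This lets equalities between substituted patches be pulled back to the parents.\<close>

lemma sub_label_inj: "(\<And>q. sub_label a q = sub_label b q) \<Longrightarrow> a = b"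
proof -
  assume *: "\<And>q. sub_label a q = sub_label b q"
  show ?thesis using *[of NE] *[of NW] *[of SW] *[of SE] by (cases a; cases b; simp)
qed

lemma patchy_subst:
  assumes "patchy P" shows "patchy (chair_subst P)"
  unfolding patchy_def
proof (clarify, rule conjI)
  fix d l e m
  assume "(d, l) \<in> chair_subst P" "(e, m) \<in> chair_subst P"
  then obtain c a q c' a' q' where *: "(c, a) \<in> P" "d = child c q" "l = sub_label a q"
      "(c', a') \<in> P" "e = child c' q'" "m = sub_label a' q'"
    unfolding in_chair_subst by blast
  have i: "int_vec (c - c')" using patchyD assms * by blast
  then show "int_vec (fst (d, l) - fst (e, m))" using * int_vec_child by simp
  show "fst (d, l) = fst (e, m) \<longrightarrow> (d, l) = (e, m)"
  proof
    assume "fst (d, l) = fst (e, m)"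
    then have de: "d = e" by simp
    then have "c = c'" "q = q'" using child_unique[OF i, of q q'] * by simp_all
    then show "(d, l) = (e, m)" using patchyD(2)[OF assms *(1) *(4)] * de by simp
  qed
qed

lemma patchy_translate: "patchy P \<Longrightarrow> patchy (translate v P)"
  unfolding patchy_def translate_def by (force simp: case_prod_beta prod_eq_iff)

lemma patchy_single: "patchy {t}"
  by (simp add: patchy_def)

lemma patchy_iterate: "patchy P \<Longrightarrow> patchy ((chair_subst ^^ n) P)"
  by (induction n) (auto simp: patchy_subst)

lemma mem_translate: "(d, l) \<in> translate v P \<longleftrightarrow> (d - v, l) \<in> P"
  unfolding translate_def by force

lemma translate_translate: "translate u (translate v P) = translate (v + u) P"
  by (auto simp: mem_translate algebra_simps)

lemma translate_0 [simp]: "translate 0 P = P"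
  by (auto simp: mem_translate)

lemma translate_mono: "P \<subseteq> Q \<Longrightarrow> translate v P \<subseteq> translate v Q"
  unfolding translate_def by blast

lemma subst_translate: "chair_subst (translate v P) = translate (2 *\<^sub>R v) (chair_subst P)"
proof -
  have "(\<exists>c a q. (c - v, a) \<in> P \<and> d = child c q \<and> l = sub_label a q) \<longleftrightarrow>
     (\<exists>c a q. (c, a) \<in> P \<and> d - 2 *\<^sub>R v = child c q \<and> l = sub_label a q)" (is "?L \<longleftrightarrow> ?R") for d l
  proof
    assume ?L then obtain c a q where "(c - v, a) \<in> P" "d = child c q" "l = sub_label a q" by blast
    then show ?R by (intro exI[of _ "c - v"]) (auto simp: algebra_simps)
  next
    assume ?R then obtain c a q where "(c, a) \<in> P" "d - 2 *\<^sub>R v = child c q" "l = sub_label a q" by blast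
    then show ?L by (intro exI[of _ "c + v"] exI[of _ a] exI[of _ q]) (auto simp: algebra_simps)
  qed
  then show ?thesis
    by (auto simp: in_chair_subst mem_translate)
qed

lemma iterate_translate:
  "(chair_subst ^^ n) (translate v P) = translate (2 ^ n *\<^sub>R v) ((chair_subst ^^ n) P)"
  by (induction n) (auto simp: subst_translate)

lemma subst_mono: "P \<subseteq> Q \<Longrightarrow> chair_subst P \<subseteq> chair_subst Q"
  unfolding chair_subst_def by blast

lemma iterate_mono: "P \<subseteq> Q \<Longrightarrow> (chair_subst ^^ n) P \<subseteq> (chair_subst ^^ n) Q"
  by (induction n) (auto dest: subst_mono)

lemma subst_UN: "chair_subst (\<Union>i\<in>I. P i) = (\<Union>i\<in>I. chair_subst (P i))"
  unfolding chair_subst_def by blast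

lemma iterate_UN: "(chair_subst ^^ n) (\<Union>i\<in>I. P i) = (\<Union>i\<in>I. (chair_subst ^^ n) (P i))"
  by (induction n) (auto simp: subst_UN)

lemma finite_arrow: "finite (UNIV :: arrow set)"
proof -
  have "(UNIV :: arrow set) \<subseteq> {NE, NW, SW, SE}" using arrow.exhaust by blast
  then show ?thesis by (rule finite_subset) simp
qed

lemma finite_subst: "finite P \<Longrightarrow> finite (chair_subst P)"
  unfolding chair_subst_def subst_tile_def using finite_arrow by simp

subsection \<open>Chair tilings\<close>

definition legal :: "tile set \<Rightarrow> bool" where
  "legal P \<longleftrightarrow> (\<exists>t n v. P \<subseteq> translate v ((chair_subst ^^ n) {t}))"

lemma legal_iff: "legal P \<longleftrightarrow> (\<exists>t n v Q. Q \<subseteq> (chair_subst ^^ n) {t} \<and> P = translate v Q)"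
  unfolding legal_def translate_def by (simp add: subset_image_iff)

lemma legal_subset: "legal P \<Longrightarrow> Q \<subseteq> P \<Longrightarrow> legal Q"
  unfolding legal_def by blast

lemma legal_translate: "legal P \<Longrightarrow> legal (translate u P)"
proof -
  assume "legal P"
  then obtain t n v where "P \<subseteq> translate v ((chair_subst ^^ n) {t})" unfolding legal_def by blast
  then have "translate u P \<subseteq> translate (v + u) ((chair_subst ^^ n) {t})"
    using translate_mono translate_translate by metis
  then show ?thesis unfolding legal_def by blast
qed

lemma legal_subst: "legal P \<Longrightarrow> legal (chair_subst P)"
proof -
  assume "legal P"
  then obtain t n v where "P \<subseteq> translate v ((chair_subst ^^ n) {t})" unfolding legal_def by blast
  then have "chair_subst P \<subseteq> translate (2 *\<^sub>R v) ((chair_subst ^^ Suc n) {t})"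
    by (simp flip: subst_translate add: subst_mono)
  then show ?thesis unfolding legal_def by blast
qed

lemma legal_iterate: "legal P \<Longrightarrow> legal ((chair_subst ^^ n) P)"
  by (induction n) (auto simp: legal_subst)

lemma legal_patchy: "legal P \<Longrightarrow> patchy P"
  unfolding legal_def using patchy_subset patchy_translate patchy_iterate patchy_single by meson

text \<open>The combinatorial form of a tiling by unit squares meeting edge to edge: a full coset of
  the integer lattice with one label at each site.\<close>

definition gridded :: "tile set \<Rightarrow> bool" where
  "gridded T \<longleftrightarrow> patchy T \<and> T \<noteq> {} \<and> (\<forall>t\<in>T. \<forall>c. int_vec (c - fst t) \<longrightarrow> (\<exists>a. (c, a) \<in> T))"

lemma griddedD: "gridded T \<Longrightarrow> (c, a) \<in> T \<Longrightarrow> int_vec (d - c) \<Longrightarrow> \<exists>b. (d, b) \<in> T"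
  unfolding gridded_def by force

text \<open>Every site is already occupied in \<open>T\<close>, so a consistent larger set has no
  room for further tiles.\<close>

lemma gridded_eq:
  assumes "gridded T" "patchy S" "T \<subseteq> S" shows "T = S"
proof -
  obtain c a where ca: "(c, a) \<in> T" using assms(1) unfolding gridded_def by force
  have "(d, b) \<in> T" if "(d, b) \<in> S" for d b
  proof -
    have "int_vec (d - c)" using patchyD(1) assms ca that by blast
    then obtain b' where "(d, b') \<in> T" using griddedD assms(1) ca by blast
    moreover have "b' = b" using patchyD(2)[OF assms(2)] calculation that assms(3) by blast
    ultimately show ?thesis by simp
  qed
  then show ?thesis using assms(3) by auto
qed

section \<open>Geometry of unit squares at integer offsets\<close>

lemma mem_tile_supp:
  "x \<in> tile_supp t \<longleftrightarrow> (x - fst t)$1 \<le> 1/2 \<and> -1/2 \<le> (x - fst t)$1 \<and> (x - fst t)$2 \<le> 1/2 \<and> -1/2 \<le> (x - fst t)$2"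
  unfolding tile_supp_def by (simp add: mem_box_cart forall_2) linarith

lemma mem_interior_tile_supp:
  "x \<in> interior (tile_supp t) \<longleftrightarrow>
     (x - fst t)$1 < 1/2 \<and> -1/2 < (x - fst t)$1 \<and> (x - fst t)$2 < 1/2 \<and> -1/2 < (x - fst t)$2"
  unfolding tile_supp_def by (simp add: mem_box_cart forall_2) linarith

lemma Ints_abs_cases:
  fixes x :: real
  assumes "x \<in> \<int>" obtains "\<bar>x\<bar> > 1" | "x = -1" | "x = 0" | "x = 1"
proof -
  obtain k where k: "x = of_int k" using assms Ints_cases by blast
  then have "\<bar>k\<bar> > 1 \<or> k = -1 \<or> k = 0 \<or> k = 1" by linarith
  then show ?thesis using that k by force
qed

text \<open>The offset \<open>d\<close> between the centres serves as a supporting functional. If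
  its entries are -1, 0 or 1, its maximum on the square of \<open>s\<close> is attained exactly on
  the part shared with \<open>t\<close>; a larger entry makes the squares disjoint.\<close>

lemma tile_Int_face:
  assumes "int_vec (fst t - fst s)"
  shows "(tile_supp s \<inter> tile_supp t) face_of tile_supp s"
proof -
  define d where "d = fst t - fst s"
  let ?b = "d \<bullet> fst s + (\<bar>d$1\<bar> + \<bar>d$2\<bar>) / 2"
  let ?H = "{x. d \<bullet> x = ?b}"
  have far: "tile_supp s \<inter> tile_supp t = {}" if "\<bar>d$i\<bar> > 1" for i
    using that exhaust_2[of i] unfolding d_def set_eq_iff by (auto simp: mem_tile_supp)
  have le: "d \<bullet> x \<le> ?b" if "x \<in> tile_supp s" for x
  proof -
    have *: "d$i * (x$i - fst s$i) \<le> \<bar>d$i\<bar> / 2" for i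
    proof -
      have "\<bar>x$i - fst s$i\<bar> \<le> 1/2" using that exhaust_2[of i] unfolding abs_le_iff by (auto simp: mem_tile_supp)
      then have "\<bar>d$i\<bar> * \<bar>x$i - fst s$i\<bar> \<le> \<bar>d$i\<bar> * (1/2)" by (intro mult_left_mono) auto
      then show ?thesis by (simp flip: abs_mult)
    qed
    have "a + u \<le> b + v + (m + n) / 2" if "a - b \<le> m / 2" "u - v \<le> n / 2" for a b u v m n :: real
      using that by argo
    from this[OF *[of 1, unfolded right_diff_distrib] *[of 2, unfolded right_diff_distrib]]
    show ?thesis unfolding inner_vec_def sum_2 inner_real_def .
  qed
  have conv: "convex (tile_supp s)" unfolding tile_supp_def by (rule convex_box)
  have face: "(tile_supp s \<inter> ?H) face_of tile_supp s"
    using face_of_Int_supporting_hyperplane_le[OF conv le] .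
  have d12: "d$1 \<in> \<int>" "d$2 \<in> \<int>" using assms by (auto simp: d_def int_vec_def)
  show ?thesis
  proof (cases "tile_supp s \<inter> tile_supp t = {}")
    case False
    have eq: "fst t = fst s + d" by (simp add: d_def)
    have "x \<in> tile_supp s \<Longrightarrow> x \<in> tile_supp t \<longleftrightarrow> x \<in> ?H" for x
      apply (rule Ints_abs_cases[OF d12(1)]; rule Ints_abs_cases[OF d12(2)])
      using False far[of 1] far[of 2]
      by (auto simp: mem_tile_supp eq inner_vec_def sum_2 abs_le_iff)
    then have "tile_supp s \<inter> tile_supp t = tile_supp s \<inter> ?H" by blast
    then show ?thesis using face by simp
  qed simp
qed

text \<open>Any two tiles form a finite patch, and legality puts both into an iterate of one tile,
  so their centres differ by an integer vector. Covering the plane then amounts to occupying the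
  whole lattice coset, and the face condition is automatic.\<close>

lemma chair_tilings_iff:
  "T \<in> chair_tilings \<longleftrightarrow> gridded T \<and> (\<forall>P. P \<subseteq> T \<and> finite P \<longrightarrow> legal P)"
proof -
  have "is_tiling T \<longleftrightarrow> gridded T" if L: "\<And>P. P \<subseteq> T \<Longrightarrow> finite P \<Longrightarrow> legal P"
  proof
    assume tl: "is_tiling T"
    have "patchy {s, t}" if "s \<in> T" "t \<in> T" for s t
      using that L[of "{s, t}"] legal_patchy by simp
    then have pT: "patchy T" unfolding patchy_def by blast
    have cov: "\<exists>t\<in>T. x \<in> tile_supp t" for x using tl unfolding is_tiling_def by blast
    have "\<exists>a. (c, a) \<in> T" if t: "t \<in> T" and i: "int_vec (c - fst t)" for t c
    proof -
      \<comment> \<open>The tile covering the point \<open>c\<close> has its centre at an integer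
        offset smaller than 1 from \<open>c\<close>, hence at \<open>c\<close>.\<close>
      obtain u where u: "u \<in> T" "c \<in> tile_supp u" using cov by blast
      have "int_vec (fst t - fst u)" using pT t u unfolding patchy_def by blast
      then have "int_vec (c - fst u)" using i int_vec_diff_trans by blast
      then have "c - fst u = 0"
        by (rule int_vec_small) (use u in \<open>simp_all add: mem_tile_supp abs_less_iff\<close>)
      then show ?thesis using u by (metis eq_iff_diff_eq_0 prod.collapse)
    qed
    then show "gridded T" using pT cov unfolding gridded_def by blast
  next
    assume g: "gridded T"
    then have pT: "patchy T" unfolding gridded_def by blast
    obtain c0 a0 where c0: "(c0, a0) \<in> T" using g unfolding gridded_def by force
    have "\<exists>t\<in>T. x \<in> tile_supp t" for x
    proof -
      define c where "c = c0 + vector [of_int (round (x$1 - c0$1)), of_int (round (x$2 - c0$2))]"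
      have "int_vec (c - c0)" by (simp add: c_def int_vec_def)
      then obtain a where "(c, a) \<in> T" using griddedD g c0 by blast
      moreover have "x \<in> tile_supp (c, a)"
        using of_int_round_abs_le[of "x$1 - c0$1", unfolded abs_le_iff]
          of_int_round_abs_le[of "x$2 - c0$2", unfolded abs_le_iff]
        by (simp add: mem_tile_supp c_def)
      ultimately show ?thesis by blast
    qed
    then have "(\<Union>t\<in>T. tile_supp t) = UNIV" by blast
    moreover have "interior (tile_supp s) \<inter> interior (tile_supp t) = {} \<and>
        (tile_supp s \<inter> tile_supp t) face_of tile_supp s \<and>
        (tile_supp s \<inter> tile_supp t) face_of tile_supp t"
      if "s \<in> T" "t \<in> T" "s \<noteq> t" for s t
    proof (intro conjI)
      have i: "int_vec (fst s - fst t)" and ne: "fst s \<noteq> fst t"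
        using pT that unfolding patchy_def by blast+
      then show "(tile_supp s \<inter> tile_supp t) face_of tile_supp s"
        "(tile_supp s \<inter> tile_supp t) face_of tile_supp t"
        using tile_Int_face[of t s] tile_Int_face[of s t] int_vec_diff_sym[OF i]
        by (simp_all add: Int_commute)
      have "\<bar>(fst s - fst t) $ 1\<bar> \<ge> 1 \<or> \<bar>(fst s - fst t) $ 2\<bar> \<ge> 1"
        using int_vec_small[OF i] ne by force
      then show "interior (tile_supp s) \<inter> interior (tile_supp t) = {}"
        unfolding set_eq_iff by (auto simp: mem_interior_tile_supp)
    qed
    ultimately show "is_tiling T" unfolding is_tiling_def by blast
  qed
  then show ?thesis unfolding chair_tilings_def legal_iff[symmetric] by blast
qed

subsection \<open>Desubstitution\<close>

lemma subst_parent: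
  assumes "patchy P" "(c, a) \<in> P" "int_vec (d - c)" "(child d q, l) \<in> chair_subst P"
  shows "\<exists>b. (d, b) \<in> P \<and> l = sub_label b q"
proof -
  obtain e b r where e: "(e, b) \<in> P" "child d q = child e r" "l = sub_label b r"
    using assms(4) unfolding in_chair_subst by blast
  have "int_vec (d - e)" using assms(3) patchyD(1)[OF assms(1,2) e(1)] int_vec_diff_trans by blast
  from child_unique[OF this e(2)] e show ?thesis by blast
qed

lemma sub_label_self [simp]: "sub_label a a = a"
  by (cases a) auto

lemma single_subst: "{(c, a)} \<subseteq> chair_subst {((1/2) *\<^sub>R (c - (1/2) *\<^sub>R arrow_dir a), a)}"
  by (auto simp: in_chair_subst intro!: exI[of _ a])

text \<open>A tile labelled \<open>a\<close> is the quarter in position \<open>a\<close> of a larger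
  tile labelled \<open>a\<close>. Starting from that larger tile adds one level of substitution,
  which can then be peeled off at the end.\<close>

lemma legal_desubst:
  assumes "legal P" obtains Q where "legal Q" "P \<subseteq> chair_subst Q"
proof -
  obtain c a n v where P: "P \<subseteq> translate v ((chair_subst ^^ n) {(c, a)})"
    using assms unfolding legal_def by auto
  define t where "t = ((1/2) *\<^sub>R (c - (1/2) *\<^sub>R arrow_dir a), a)"
  define Q where "Q = translate ((1/2) *\<^sub>R v) ((chair_subst ^^ n) {t})"
  have "(chair_subst ^^ n) {(c, a)} \<subseteq> (chair_subst ^^ n) (chair_subst {t})"
    unfolding t_def by (intro iterate_mono single_subst)
  then have "translate v ((chair_subst ^^ n) {(c, a)}) \<subseteq> chair_subst Q"
    unfolding Q_def subst_translate by (simp add: funpow_swap1 translate_mono)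
  moreover have "legal Q" unfolding Q_def legal_def by blast
  ultimately show ?thesis using that P by blast
qed

text \<open>Finite patches desubstitute separately, with the parent of the fixed tile
  \<open>(c0, a0)\<close> in a position that may depend on the patch. As there are only four
  positions, one of them works for all finite patches, and it fixes the grid of the
  preimage.\<close>

lemma chair_desubst:
  assumes "T \<in> chair_tilings"
  obtains T' where "T' \<in> chair_tilings" "chair_subst T' = T"
proof -
  have gT: "gridded T" and LT: "\<And>P. P \<subseteq> T \<Longrightarrow> finite P \<Longrightarrow> legal P"
    using assms unfolding chair_tilings_iff by blast+
  have pT: "patchy T" using gT unfolding gridded_def by blast
  obtain c0 a0 where t0: "(c0, a0) \<in> T" using gT unfolding gridded_def by force
  define par where "par q = (1/2) *\<^sub>R (c0 - (1/2) *\<^sub>R arrow_dir q)" for q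
  have par: "child (par q) q = c0" for q by (simp add: par_def)
  define good where "good q P \<longleftrightarrow> (\<exists>Q a. legal Q \<and> P \<subseteq> chair_subst Q \<and> (par q, a) \<in> Q)" for q P
  have ex_good: "\<exists>q. good q P" if "P \<subseteq> T" "finite P" "(c0, a0) \<in> P" for P
  proof -
    have "legal P" using LT that by blast
    then obtain Q where Q: "legal Q" "P \<subseteq> chair_subst Q" by (rule legal_desubst)
    then have "(c0, a0) \<in> chair_subst Q" using that by blast
    then obtain c a q where c: "(c, a) \<in> Q" "c0 = child c q" unfolding in_chair_subst by blast
    then have "par q = c" by (simp add: par_def)
    then have "good q P" using Q c unfolding good_def by blast
    then show ?thesis ..
  qed
  have good_mono: "good q P \<Longrightarrow> P' \<subseteq> P \<Longrightarrow> good q P'" for q P P'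
    unfolding good_def by (meson order_trans)
  \<comment> \<open>If every position failed on some finite patch, the union of the four failing
    patches would still admit a good position, which is inherited by each of them.\<close>
  have "\<exists>q. \<forall>P. P \<subseteq> T \<and> finite P \<longrightarrow> good q P"
  proof (rule ccontr)
    assume "\<not> ?thesis"
    then obtain B where B: "\<And>q. B q \<subseteq> T \<and> finite (B q) \<and> \<not> good q (B q)" by metis
    define P where "P = insert (c0, a0) (\<Union>q. B q)"
    have "P \<subseteq> T" "finite P" using B t0 finite_arrow unfolding P_def by auto
    then obtain q where "good q P" using ex_good unfolding P_def by blast
    then have "good q (B q)" using good_mono unfolding P_def by blast
    then show False using B by blast
  qed
  then obtain q where good: "\<And>P. P \<subseteq> T \<Longrightarrow> finite P \<Longrightarrow> good q P" by blast
  \<comment> \<open>All tiles on the chosen grid whose inflation is present in \<open>T\<close>;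
    their consistency comes from the witnesses \<open>Q\<close> of finite patches.\<close>
  define T' where "T' = {(c, a). int_vec (c - par q) \<and> subst_tile (c, a) \<subseteq> T}"
  have memT': "(c, a) \<in> T' \<longleftrightarrow> int_vec (c - par q) \<and> (\<forall>r. (child c r, sub_label a r) \<in> T)" for c a
    unfolding T'_def subst_tile_def by auto
  have T'_legal: "legal P" if P: "P \<subseteq> T'" "finite P" for P
  proof -
    have "chair_subst P \<subseteq> T" using P(1) unfolding T'_def chair_subst_def by blast
    then have "good q (chair_subst P)" using good finite_subst P by blast
    then obtain Q a' where Q: "legal Q" "chair_subst P \<subseteq> chair_subst Q" "(par q, a') \<in> Q"
      unfolding good_def by blast
    have pQ: "patchy Q" using Q legal_patchy by blast
    have "(c, a) \<in> Q" if ca: "(c, a) \<in> P" for c a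
    proof -
      have "\<exists>b. (c, b) \<in> Q \<and> sub_label a r = sub_label b r" for r
      proof (rule subst_parent[OF pQ Q(3)])
        show "int_vec (c - par q)" using ca P memT' by blast
        show "(child c r, sub_label a r) \<in> chair_subst Q" using Q(2) child_in_subst[OF ca] by blast
      qed
      then obtain b where "(c, b) \<in> Q" "\<And>r. sub_label a r = sub_label b r"
        using patchyD(2)[OF pQ] by metis
      then show ?thesis using sub_label_inj by blast
    qed
    then have "P \<subseteq> Q" by auto
    then show ?thesis using Q legal_subset by blast
  qed
  have T'_ex: "\<exists>a. (c, a) \<in> T'" if c: "int_vec (c - par q)" for c
  proof -
    have "int_vec (child c r - c0)" for r
      using int_vec_child[OF c, of r q] par[of q] by simp
    then have "\<forall>r. \<exists>l. (child c r, l) \<in> T" using griddedD[OF gT t0] by blast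
    then obtain lab where lab: "\<And>r. (child c r, lab r) \<in> T" using choice by metis
    \<comment> \<open>The four tiles over one inflated square form a finite patch, and its witness
      supplies a single label \<open>b\<close> producing all four.\<close>
    have "good q ((\<lambda>r. (child c r, lab r)) ` UNIV)"
      using finite_arrow lab by (intro good) auto
    then obtain Q a' where Q: "legal Q" "\<And>r. (child c r, lab r) \<in> chair_subst Q" "(par q, a') \<in> Q"
      unfolding good_def by blast
    have pQ: "patchy Q" using Q legal_patchy by blast
    have "\<exists>b. (c, b) \<in> Q \<and> lab r = sub_label b r" for r
      by (rule subst_parent[OF pQ Q(3) c Q(2)])
    then obtain b where "\<And>r. lab r = sub_label b r" using patchyD(2)[OF pQ] by metis
    then have "(c, b) \<in> T'" using memT' lab c by simp
    then show ?thesis by blast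
  qed
  have "patchy {s, t}" if "s \<in> T'" "t \<in> T'" for s t
    using T'_legal[of "{s, t}"] that legal_patchy by simp
  then have "patchy T'" unfolding patchy_def by blast
  moreover have "\<exists>b. (d, b) \<in> T'" if "(c, a) \<in> T'" "int_vec (d - c)" for c a d
    using that T'_ex int_vec_diff_trans memT' by blast
  moreover have "T' \<noteq> {}" using T'_ex[of "par q"] by auto
  ultimately have gT': "gridded T'" unfolding gridded_def by (auto simp: split_paired_all)
  have sub: "chair_subst T' \<subseteq> T" unfolding T'_def chair_subst_def by blast
  have "(d, l) \<in> chair_subst T'" if dl: "(d, l) \<in> T" for d l
  proof -
    have "good q {(d, l)}" using good dl by simp
    then obtain Q a' where Q: "legal Q" "(d, l) \<in> chair_subst Q" "(par q, a') \<in> Q"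
      unfolding good_def by blast
    then obtain c a r where c: "(c, a) \<in> Q" "d = child c r" unfolding in_chair_subst by blast
    have "int_vec (c - par q)" using patchyD(1)[OF legal_patchy[OF Q(1)]] c Q by blast
    then obtain b where "(c, b) \<in> T'" using T'_ex by blast
    then have "(d, sub_label b r) \<in> chair_subst T'" using child_in_subst c by simp
    moreover have "sub_label b r = l" using patchyD(2)[OF pT] calculation sub dl by blast
    ultimately show ?thesis by simp
  qed
  then have "chair_subst T' = T" using sub by auto
  moreover have "T' \<in> chair_tilings" unfolding chair_tilings_iff using gT' T'_legal by blast
  ultimately show ?thesis using that by blast
qed

subsection \<open>Vertex stars\<close>

lemma star_parent:
  assumes "patchy P" "(c, a) \<in> P" "(d, l) \<in> chair_subst P"
    and "d = child (c + vector [of_int i, of_int j]) q"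
  shows "\<exists>b. (c + vector [of_int i, of_int j], b) \<in> P \<and> l = sub_label b q"
  by (rule subst_parent[OF assms(1,2)]) (use assms(3,4) in \<open>auto simp: int_vec_def\<close>)

text \<open>If the arrows of all four tiles at a vertex lie on lines through it, then three of them point
  to the vertex (this happens at the centre of an inflated tile) or none does.  So in a mirror
  symmetric star no arrow points to the vertex.\<close>

lemma no_symmetric_inward_star:
  assumes "(p + (1/2) *\<^sub>R arrow_dir NW, a) \<in> (chair_subst ^^ n) {t}"
    and "(p + (1/2) *\<^sub>R arrow_dir NE, b) \<in> (chair_subst ^^ n) {t}"
    and "(p + (1/2) *\<^sub>R arrow_dir SW, c) \<in> (chair_subst ^^ n) {t}"
    and "(p + (1/2) *\<^sub>R arrow_dir SE, d) \<in> (chair_subst ^^ n) {t}"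
    and "a = SE \<longleftrightarrow> c = NE" "b = SW \<longleftrightarrow> d = NW"
  shows "a \<noteq> SE \<and> b \<noteq> SW"
  using assms
proof (induction n arbitrary: p a b c d)
  case 0
  then have "arrow_dir NW = arrow_dir NE" by auto
  then show ?case by (simp add: inj_arrow_dir)
next
  case (Suc n)
  let ?P = "(chair_subst ^^ n) {t}"
  have pP: "patchy ?P" by (intro patchy_iterate patchy_single)
  have mem: "(p + (1/2) *\<^sub>R arrow_dir NW, a) \<in> chair_subst ?P"
    "(p + (1/2) *\<^sub>R arrow_dir NE, b) \<in> chair_subst ?P"
    "(p + (1/2) *\<^sub>R arrow_dir SW, c) \<in> chair_subst ?P"
    "(p + (1/2) *\<^sub>R arrow_dir SE, d) \<in> chair_subst ?P"
    using Suc.prems by simp_all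
  obtain e a' q where e: "(e, a') \<in> ?P" "p + (1/2) *\<^sub>R arrow_dir NW = child e q" "a = sub_label a' q"
    using mem(1) unfolding in_chair_subst by blast
  have p: "p = child e q - (1/2) *\<^sub>R arrow_dir NW" using e(2) by (simp add: algebra_simps)
  note par = star_parent[OF pP e(1)]
  show ?case
  proof (cases q)
    \<comment> \<open>Here \<open>p\<close> is the centre of an inflated tile: three arrows point
      inward and one outward, which violates the mirror hypotheses.\<close>
    case NW
    have "\<exists>b'. (e + vector [of_int 0, of_int 0], b') \<in> ?P \<and> b = sub_label b' NE"
      by (rule par[OF mem(2)]) (simp add: p NW vec2_eq_iff)
    moreover have "\<exists>b'. (e + vector [of_int 0, of_int 0], b') \<in> ?P \<and> c = sub_label b' SW"
      by (rule par[OF mem(3)]) (simp add: p NW vec2_eq_iff)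
    moreover have "\<exists>b'. (e + vector [of_int 0, of_int 0], b') \<in> ?P \<and> d = sub_label b' SE"
      by (rule par[OF mem(4)]) (simp add: p NW vec2_eq_iff)
    moreover have "e + vector [of_int 0, of_int 0] = e" by (simp add: vec2_eq_iff)
    ultimately have "b = sub_label a' NE" "c = sub_label a' SW" "d = sub_label a' SE"
      using patchyD(2)[OF pP e(1)] by metis+
    then show ?thesis using e(3) NW Suc.prems(5,6) by (cases a') auto
  next
    \<comment> \<open>Here \<open>p\<close> is the midpoint of an edge of an inflated tile. A
      quarter in position NE carries NE or SW, never SE, and one in position NW is never labelled
      SW. The case of position SW is alike.\<close>
    case NE
    have "\<exists>b'. (e + vector [of_int 1, of_int 0], b') \<in> ?P \<and> b = sub_label b' NW"
      by (rule par[OF mem(2)]) (simp add: p NE vec2_eq_iff)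
    then obtain b' where "b = sub_label b' NW" by blast
    then show ?thesis using e(3) NE by (cases a'; cases b') auto
  next
    case SW
    have "\<exists>b'. (e + vector [of_int 0, of_int 0], b') \<in> ?P \<and> b = sub_label b' SE"
      by (rule par[OF mem(2)]) (simp add: p SW vec2_eq_iff)
    then obtain b' where "b = sub_label b' SE" by blast
    then show ?thesis using e(3) SW by (cases a'; cases b') auto
  next
    \<comment> \<open>Here \<open>p\<close> is a common corner of four inflated tiles. An arrow
      points to \<open>p\<close> exactly when the label equals the quarter position, hence exactly
      when the parent carries that label; this reduces the claim to the vertex \<open>p'\<close> of
      the parents.\<close>
    case SE
    have "\<exists>b'. (e + vector [of_int 1, of_int 0], b') \<in> ?P \<and> b = sub_label b' SW"
      by (rule par[OF mem(2)]) (simp add: p SE vec2_eq_iff)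
    moreover have "\<exists>b'. (e + vector [of_int 0, of_int (-1)], b') \<in> ?P \<and> c = sub_label b' NE"
      by (rule par[OF mem(3)]) (simp add: p SE vec2_eq_iff)
    moreover have "\<exists>b'. (e + vector [of_int 1, of_int (-1)], b') \<in> ?P \<and> d = sub_label b' NW"
      by (rule par[OF mem(4)]) (simp add: p SE vec2_eq_iff)
    ultimately obtain b' c' d' where
        b': "(e + vector [of_int 1, of_int 0], b') \<in> ?P" "b = sub_label b' SW" and
        c': "(e + vector [of_int 0, of_int (-1)], c') \<in> ?P" "c = sub_label c' NE" and
        d': "(e + vector [of_int 1, of_int (-1)], d') \<in> ?P" "d = sub_label d' NW"
      by blast
    define p' where "p' = e + (1/2) *\<^sub>R arrow_dir SE"
    have pos: "p' + (1/2) *\<^sub>R arrow_dir NW = e"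
      "p' + (1/2) *\<^sub>R arrow_dir NE = e + vector [of_int 1, of_int 0]"
      "p' + (1/2) *\<^sub>R arrow_dir SW = e + vector [of_int 0, of_int (-1)]"
      "p' + (1/2) *\<^sub>R arrow_dir SE = e + vector [of_int 1, of_int (-1)]"
      unfolding p'_def by (simp_all add: vec2_eq_iff)
    have "a' = SE \<longleftrightarrow> a = SE" using e(3) SE by (cases a') auto
    moreover have "b' = SW \<longleftrightarrow> b = SW" using b'(2) by (cases b') auto
    moreover have "c' = NE \<longleftrightarrow> c = NE" using c'(2) by (cases c') auto
    moreover have "d' = NW \<longleftrightarrow> d = NW" using d'(2) by (cases d') auto
    moreover have "a' \<noteq> SE \<and> b' \<noteq> SW"
      by (rule Suc.IH[of p' a' b' c' d']) (use calculation pos e(1) b'(1) c'(1) d'(1) Suc.prems(5,6) in auto)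
    ultimately show ?thesis by blast
  qed
qed

subsection \<open>Symmetries of the substitution\<close>

text \<open>Collects what makes a linear map commute with the substitution and respect the integer
  lattice, so that the reflection and the rotation share the arguments below.\<close>

definition chair_sym :: "real^2^2 \<Rightarrow> bool" where
  "chair_sym A \<longleftrightarrow> (\<forall>a. arrow_dir (act_arrow A a) = A *v arrow_dir a) \<and>
     (\<forall>a q. sub_label (act_arrow A a) (act_arrow A q) = act_arrow A (sub_label a q)) \<and>
     surj (act_arrow A) \<and> (\<forall>v. int_vec (A *v v) \<longleftrightarrow> int_vec v) \<and> bij ((*v) A)"

lemma refl_x_mult: "refl_x *v v = vector [v$1, - v$2]"
  by (simp add: refl_x_def vec2_eq_iff matrix_vector_mult_def sum_2)

lemma rot90_mult: "rot90 *v v = vector [- v$2, v$1]"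
  by (simp add: rot90_def vec2_eq_iff matrix_vector_mult_def sum_2)

lemma refl_x_refl_x [simp]: "refl_x *v (refl_x *v v) = v"
  by (simp add: refl_x_mult vec2_eq_iff)

lemma act_refl_x_refl_x [simp]: "act_arrow refl_x (act_arrow refl_x a) = a"
  by (cases a) (simp_all add: act_arrow_refl_x)

lemma Ints_minus_iff: "- x \<in> \<int> \<longleftrightarrow> x \<in> \<int>" for x :: real
  by (metis Ints_minus minus_minus)

lemma chair_sym_refl_x: "chair_sym refl_x"
  unfolding chair_sym_def
proof (intro conjI allI)
  show "arrow_dir (act_arrow refl_x a) = refl_x *v arrow_dir a" for a
    by (cases a) (simp_all add: act_arrow_refl_x refl_x_mult vec2_eq_iff)
  show "surj (act_arrow refl_x)"
    by (rule surjI[of _ "act_arrow refl_x"]) simp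
  show "int_vec (refl_x *v v) \<longleftrightarrow> int_vec v" for v
    by (simp add: int_vec_def refl_x_mult Ints_minus_iff)
  show "bij ((*v) refl_x)"
    by (rule o_bij[of "(*v) refl_x"]) (auto simp: fun_eq_iff)
qed (rule sub_label_refl_x)

lemma chair_sym_rot90: "chair_sym rot90"
  unfolding chair_sym_def
proof (intro conjI allI)
  show "arrow_dir (act_arrow rot90 a) = rot90 *v arrow_dir a" for a
    by (cases a) (simp_all add: act_arrow_rot90 rot90_mult vec2_eq_iff)
  have "act_arrow rot90 (act_arrow rot90 (act_arrow rot90 (act_arrow rot90 a))) = a" for a
    by (cases a) (simp_all add: act_arrow_rot90)
  then show "surj (act_arrow rot90)" by (rule surjI)
  show "int_vec (rot90 *v v) \<longleftrightarrow> int_vec v" for v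
    by (auto simp: int_vec_def rot90_mult Ints_minus_iff)
  show "bij ((*v) rot90)"
    by (rule o_bij[of "\<lambda>v. rot90 *v (rot90 *v (rot90 *v v))"])
      (auto simp: fun_eq_iff rot90_mult vec2_eq_iff)
qed (rule sub_label_rot90)

lemma act_child: "chair_sym A \<Longrightarrow> A *v child c q = child (A *v c) (act_arrow A q)"
  unfolding chair_sym_def by (simp add: matrix_vector_right_distrib matrix_vector_mult_scaleR)

lemma mem_act_tiling:
  "(d, l) \<in> act_tiling A P \<longleftrightarrow> (\<exists>c a. (c, a) \<in> P \<and> d = A *v c \<and> l = act_arrow A a)"
  unfolding act_tiling_def act_tile_def by force

lemma act_tilingI: "(c, a) \<in> P \<Longrightarrow> (A *v c, act_arrow A a) \<in> act_tiling A P"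
  unfolding mem_act_tiling by blast

lemma act_subst:
  assumes "chair_sym A" shows "act_tiling A (chair_subst P) = chair_subst (act_tiling A P)"
proof -
  have *: "sub_label (act_arrow A a) (act_arrow A q) = act_arrow A (sub_label a q)" for a q
    using assms unfolding chair_sym_def by blast
  have surj: "\<exists>r. q = act_arrow A r" for q using assms unfolding chair_sym_def by (metis surjD)
  have "(d, l) \<in> act_tiling A (chair_subst P) \<longleftrightarrow> (d, l) \<in> chair_subst (act_tiling A P)" for d l
  proof
    assume "(d, l) \<in> act_tiling A (chair_subst P)"
    then obtain c a q where "(c, a) \<in> P" "d = A *v child c q" "l = act_arrow A (sub_label a q)"
      unfolding mem_act_tiling in_chair_subst by blast
    then show "(d, l) \<in> chair_subst (act_tiling A P)"
      using child_in_subst[OF act_tilingI[of c a P A], of "act_arrow A q"]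
      by (simp add: act_child[OF assms] *)
  next
    assume "(d, l) \<in> chair_subst (act_tiling A P)"
    then obtain c a q where "(c, a) \<in> P" "d = child (A *v c) q" "l = sub_label (act_arrow A a) q"
      unfolding mem_act_tiling in_chair_subst by blast
    moreover obtain r where "q = act_arrow A r" using surj by blast
    ultimately show "(d, l) \<in> act_tiling A (chair_subst P)"
      using act_tilingI[OF child_in_subst[of c a P r], of A] by (simp add: act_child[OF assms] *)
  qed
  then show ?thesis by auto
qed

lemma act_iterate:
  "chair_sym A \<Longrightarrow> act_tiling A ((chair_subst ^^ n) P) = (chair_subst ^^ n) (act_tiling A P)"
  by (induction n) (auto simp: act_subst)

lemma act_translate: "act_tiling A (translate v P) = translate (A *v v) (act_tiling A P)"
  unfolding act_tiling_def translate_def image_image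
  by (simp add: act_tile_def case_prod_beta matrix_vector_right_distrib)

lemma act_legal:
  assumes "chair_sym A" "legal P" shows "legal (act_tiling A P)"
proof -
  obtain t n v where "P \<subseteq> translate v ((chair_subst ^^ n) {t})" using assms(2) unfolding legal_def by blast
  then have "act_tiling A P \<subseteq> act_tiling A (translate v ((chair_subst ^^ n) {t}))"
    unfolding act_tiling_def by blast
  also have "\<dots> = translate (A *v v) ((chair_subst ^^ n) {act_tile A t})"
    by (simp add: act_translate act_iterate[OF assms(1)]) (simp add: act_tiling_def)
  finally show ?thesis unfolding legal_def by blast
qed

lemma act_gridded:
  assumes A: "chair_sym A" and g: "gridded T" shows "gridded (act_tiling A T)"
proof -
  have pT: "patchy T" and ne: "T \<noteq> {}" using g unfolding gridded_def by blast+
  have int: "int_vec (A *v u - A *v v) \<longleftrightarrow> int_vec (u - v)" for u v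
    using A unfolding chair_sym_def by (simp flip: matrix_vector_mult_diff_distrib)
  have bij: "bij ((*v) A)" using A unfolding chair_sym_def by blast
  have "int_vec (A *v c - A *v d) \<and> (A *v c = A *v d \<longrightarrow> a = b)"
    if "(c, a) \<in> T" "(d, b) \<in> T" for c a d b
    using patchyD[OF pT that] int bij_is_inj[OF bij] by (auto dest: injD)
  then have "patchy (act_tiling A T)"
    unfolding patchy_def act_tiling_def act_tile_def by (auto simp: split_paired_all) blast
  moreover have "\<exists>b. (d, b) \<in> act_tiling A T" if ca: "(c, a) \<in> T" and d: "int_vec (d - A *v c)" for c a d
  proof -
    obtain e where e: "d = A *v e" using bij by (metis bij_pointE)
    then have "int_vec (e - c)" using d int by simp
    then obtain b where "(e, b) \<in> T" using griddedD[OF g ca] by blast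
    then show ?thesis using act_tilingI e by blast
  qed
  ultimately show ?thesis
    using ne unfolding gridded_def by (auto simp: split_paired_all mem_act_tiling) (auto simp: act_tiling_def)
qed

lemma act_chair_tilings:
  assumes A: "chair_sym A" and T: "T \<in> chair_tilings" shows "act_tiling A T \<in> chair_tilings"
  unfolding chair_tilings_iff
proof (intro conjI allI impI)
  show "gridded (act_tiling A T)" using act_gridded assms unfolding chair_tilings_iff by blast
  fix P assume "P \<subseteq> act_tiling A T \<and> finite P"
  then obtain P' where "P' \<subseteq> T" "finite P'" "P = act_tiling A P'"
    unfolding act_tiling_def by (metis finite_subset_image)
  then show "legal P" using act_legal[OF A] T unfolding chair_tilings_iff by blast
qed

subsection \<open>Tilings with a horizontal axis of symmetry\<close>

definition sym_tilings :: "tile set set" where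
  "sym_tilings = {T \<in> chair_tilings. act_tiling refl_x T = T}"

lemma sym_tilingD:
  assumes "T \<in> sym_tilings" "(c, a) \<in> T" shows "(refl_x *v c, act_arrow refl_x a) \<in> T"
  using act_tilingI[OF assms(2), of refl_x] assms(1) unfolding sym_tilings_def by simp

lemma sym_tilings_gridded: "T \<in> sym_tilings \<Longrightarrow> gridded T" "T \<in> sym_tilings \<Longrightarrow> patchy T"
  unfolding sym_tilings_def chair_tilings_iff gridded_def by blast+

lemma double_Ints_cases:
  fixes x :: real
  assumes "2 * x \<in> \<int>" obtains "x \<in> \<int>" | "x - 1/2 \<in> \<int>"
proof -
  obtain k where k: "2 * x = of_int k" using assms Ints_cases by blast
  show ?thesis
  proof (cases "even k")
    case True
    then obtain j where "k = 2 * j" by (elim evenE)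
    then have "x = of_int j" using k by simp
    then show ?thesis using that by simp
  next
    case False
    then obtain j where "k = 2 * j + 1" by (elim oddE)
    then have "x - 1/2 = of_int j" using k by simp
    then show ?thesis using that by (metis Ints_of_int)
  qed
qed

text \<open>A tile centred on the axis would be mapped to itself with a different label.\<close>

lemma sym_tiling_height:
  assumes T: "T \<in> sym_tilings" and ca: "(c, a) \<in> T"
  shows "c$2 - 1/2 \<in> \<int>"
proof -
  note g = sym_tilings_gridded(1)[OF T] and p = sym_tilings_gridded(2)[OF T]
  have "int_vec (c - refl_x *v c)" using patchyD(1)[OF p ca sym_tilingD[OF T ca]] .
  then have "2 * c$2 \<in> \<int>" by (simp add: int_vec_def refl_x_mult)
  then show ?thesis
  proof (cases rule: double_Ints_cases)
    case 1
    define d :: "real^2" where "d = vector [c$1, 0]"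
    have "int_vec (d - c)" using 1 by (simp add: int_vec_def d_def Ints_minus_iff)
    then obtain b where b: "(d, b) \<in> T" using griddedD[OF g ca] by blast
    have "refl_x *v d = d" by (simp add: refl_x_mult d_def vec2_eq_iff)
    then have "act_arrow refl_x b = b" using patchyD(2)[OF p sym_tilingD[OF T b] b] by simp
    then show ?thesis by (cases b) (simp_all add: act_arrow_refl_x)
  qed
qed

text \<open>A local argument: the heights of the children place the mirror image of each parent
  centre on the grid of \<open>T\<close>, and the label there is forced because its four children
  carry the reflected labels.\<close>

lemma sym_desubst:
  assumes T: "chair_subst T \<in> sym_tilings" and T': "T \<in> chair_tilings"
  shows "T \<in> sym_tilings"
proof -
  have g: "gridded T" and p: "patchy T" using T' unfolding chair_tilings_iff gridded_def by blast+
  have refl: "(refl_x *v c, act_arrow refl_x a) \<in> T" if ca: "(c, a) \<in> T" for c a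
  proof -
    \<comment> \<open>This height is twice that of \<open>c\<close> plus 1/2, so reflection moves
      \<open>c\<close> by an integer vector.\<close>
    have "(child c NE)$2 - 1/2 \<in> \<int>" using sym_tiling_height[OF T child_in_subst[OF ca]] .
    then have "int_vec (refl_x *v c - c)"
      by (simp add: int_vec_def refl_x_mult)
    then obtain b where b: "(refl_x *v c, b) \<in> T" using griddedD[OF g ca] by blast
    have "sub_label b q = sub_label (act_arrow refl_x a) q" for q
    proof -
      let ?q = "act_arrow refl_x q"
      have "(refl_x *v child c ?q, act_arrow refl_x (sub_label a ?q)) \<in> chair_subst T"
        by (intro sym_tilingD[OF T] child_in_subst ca)
      then have "(child (refl_x *v c) q, sub_label (act_arrow refl_x a) q) \<in> chair_subst T"
        by (simp add: act_child[OF chair_sym_refl_x] flip: sub_label_refl_x)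
      then show ?thesis using patchyD(2)[OF patchy_subst[OF p] child_in_subst[OF b]] by blast
    qed
    then show ?thesis using sub_label_inj b by metis
  qed
  have "act_tiling refl_x T \<subseteq> T" using refl by (auto simp: mem_act_tiling)
  moreover have "(c, a) \<in> act_tiling refl_x T" if "(c, a) \<in> T" for c a
    using act_tilingI[OF refl[OF that], of refl_x] by simp
  ultimately have "act_tiling refl_x T = T" by auto
  then show ?thesis using T' unfolding sym_tilings_def by blast
qed

text \<open>The two lower corners of the tile lie on the axis, where the vertex stars are mirror
  symmetric. The right corner excludes SE, the left corner SW.\<close>

lemma sym_tiling_row:
  assumes T: "T \<in> sym_tilings" and ca: "(c, a) \<in> T" and c2: "c$2 = 1/2"
  shows "a \<noteq> SE" "a \<noteq> SW"
proof -
  note g = sym_tilings_gridded(1)[OF T] and p = sym_tilings_gridded(2)[OF T]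
  have main: "a1 \<noteq> SE \<and> b1 \<noteq> SW"
    if a1: "(e, a1) \<in> T" and b1: "(f, b1) \<in> T" and e2: "e$2 = 1/2" and f: "f = e + vector [1, 0]"
    for e f a1 b1
  proof -
    define x where "x = e - (1/2) *\<^sub>R arrow_dir NW"
    have pos: "e = x + (1/2) *\<^sub>R arrow_dir NW" "f = x + (1/2) *\<^sub>R arrow_dir NE"
      "refl_x *v e = x + (1/2) *\<^sub>R arrow_dir SW" "refl_x *v f = x + (1/2) *\<^sub>R arrow_dir SE"
      using e2 f by (simp_all add: x_def vec2_eq_iff refl_x_mult)
    let ?P = "{(e, a1), (f, b1), (refl_x *v e, act_arrow refl_x a1), (refl_x *v f, act_arrow refl_x b1)}"
    have "?P \<subseteq> T" using sym_tilingD[OF T] a1 b1 by blast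
    then have "legal ?P" using T unfolding sym_tilings_def chair_tilings_iff by blast
    then obtain t n v where "?P \<subseteq> translate v ((chair_subst ^^ n) {t})" unfolding legal_def by blast
    then have mem: "(e - v, a1) \<in> (chair_subst ^^ n) {t}" "(f - v, b1) \<in> (chair_subst ^^ n) {t}"
      "(refl_x *v e - v, act_arrow refl_x a1) \<in> (chair_subst ^^ n) {t}"
      "(refl_x *v f - v, act_arrow refl_x b1) \<in> (chair_subst ^^ n) {t}"
      by (simp_all add: mem_translate)
    have eqs: "(x - v) + (1/2) *\<^sub>R arrow_dir NW = e - v" "(x - v) + (1/2) *\<^sub>R arrow_dir NE = f - v"
      "(x - v) + (1/2) *\<^sub>R arrow_dir SW = refl_x *v e - v" "(x - v) + (1/2) *\<^sub>R arrow_dir SE = refl_x *v f - v"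
      unfolding pos(3,4) by (simp_all add: pos(1,2))
    have "((x - v) + (1/2) *\<^sub>R arrow_dir NW, a1) \<in> (chair_subst ^^ n) {t}"
      "((x - v) + (1/2) *\<^sub>R arrow_dir NE, b1) \<in> (chair_subst ^^ n) {t}"
      "((x - v) + (1/2) *\<^sub>R arrow_dir SW, act_arrow refl_x a1) \<in> (chair_subst ^^ n) {t}"
      "((x - v) + (1/2) *\<^sub>R arrow_dir SE, act_arrow refl_x b1) \<in> (chair_subst ^^ n) {t}"
      unfolding eqs by (fact mem)+
    then show ?thesis
      by (rule no_symmetric_inward_star) (cases a1, auto simp: act_arrow_refl_x, (cases b1, auto simp: act_arrow_refl_x)+)
  qed
  have "int_vec ((c + vector [1, 0]) - c)" "int_vec ((c - vector [1, 0]) - c)"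
    by (simp_all add: int_vec_def)
  then obtain b1 b2 where "(c + vector [1, 0], b1) \<in> T" "(c - vector [1, 0], b2) \<in> T"
    using griddedD[OF g ca] by blast
  then show "a \<noteq> SE" "a \<noteq> SW"
    using main[OF ca, of _ b1] main[of "c - vector [1, 0]" b2 c a] ca c2 by simp_all
qed

subsection \<open>The symmetric tiling of a point of the solenoid\<close>

lemma solenoid_iff:
  "s \<in> topspace dyadic_solenoid \<longleftrightarrow>
     (\<forall>n. s n \<in> range RZ_class) \<and> (\<forall>n. s n = RZ_double (s (Suc n)))"
  unfolding dyadic_solenoid_def by (auto simp: topspace_RZ PiE_UNIV_domain)

lemma solenoid_shift:
  "s \<in> topspace dyadic_solenoid \<Longrightarrow> (\<lambda>n. s (Suc n)) \<in> topspace dyadic_solenoid"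
  unfolding solenoid_iff by blast

lemma class_mem_unique:
  assumes "C \<in> range RZ_class" "x \<in> C" "y \<in> C" shows "x - y \<in> \<int>"
proof -
  obtain z where "C = RZ_class z" using assms(1) by blast
  then have "x - z \<in> \<int>" "y - z \<in> \<int>" using assms(2,3) by (simp_all add: mem_RZ_class)
  then have "(x - z) - (y - z) \<in> \<int>" by (rule Ints_diff)
  then show ?thesis by simp
qed

lemma class_mem_add:
  assumes "C \<in> range RZ_class" "x \<in> C" "y - x \<in> \<int>" shows "y \<in> C"
proof -
  obtain z where z: "C = RZ_class z" using assms(1) by blast
  then have "x - z \<in> \<int>" using assms(2) by (simp add: mem_RZ_class)
  then have "(y - x) + (x - z) \<in> \<int>" using assms(3) by (intro Ints_add)
  then show ?thesis using z by (simp add: mem_RZ_class)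
qed

lemma class_nonempty:
  assumes "C \<in> range RZ_class" shows "\<exists>x. x \<in> C"
proof -
  obtain z where "C = RZ_class z" using assms by blast
  then have "z \<in> C" by (simp add: mem_RZ_class)
  then show ?thesis ..
qed

lemma class_eqI:
  assumes "C \<in> range RZ_class" "D \<in> range RZ_class" "x \<in> C" "x \<in> D" shows "C = D"
proof -
  have "y \<in> C \<longleftrightarrow> y \<in> D" for y
    using class_mem_add[OF assms(1,3), of y] class_mem_add[OF assms(2,4), of y]
      class_mem_unique[OF assms(1), of y x] class_mem_unique[OF assms(2), of y x] assms(3,4) by blast
  then show ?thesis by blast
qed

text \<open>Doubling the points of a coset of the integers hits only every other point of the image
  coset; the points \<open>2 * w + 1\<close> fill the gaps.\<close>

lemma mem_RZ_double:
  assumes "D \<in> range RZ_class"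
  shows "x \<in> RZ_double D \<longleftrightarrow> (\<exists>w\<in>D. x = 2 * w \<or> x = 2 * w + 1)"
proof -
  obtain w0 where w0: "D = RZ_class w0" using assms by blast
  show ?thesis
  proof
    assume "x \<in> RZ_double D"
    then have "x - 2 * w0 \<in> \<int>" by (simp add: w0 RZ_double_class mem_RZ_class)
    then have "2 * (x / 2 - w0) \<in> \<int>" by (simp add: right_diff_distrib)
    then have "x / 2 - w0 \<in> \<int> \<or> (x - 1) / 2 - w0 \<in> \<int>"
      by (rule double_Ints_cases) (auto simp: diff_divide_distrib algebra_simps)
    then have "x / 2 \<in> D \<or> (x - 1) / 2 \<in> D" by (simp add: w0 mem_RZ_class)
    moreover have "x = 2 * (x / 2)" "x = 2 * ((x - 1) / 2) + 1" by (simp_all add: field_simps)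
    ultimately show "\<exists>w\<in>D. x = 2 * w \<or> x = 2 * w + 1" by blast
  next
    assume "\<exists>w\<in>D. x = 2 * w \<or> x = 2 * w + 1"
    then obtain w where w: "w - w0 \<in> \<int>" "x = 2 * w \<or> x = 2 * w + 1" by (auto simp: w0 mem_RZ_class)
    have "2 * (w - w0) \<in> \<int>" "2 * (w - w0) + 1 \<in> \<int>" using w(1) by (auto intro!: Ints_mult Ints_add simp del: right_diff_distrib_numeral)
    then show "x \<in> RZ_double D" using w(2) by (auto simp: w0 RZ_double_class mem_RZ_class algebra_simps)
  qed
qed

text \<open>Two by two tiles straddling the axis, with left edge at \<open>2 * z\<close>. The
  parameter is half the left edge, so that integer steps of \<open>z\<close> lay blocks side by
  side.\<close>

definition block :: "real \<Rightarrow> tile set" where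
  "block z = {(vector [2 * z + 1/2, 1/2], NE), (vector [2 * z + 3/2, 1/2], NW),
              (vector [2 * z + 1/2, -1/2], SE), (vector [2 * z + 3/2, -1/2], SW)}"

definition row :: "real set \<Rightarrow> tile set" where
  "row C = (\<Union>z\<in>C. block z)"

lemma block_translate: "translate (vector [2 * t, 0]) (block z) = block (z + t)"
proof -
  have "vector [a, b] + vector [c, d] = (vector [a + c, b + d] :: real^2)" for a b c d
    by (simp add: vec2_eq_iff)
  then show ?thesis unfolding translate_def block_def by (simp add: algebra_simps)
qed

lemma row_translate: "translate (vector [2 * t, 0]) (row C) = row ((\<lambda>z. z + t) ` C)"
  unfolding row_def by (simp add: block_translate[symmetric]) (auto simp: translate_def)

text \<open>The lower quarters of NE tiles and of NW tiles are NE and NW, in this order, and the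
  mirror image holds below the axis. So the pattern along the axis reproduces itself.\<close>

lemma subst_block: "block (2 * z) \<union> block (2 * z + 1) \<subseteq> chair_subst (block z)"
proof -
  have mem: "(vector [2 * z + 1/2, 1/2], NE) \<in> block z" "(vector [2 * z + 3/2, 1/2], NW) \<in> block z"
    "(vector [2 * z + 1/2, -1/2], SE) \<in> block z" "(vector [2 * z + 3/2, -1/2], SW) \<in> block z"
    unfolding block_def by simp_all
  note c = mem[THEN child_in_subst]
  have "child (vector [2 * z + 1/2, 1/2]) SW = vector [2 * (2 * z) + 1/2, 1/2]"
    "child (vector [2 * z + 1/2, 1/2]) SE = vector [2 * (2 * z) + 3/2, 1/2]"
    "child (vector [2 * z + 1/2, -1/2]) NW = vector [2 * (2 * z) + 1/2, -1/2]"
    "child (vector [2 * z + 1/2, -1/2]) NE = vector [2 * (2 * z) + 3/2, -1/2]"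
    "child (vector [2 * z + 3/2, 1/2]) SW = vector [2 * (2 * z + 1) + 1/2, 1/2]"
    "child (vector [2 * z + 3/2, 1/2]) SE = vector [2 * (2 * z + 1) + 3/2, 1/2]"
    "child (vector [2 * z + 3/2, -1/2]) NW = vector [2 * (2 * z + 1) + 1/2, -1/2]"
    "child (vector [2 * z + 3/2, -1/2]) NE = vector [2 * (2 * z + 1) + 3/2, -1/2]"
    by (simp_all add: vec2_eq_iff)
  then show ?thesis
    using c(1)[of SW] c(1)[of SE] c(2)[of SW] c(2)[of SE] c(3)[of NW] c(3)[of NE] c(4)[of NW] c(4)[of NE]
    unfolding block_def[of "2 * z"] block_def[of "2 * z + 1"] sub_label.simps by simp
qed

lemma subst_row:
  assumes "D \<in> range RZ_class" shows "row (RZ_double D) \<subseteq> chair_subst (row D)"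
proof
  fix t assume "t \<in> row (RZ_double D)"
  then obtain z where z: "z \<in> RZ_double D" "t \<in> block z" unfolding row_def by blast
  obtain w where w: "w \<in> D" "z = 2 * w \<or> z = 2 * w + 1"
    using z(1) unfolding mem_RZ_double[OF assms] by (elim bexE)
  then have "t \<in> block (2 * w) \<union> block (2 * w + 1)" using z(2) by auto
  then have "t \<in> chair_subst (block w)" using subst_block by blast
  then show "t \<in> chair_subst (row D)"
    using subst_mono[of "block w" "row D"] \<open>w \<in> D\<close> unfolding row_def by blast
qed

text \<open>The second iterate of an \<open>NE\<close> tile contains an \<open>NE\<close> tile on top of an \<open>SE\<close> tile, and a
  block lies around the centre of the inflation of such a pair.\<close>

lemma legal_block: "legal (block z)"
proof -
  define t0 :: tile where "t0 = (vector [1/2, 1/2], NE)"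
  define P where "P = (chair_subst ^^ 3) {t0}"
  have P: "P = chair_subst (chair_subst (chair_subst {t0}))"
    by (simp add: P_def eval_nat_numeral)
  have pos: "child (vector [1/2, 1/2]) NW = vector [1/2, 3/2]"
    "child (vector [1/2, 1/2]) SW = vector [1/2, 1/2]"
    "child (vector [1/2, 3/2]) SW = vector [1/2, 5/2]"
    "child (vector [1/2, 5/2]) SW = vector [1/2, 9/2]"
    "child (vector [1/2, 5/2]) SE = vector [3/2, 9/2]"
    "child (vector [1/2, 3/2]) NW = vector [1/2, 7/2]"
    "child (vector [1/2, 3/2]) NE = vector [3/2, 7/2]"
    by (simp_all add: vec2_eq_iff)
  have "(vector [1/2, 1/2], NE) \<in> {t0}" by (simp add: t0_def)
  note 1 = child_in_subst[OF this, of NW] child_in_subst[OF this, of SW]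
  note 1 = 1[unfolded pos sub_label.simps]
  note 2 = child_in_subst[OF 1(1), of SW] child_in_subst[OF 1(2), of NW]
  note 2 = 2[unfolded pos sub_label.simps]
  note 3 = child_in_subst[OF 2(1), of SW] child_in_subst[OF 2(1), of SE]
    child_in_subst[OF 2(2), of NW] child_in_subst[OF 2(2), of NE]
  note 3 = 3[unfolded pos sub_label.simps, folded P]
  have "vector [a, b] - vector [0, -4] = (vector [a, b + 4] :: real^2)" for a b :: real
    by (simp add: vec2_eq_iff)
  then have "block 0 \<subseteq> translate (vector [0, -4]) P"
    using 3 unfolding block_def by (simp add: mem_translate)
  then have "legal (block 0)" unfolding legal_def P_def by blast
  from legal_translate[OF this, of "vector [2 * z, 0]"] show ?thesis by (simp add: block_translate)
qed

text \<open>The \<open>m\<close>-fold substitution of one legal block contains \<open>2 ^ m\<close>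
  consecutive blocks along the axis.\<close>

lemma legal_blocks: "legal (\<Union>k<n. block (z + real k))"
proof -
  have *: "legal (\<Union>k<(2::nat)^m. block (2 ^ m * w + real k))" for w m
  proof (induction m)
    case 0
    show ?case using legal_block[of w] by (simp add: lessThan_Suc)
  next
    case (Suc m)
    have "block (2 ^ Suc m * w + real k) \<subseteq> chair_subst (\<Union>k<(2::nat)^m. block (2 ^ m * w + real k))"
      if k: "k < 2 ^ Suc m" for k
    proof -
      let ?z = "2 ^ m * w + real (k div 2)"
      have "real k = 2 * real (k div 2) \<or> real k = 2 * real (k div 2) + 1"
        by (cases "even k") (auto elim!: evenE oddE)
      then have "2 ^ Suc m * w + real k = 2 * ?z \<or> 2 ^ Suc m * w + real k = 2 * ?z + 1"
        by (auto simp: algebra_simps)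
      then have "block (2 ^ Suc m * w + real k) \<subseteq> chair_subst (block ?z)"
        using subst_block[of ?z] by (metis le_sup_iff)
      moreover have "k div 2 < 2 ^ m" using k by simp
      ultimately show ?thesis unfolding subst_UN by blast
    qed
    then have "(\<Union>k<(2::nat)^Suc m. block (2 ^ Suc m * w + real k))
        \<subseteq> chair_subst (\<Union>k<(2::nat)^m. block (2 ^ m * w + real k))" by blast
    then show ?case using legal_subst[OF Suc.IH] legal_subset by blast
  qed
  have "{..<n} \<subseteq> {..<2 ^ n}" using less_exp[of n] by auto
  then have "(\<Union>k<n. block (z + real k)) \<subseteq> (\<Union>k<(2::nat)^n. block (z + real k))"
    by (rule UN_mono) simp
  \<comment> \<open>The starting block sits at \<open>z / 2 ^ n\<close> to undo the
    dilation.\<close>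
  moreover have "legal (\<Union>k<(2::nat)^n. block (z + real k))" using *[of n "z / 2 ^ n"] by simp
  ultimately show ?thesis using legal_subset by blast
qed

text \<open>Members of one coset differ by integers, so finitely many blocks of a row lie in one run
  of consecutive blocks that begins at the least index \<open>z\<close>.\<close>

lemma legal_finite_row:
  assumes C: "C \<in> range RZ_class" and F: "finite F" "F \<subseteq> row C"
  shows "legal F"
proof -
  have "\<forall>t\<in>F. \<exists>z. z \<in> C \<and> t \<in> block z" using F unfolding row_def by blast
  then obtain g where g: "\<And>t. t \<in> F \<Longrightarrow> g t \<in> C \<and> t \<in> block (g t)" by metis
  show ?thesis
  proof (cases "F = {}")
    case True
    then show ?thesis unfolding legal_def by simp
  next
    case False
    define z where "z = Min (g ` F)"
    have z: "z \<in> g ` F" "\<And>t. t \<in> F \<Longrightarrow> z \<le> g t" using F False unfolding z_def by auto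
    define n where "n = Suc (nat \<lfloor>Max ((\<lambda>t. g t - z) ` F)\<rfloor>)"
    have "\<exists>k<n. g t = z + real k" if t: "t \<in> F" for t
    proof -
      have "g t - z \<in> \<int>" using class_mem_unique[OF C] g t z(1) by (metis imageE)
      then obtain i where i: "g t - z = of_int i" using Ints_cases by blast
      have "i \<ge> 0" using z(2)[OF t] i by (metis diff_ge_0_iff_ge of_int_0_le_iff)
      have "g t - z \<le> Max ((\<lambda>t. g t - z) ` F)" using F t by auto
      then have "i \<le> \<lfloor>Max ((\<lambda>t. g t - z) ` F)\<rfloor>" using i by (simp add: le_floor_iff)
      then have "nat i < n" unfolding n_def by linarith
      moreover have "g t = z + real (nat i)" using i \<open>i \<ge> 0\<close> by simp
      ultimately show ?thesis by blast
    qed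
    then have "F \<subseteq> (\<Union>k<n. block (z + real k))" using g by fastforce
    then show ?thesis using legal_blocks legal_subset by blast
  qed
qed

lemma row_refl: "act_tiling refl_x (row C) = row C"
proof -
  have "act_tiling refl_x (block z) = block z" for z
  proof -
    have "refl_x *v vector [a, b] = vector [a, -b]" for a b by (simp add: refl_x_mult)
    then show ?thesis
      by (auto simp: act_tiling_def act_tile_def block_def act_arrow_refl_x)
  qed
  then have "(\<Union>z\<in>C. act_tiling refl_x (block z)) = (\<Union>z\<in>C. block z)" by simp
  then show ?thesis unfolding row_def act_tiling_def by (simp add: image_UN)
qed

text \<open>For a point \<open>s\<close> of the solenoid, the part at \<open>n\<close> fills the
  strip of height \<open>2 ^ n\<close> on either side of the axis.\<close>

definition sol_tiling :: "(nat \<Rightarrow> real set) \<Rightarrow> tile set" where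
  "sol_tiling s = (\<Union>n. (chair_subst ^^ n) (row (s (Suc n))))"

abbreviation level :: "(nat \<Rightarrow> real set) \<Rightarrow> nat \<Rightarrow> tile set" where
  "level s n \<equiv> (chair_subst ^^ n) (row (s (Suc n)))"

lemma solenoid_class: "s \<in> topspace dyadic_solenoid \<Longrightarrow> s n \<in> range RZ_class"
  unfolding solenoid_iff by blast

lemma mem_solenoid_double:
  assumes "s \<in> topspace dyadic_solenoid"
  shows "x \<in> s n \<longleftrightarrow> (\<exists>w\<in>s (Suc n). x = 2 * w \<or> x = 2 * w + 1)"
proof -
  have "s n = RZ_double (s (Suc n))" using assms unfolding solenoid_iff by blast
  then show ?thesis using mem_RZ_double[OF solenoid_class[OF assms], of x "Suc n"] by simp
qed

text \<open>By induction over shifted sequences: one substitution doubles the height of the strip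
  and turns the class \<open>s 1\<close> of left edges into \<open>s 0\<close>.\<close>

lemma level_centres:
  assumes "s \<in> topspace dyadic_solenoid"
  shows "(\<exists>a. (c, a) \<in> level s n) \<longleftrightarrow>
     c$1 - 1/2 \<in> s 0 \<and> (\<exists>j::int. c$2 = of_int j + 1/2 \<and> - (2^n) \<le> j \<and> j < 2^n)"
  using assms
proof (induction n arbitrary: s c)
  case 0
  show ?case (is "?L \<longleftrightarrow> ?R")
  proof
    assume ?L
    then obtain z a where "z \<in> s 1" "(c, a) \<in> block z" unfolding row_def by auto
    then have "c$1 - 1/2 = 2 * z \<or> c$1 - 1/2 = 2 * z + 1"
        "c$2 = of_int 0 + 1/2 \<or> c$2 = of_int (-1) + 1/2"
      by (auto simp: block_def)
    moreover have "- (2^0) \<le> (0::int)" "(0::int) < 2^0" "- (2^0) \<le> (-1::int)" "(-1::int) < 2^0" by auto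
    ultimately show ?R using mem_solenoid_double[OF 0] \<open>z \<in> s 1\<close> by (metis One_nat_def)
  next
    assume ?R
    then obtain z j where z: "z \<in> s 1" "c$1 - 1/2 = 2 * z \<or> c$1 - 1/2 = 2 * z + 1"
        and j: "c$2 = of_int j + 1/2" "j = 0 \<or> j = -1"
      using mem_solenoid_double[OF 0, of _ 0] by force
    have "\<exists>a. (c, a) \<in> block z"
      using z(2) j unfolding block_def by (auto simp: vec2_eq_iff)
    then show ?L using z(1) unfolding row_def by auto
  qed
next
  case (Suc n)
  let ?s = "\<lambda>n. s (Suc n)"
  have IH: "(\<exists>a. (e, a) \<in> level ?s n) \<longleftrightarrow>
     e$1 - 1/2 \<in> s 1 \<and> (\<exists>j::int. e$2 = of_int j + 1/2 \<and> - (2^n) \<le> j \<and> j < 2^n)" for e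
    using Suc.IH[OF solenoid_shift[OF Suc.prems], of e] by simp
  have lv: "level s (Suc n) = chair_subst (level ?s n)" by simp
  show ?case (is "?L \<longleftrightarrow> ?R")
  proof
    assume ?L
    then obtain e a q where e: "(e, a) \<in> level ?s n" "c = child e q"
      unfolding lv in_chair_subst by blast
    then obtain j :: int where j: "e$1 - 1/2 \<in> s 1" "e$2 = of_int j + 1/2" "- (2^n) \<le> j" "j < 2^n"
      using IH by blast
    have "c$1 - 1/2 = 2 * (e$1 - 1/2) \<or> c$1 - 1/2 = 2 * (e$1 - 1/2) + 1"
      unfolding e(2) by (cases q) auto
    then have "c$1 - 1/2 \<in> s 0"
      using mem_solenoid_double[OF Suc.prems, of "c$1 - 1/2" 0] j(1) unfolding One_nat_def by blast
    moreover have "c$2 = of_int (2 * j) + 1/2 \<or> c$2 = of_int (2 * j + 1) + 1/2"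
      unfolding e(2) by (cases q) (auto simp: j(2))
    moreover have "- (2^Suc n) \<le> 2 * j" "2 * j < 2^Suc n" "- (2^Suc n) \<le> 2 * j + 1" "2 * j + 1 < 2^Suc n"
      using j(3,4) by auto
    ultimately show ?R by blast
  next
    assume ?R
    then obtain j :: int where j: "c$1 - 1/2 \<in> s 0" "c$2 = of_int j + 1/2" "- (2^Suc n) \<le> j" "j < 2^Suc n"
      by blast
    obtain w where w: "w \<in> s 1" "c$1 - 1/2 = 2 * w \<or> c$1 - 1/2 = 2 * w + 1"
      using mem_solenoid_double[OF Suc.prems, of _ 0] j(1) by auto
    define e :: "real^2" where "e = vector [w + 1/2, of_int (j div 2) + 1/2]"
    have "- (2^n) \<le> j div 2" "j div 2 < 2^n" using j(3,4) by auto
    then have "\<exists>a. (e, a) \<in> level ?s n" using IH[of e] w(1) unfolding e_def by auto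
    then obtain a where a: "(e, a) \<in> level ?s n" ..
    have "j = 2 * (j div 2) \<or> j = 2 * (j div 2) + 1" by presburger
    then have "(of_int j::real) = 2 * of_int (j div 2) \<or> (of_int j::real) = 2 * of_int (j div 2) + 1"
      by (metis of_int_add of_int_mult of_int_numeral of_int_1)
    then have "\<exists>q. c = child e q"
      using w(2) j(2)
      by (elim disjE) (force simp: e_def vec2_eq_iff intro: exI[of _ SW] exI[of _ NW] exI[of _ SE] exI[of _ NE])+
    then show ?L using child_in_subst[OF a] unfolding lv by blast
  qed
qed

text \<open>A row reappears along the axis inside the substitution of the row one level up, so the
  strips are nested with agreeing labels.\<close>

lemma level_Suc_mono:
  assumes "s \<in> topspace dyadic_solenoid" shows "level s n \<subseteq> level s (Suc n)"
proof -
  have "s (Suc n) = RZ_double (s (Suc (Suc n)))" using assms unfolding solenoid_iff by blast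
  then have "row (s (Suc n)) \<subseteq> chair_subst (row (s (Suc (Suc n))))"
    using subst_row[OF solenoid_class[OF assms]] by simp
  from iterate_mono[OF this, of n] show ?thesis by (simp add: funpow_swap1)
qed

lemma level_mono:
  assumes "s \<in> topspace dyadic_solenoid" "m \<le> n" shows "level s m \<subseteq> level s n"
  by (rule lift_Suc_mono_le[where f = "level s"]) (use assms level_Suc_mono in auto)

lemma finite_sol_tiling_level:
  assumes s: "s \<in> topspace dyadic_solenoid" and P: "finite P" "P \<subseteq> sol_tiling s"
  shows "\<exists>n. P \<subseteq> level s n"
  using P
proof (induction P)
  case (insert t P)
  then obtain n m where "P \<subseteq> level s n" "t \<in> level s m" unfolding sol_tiling_def by blast
  then have "insert t P \<subseteq> level s (max m n)"
    using level_mono[OF s, of n "max m n"] level_mono[OF s, of m "max m n"] by auto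
  then show ?case ..
qed simp

lemma iterate_finite:
  assumes "finite P" "P \<subseteq> (chair_subst ^^ n) R"
  shows "\<exists>F\<subseteq>R. finite F \<and> P \<subseteq> (chair_subst ^^ n) F"
proof -
  have "(chair_subst ^^ n) (\<Union>t\<in>R. {t}) = (\<Union>t\<in>R. (chair_subst ^^ n) {t})" by (rule iterate_UN)
  then have "\<forall>p\<in>P. \<exists>t\<in>R. p \<in> (chair_subst ^^ n) {t}" using assms(2) by auto
  then obtain g where g: "\<And>p. p \<in> P \<Longrightarrow> g p \<in> R \<and> p \<in> (chair_subst ^^ n) {g p}" by metis
  have "p \<in> (chair_subst ^^ n) (g ` P)" if "p \<in> P" for p
    using g[OF that] iterate_mono[of "{g p}" "g ` P" n] that by blast
  then show ?thesis using g assms(1) by (intro exI[of _ "g ` P"]) blast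
qed

text \<open>A finite patch lies in one strip, hence in an iterate of a finite part of a row.\<close>

lemma legal_sol_tiling:
  assumes s: "s \<in> topspace dyadic_solenoid" and P: "finite P" "P \<subseteq> sol_tiling s"
  shows "legal P"
proof -
  obtain n where "P \<subseteq> level s n" using finite_sol_tiling_level[OF assms] by blast
  then obtain F where F: "F \<subseteq> row (s (Suc n))" "finite F" "P \<subseteq> (chair_subst ^^ n) F"
    using iterate_finite[OF P(1)] by blast
  have "legal F" by (rule legal_finite_row[OF solenoid_class[OF s] F(2,1)])
  then show ?thesis by (rule legal_subset[OF legal_iterate F(3)])
qed

lemma patchy_sol_tiling:
  assumes s: "s \<in> topspace dyadic_solenoid" shows "patchy (sol_tiling s)"
proof -
  have "patchy {t, u}" if "t \<in> sol_tiling s" "u \<in> sol_tiling s" for t u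
    using legal_patchy[OF legal_sol_tiling[OF s, of "{t, u}"]] that by simp
  then show ?thesis unfolding patchy_def by blast
qed

lemma sol_tiling_centres:
  assumes s: "s \<in> topspace dyadic_solenoid"
  shows "(\<exists>a. (c, a) \<in> sol_tiling s) \<longleftrightarrow> c$1 - 1/2 \<in> s 0 \<and> c$2 - 1/2 \<in> \<int>"
proof
  assume "\<exists>a. (c, a) \<in> sol_tiling s"
  then obtain n a where "(c, a) \<in> level s n" unfolding sol_tiling_def by blast
  then obtain j where "c$1 - 1/2 \<in> s 0" "c$2 = of_int j + 1/2" using level_centres[OF s] by blast
  then show "c$1 - 1/2 \<in> s 0 \<and> c$2 - 1/2 \<in> \<int>" by simp
next
  assume *: "c$1 - 1/2 \<in> s 0 \<and> c$2 - 1/2 \<in> \<int>"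
  then obtain j where j: "c$2 - 1/2 = of_int j" using Ints_cases by blast
  define n where "n = nat \<bar>j\<bar> + 1"
  have "int n < 2 ^ n" by simp
  then have "- (2^n) \<le> j \<and> j < 2^n" unfolding n_def by linarith
  moreover have "c$2 = of_int j + 1/2" using j by simp
  ultimately have "\<exists>a. (c, a) \<in> level s n" using level_centres[OF s] * by blast
  then show "\<exists>a. (c, a) \<in> sol_tiling s" unfolding sol_tiling_def by blast
qed

text \<open>Level \<open>n\<close> already fills every lattice site of its strip, and a site carries
  only one label in the whole tiling.\<close>

lemma sol_tiling_strip:
  assumes s: "s \<in> topspace dyadic_solenoid" and ca: "(c, a) \<in> sol_tiling s" and "\<bar>c$2\<bar> < 2 ^ n"
  shows "(c, a) \<in> level s n"
proof -
  have c: "c$1 - 1/2 \<in> s 0" "c$2 - 1/2 \<in> \<int>" using sol_tiling_centres[OF s] ca by blast+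
  then obtain j where j: "c$2 - 1/2 = of_int j" using Ints_cases by blast
  then have "c$2 = of_int j + 1/2" by simp
  moreover have "c$2 < 2^n" "- (2^n) < c$2" using assms(3) unfolding abs_less_iff by linarith+
  ultimately have "of_int j < (2^n :: real)" "- (2^n) < (of_int j + 1 :: real)" by linarith+
  then have "of_int j < (of_int (2^n) :: real)" "of_int (- (2^n)) < (of_int (j + 1) :: real)"
    by (simp_all only: of_int_minus of_int_power of_int_numeral of_int_add of_int_1)
  then have "- (2^n) \<le> j \<and> j < 2^n" unfolding of_int_less_iff by linarith
  then obtain b where b: "(c, b) \<in> level s n"
    using level_centres[OF s] c \<open>c$2 = of_int j + 1/2\<close> by blast
  then have "(c, b) \<in> sol_tiling s" unfolding sol_tiling_def by blast
  then show ?thesis using patchyD(2)[OF patchy_sol_tiling[OF s] ca] b by blast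
qed

lemma sol_tiling_sym:
  assumes s: "s \<in> topspace dyadic_solenoid" shows "sol_tiling s \<in> sym_tilings"
proof -
  have "\<exists>b. (d, b) \<in> sol_tiling s" if ca: "(c, a) \<in> sol_tiling s" and i: "int_vec (d - c)" for c a d
  proof -
    have c: "c$1 - 1/2 \<in> s 0" "c$2 - 1/2 \<in> \<int>" using sol_tiling_centres[OF s] ca by blast+
    have "d$1 - 1/2 \<in> s 0"
      by (rule class_mem_add[OF solenoid_class[OF s] c(1)]) (use i in \<open>simp add: int_vec_def\<close>)
    moreover have "(d$2 - c$2) + (c$2 - 1/2) \<in> \<int>" using i c by (intro Ints_add) (simp_all add: int_vec_def)
    ultimately show ?thesis using sol_tiling_centres[OF s, of d] by simp
  qed
  moreover have "sol_tiling s \<noteq> {}"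
  proof -
    obtain x where "x \<in> s 0" using class_nonempty[OF solenoid_class[OF s]] by blast
    then show ?thesis using sol_tiling_centres[OF s, of "vector [x + 1/2, 1/2]"] by auto
  qed
  ultimately have "gridded (sol_tiling s)"
    unfolding gridded_def using patchy_sol_tiling[OF s] by (auto simp: split_paired_all)
  then have "sol_tiling s \<in> chair_tilings"
    unfolding chair_tilings_iff using legal_sol_tiling[OF s] by blast
  moreover have "act_tiling refl_x (sol_tiling s) = (\<Union>n. act_tiling refl_x (level s n))"
    unfolding sol_tiling_def act_tiling_def by blast
  then have "act_tiling refl_x (sol_tiling s) = sol_tiling s"
    unfolding sol_tiling_def by (simp add: act_iterate[OF chair_sym_refl_x] row_refl)
  ultimately show ?thesis unfolding sym_tilings_def by blast
qed

text \<open>Desubstitution corresponds to the shift of the sequence; since the levels increase, the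
  union may start at level 1.\<close>

lemma sol_tiling_subst:
  assumes s: "s \<in> topspace dyadic_solenoid"
  shows "chair_subst (sol_tiling (\<lambda>n. s (Suc n))) = sol_tiling s"
proof -
  have "chair_subst (sol_tiling (\<lambda>n. s (Suc n))) = (\<Union>n. level s (Suc n))"
    unfolding sol_tiling_def subst_UN by simp
  also have "\<dots> = (\<Union>n. level s n)"
    using level_Suc_mono[OF s] by blast
  finally show ?thesis unfolding sol_tiling_def .
qed

section \<open>Bijectivity of the parametrisation by the solenoid\<close>

lemma subst_inj:
  assumes "patchy P" "chair_subst P = chair_subst Q" "(c, a) \<in> P" "(c, b) \<in> Q"
  shows "a = b"
proof (rule sub_label_inj)
  fix q
  have "(child c q, sub_label b q) \<in> chair_subst P" using child_in_subst assms(2,4) by blast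
  then show "sub_label a q = sub_label b q"
    using patchyD(2)[OF patchy_subst[OF assms(1)] child_in_subst[OF assms(3)]] by blast
qed

text \<open>The row above the axis alternates NE and NW, so its NE tiles allow coordinate 1 to be
  read off from the tiling.\<close>

lemma sol_tiling_NE:
  assumes s: "s \<in> topspace dyadic_solenoid"
  shows "(vector [2 * z + 1/2, 1/2], NE) \<in> sol_tiling s \<longleftrightarrow> z \<in> s 1"
proof
  have row: "row (s 1) \<subseteq> sol_tiling s"
    unfolding sol_tiling_def using UN_upper[of 0 UNIV "level s"] by simp
  show "z \<in> s 1 \<Longrightarrow> (vector [2 * z + 1/2, 1/2], NE) \<in> sol_tiling s"
    using row unfolding row_def block_def by auto
  assume z: "(vector [2 * z + 1/2, 1/2], NE) \<in> sol_tiling s"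
  then have "2 * z \<in> s 0" using sol_tiling_centres[OF s, of "vector [2 * z + 1/2, 1/2]"] by auto
  then obtain w where w: "w \<in> s 1" "2 * z = 2 * w \<or> 2 * z = 2 * w + 1"
    using mem_solenoid_double[OF s, of _ 0] by auto
  show "z \<in> s 1"
  proof (cases "2 * z = 2 * w")
    case False
    then have "2 * z + 1/2 = 2 * w + 3/2" using w(2) by simp
    then have "(vector [2 * z + 1/2, 1/2], NW) \<in> sol_tiling s"
      using row w(1) unfolding row_def block_def by auto
    then show ?thesis using patchyD(2)[OF patchy_sol_tiling[OF s] z] by blast
  qed (use w in simp)
qed

text \<open>Coordinate 1 is visible in the tiling and also fixes the grid of the preimage under
  substitution. On a known grid the preimage is unique, so the argument can be repeated one level
  further.\<close>

lemma sol_tiling_inj: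
  assumes "s \<in> topspace dyadic_solenoid" "t \<in> topspace dyadic_solenoid" "sol_tiling s = sol_tiling t"
  shows "s = t"
proof
  fix n
  have "s n = t n \<and> s (Suc n) = t (Suc n)"
    using assms
  proof (induction n arbitrary: s t)
    case 0
    have "s 1 = t 1" using sol_tiling_NE 0 by blast
    moreover have "s 0 = RZ_double (s 1)" "t 0 = RZ_double (t 1)"
      using 0(1,2) unfolding solenoid_iff One_nat_def by blast+
    ultimately show ?case by simp
  next
    case (Suc n)
    let ?s = "\<lambda>n. s (Suc n)" and ?t = "\<lambda>n. t (Suc n)"
    note sh = Suc.prems(1,2)[THEN solenoid_shift]
    have "s 1 = t 1" using sol_tiling_NE Suc.prems by blast
    then have c: "(\<exists>a. (c, a) \<in> sol_tiling ?s) \<longleftrightarrow> (\<exists>a. (c, a) \<in> sol_tiling ?t)" for c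
      using sol_tiling_centres[OF sh(1), of c] sol_tiling_centres[OF sh(2), of c] by simp
    have "chair_subst (sol_tiling ?s) = chair_subst (sol_tiling ?t)"
      using Suc.prems sol_tiling_subst by simp
    then have "(c, a) \<in> sol_tiling ?s \<longleftrightarrow> (c, a) \<in> sol_tiling ?t" for c a
      using c[of c] subst_inj[OF patchy_sol_tiling[OF sh(1)]] by blast
    then have "sol_tiling ?s = sol_tiling ?t" by auto
    from Suc.IH[OF sh this] show ?case by simp
  qed
  then show "s n = t n" ..
qed

text \<open>Repeated desubstitution gives tilings \<open>F n\<close>, whose left edges define
  coordinate \<open>n\<close>. The row pattern is forced in every \<open>F n\<close>, which gives an
  inclusion \<open>sol_tiling s \<subseteq> T\<close>, and \<open>gridded_eq\<close> makes it an
  equality.\<close>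

lemma sol_tiling_surj:
  assumes T: "T \<in> sym_tilings"
  shows "\<exists>s\<in>topspace dyadic_solenoid. sol_tiling s = T"
proof -
  have step: "\<exists>V. V \<in> sym_tilings \<and> chair_subst V = U" if "U \<in> sym_tilings" for U
  proof -
    have "U \<in> chair_tilings" using that unfolding sym_tilings_def by blast
    then obtain V where "V \<in> chair_tilings" "chair_subst V = U" by (rule chair_desubst)
    then show ?thesis using sym_desubst that by blast
  qed
  have "\<exists>F. F 0 = T \<and> (\<forall>n. F n \<in> sym_tilings \<and> chair_subst (F (Suc n)) = F n)"
  proof -
    define F where "F = rec_nat T (\<lambda>_ U. SOME V. V \<in> sym_tilings \<and> chair_subst V = U)"
    have F: "F 0 = T" "F (Suc n) = (SOME V. V \<in> sym_tilings \<and> chair_subst V = F n)" for n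
      by (simp_all add: F_def)
    have S: "F (Suc n) \<in> sym_tilings \<and> chair_subst (F (Suc n)) = F n" if "F n \<in> sym_tilings" for n
      unfolding F(2) by (rule someI_ex[OF step[OF that]])
    have "F n \<in> sym_tilings" for n
      by (induction n) (use T F(1) S in auto)
    then show ?thesis using F(1) S by blast
  qed
  then obtain F where F0: "F 0 = T" and F: "\<And>n. F n \<in> sym_tilings" "\<And>n. chair_subst (F (Suc n)) = F n"
    by blast
  note g = F(1)[THEN sym_tilings_gridded(1)] and p = F(1)[THEN sym_tilings_gridded(2)]
  define s where "s n = {x. \<exists>c a. (c, a) \<in> F n \<and> x = c$1 - 1/2}" for n
  have cls: "s n = RZ_class (c$1 - 1/2)" if c: "(c, a) \<in> F n" for n c a
  proof -
    have "x \<in> s n \<longleftrightarrow> x \<in> RZ_class (c$1 - 1/2)" for x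
    proof
      assume "x \<in> s n"
      then obtain d b where "(d, b) \<in> F n" "x = d$1 - 1/2" unfolding s_def by blast
      then show "x \<in> RZ_class (c$1 - 1/2)"
        using patchyD(1)[OF p \<open>(d, b) \<in> F n\<close> c] by (simp add: mem_RZ_class int_vec_def)
    next
      assume "x \<in> RZ_class (c$1 - 1/2)"
      then have "int_vec (vector [x + 1/2, c$2] - c)" by (simp add: mem_RZ_class int_vec_def algebra_simps)
      then obtain b where "(vector [x + 1/2, c$2], b) \<in> F n" using griddedD[OF g c] by blast
      then show "x \<in> s n" unfolding s_def by (intro CollectI exI conjI) (assumption, simp)
    qed
    then show ?thesis by blast
  qed
  have ex: "\<exists>c a. (c, a) \<in> F n" for n using g[of n] unfolding gridded_def by auto
  have dbl: "s n = RZ_double (s (Suc n))" for n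
  proof -
    obtain c a where c: "(c, a) \<in> F (Suc n)" using ex by blast
    have "(child c SW, sub_label a SW) \<in> F n" using child_in_subst[OF c] F(2) by blast
    from cls[OF this] cls[OF c] show ?thesis by (simp add: RZ_double_class right_diff_distrib)
  qed
  have s: "s \<in> topspace dyadic_solenoid"
    unfolding solenoid_iff using dbl cls ex by blast
  have "row (s (Suc n)) \<subseteq> F n" for n
  proof -
    have up: "(vector [2 * z + 1/2, 1/2], NE) \<in> F n \<and> (vector [2 * z + 3/2, 1/2], NW) \<in> F n"
      if z: "z \<in> s (Suc n)" for z
    proof -
      obtain c a where c: "(c, a) \<in> F (Suc n)" "z = c$1 - 1/2" using z unfolding s_def by blast
      define d :: "real^2" where "d = vector [c$1, 1/2]"
      have "- (c$2 - 1/2) \<in> \<int>" using sym_tiling_height[OF F(1) c(1)] Ints_minus by blast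
      then have "int_vec (d - c)" by (simp add: int_vec_def d_def)
      then obtain b where b: "(d, b) \<in> F (Suc n)" using griddedD[OF g c(1)] by blast
      \<comment> \<open>Only NE and NW remain just above the axis, and both have the lower quarters
        NE and NW.\<close>
      have "b \<noteq> SE" "b \<noteq> SW" using sym_tiling_row[OF F(1) b] by (simp_all add: d_def)
      then have "sub_label b SW = NE" "sub_label b SE = NW" by (cases b; simp)+
      moreover have "child d SW = vector [2 * z + 1/2, 1/2]" "child d SE = vector [2 * z + 3/2, 1/2]"
        using c(2) by (simp_all add: d_def vec2_eq_iff)
      ultimately show ?thesis
        using child_in_subst[OF b, of SW] child_in_subst[OF b, of SE] F(2)[of n] by simp
    qed
    have "(vector [2 * z + 1/2, -1/2], SE) \<in> F n \<and> (vector [2 * z + 3/2, -1/2], SW) \<in> F n"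
      if z: "z \<in> s (Suc n)" for z
      using up[OF z] sym_tilingD[OF F(1), of "vector [2 * z + 1/2, 1/2]" NE n]
        sym_tilingD[OF F(1), of "vector [2 * z + 3/2, 1/2]" NW n]
      by (simp add: refl_x_mult act_arrow_refl_x)
    then show ?thesis using up unfolding row_def block_def by blast
  qed
  moreover have "(chair_subst ^^ n) (F n) = T" for n
    by (induction n) (simp_all add: F0 F(2) funpow_swap1)
  ultimately have "level s n \<subseteq> T" for n using iterate_mono by metis
  then have "sol_tiling s \<subseteq> T" unfolding sol_tiling_def by blast
  then have "sol_tiling s = T"
    using gridded_eq sym_tilings_gridded sol_tiling_sym[OF s] T by blast
  then show ?thesis using s by blast
qed

text \<open>A change of coordinate \<open>Suc n\<close> moves the row rigidly by twice that amount,
  because of the factor 2 in \<open>block\<close>, and each of the \<open>n\<close> substitutions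
  doubles the displacement.\<close>

lemma level_translate:
  assumes "s \<in> topspace dyadic_solenoid" "t \<in> topspace dyadic_solenoid" "z \<in> s (Suc n)" "w \<in> t (Suc n)"
  shows "level t n = translate (vector [2 ^ Suc n * (w - z), 0]) (level s n)"
proof -
  have "t (Suc n) = (\<lambda>x. x + (w - z)) ` s (Suc n)"
  proof (intro equalityI subsetI)
    fix x assume "x \<in> t (Suc n)"
    then have "(x - w + z) - z \<in> \<int>"
      using class_mem_unique[OF solenoid_class[OF assms(2)] _ assms(4)] by simp
    then have "x - w + z \<in> s (Suc n)" using class_mem_add[OF solenoid_class[OF assms(1)] assms(3)] by blast
    then show "x \<in> (\<lambda>x. x + (w - z)) ` s (Suc n)" by (intro image_eqI[of _ _ "x - w + z"]) auto
  next
    fix x assume "x \<in> (\<lambda>x. x + (w - z)) ` s (Suc n)"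
    then obtain y where y: "y \<in> s (Suc n)" "x = y + (w - z)" by blast
    then have "x - w \<in> \<int>"
      using class_mem_unique[OF solenoid_class[OF assms(1)] y(1) assms(3)] by simp
    then show "x \<in> t (Suc n)" using class_mem_add[OF solenoid_class[OF assms(2)] assms(4)] by blast
  qed
  then have "row (t (Suc n)) = translate (vector [2 * (w - z), 0]) (row (s (Suc n)))"
    by (simp only: row_translate)
  moreover have "2 ^ n *\<^sub>R vector [2 * (w - z), 0] = (vector [2 ^ Suc n * (w - z), 0] :: real^2)"
    by (simp add: vec2_eq_iff)
  ultimately show ?thesis by (simp only: iterate_translate)
qed

subsection \<open>The tiling topology is Hausdorff\<close>

lemma patch_at_eq_iff:
  "patch_at r A = patch_at r B \<longleftrightarrow>
     (\<forall>c a. tile_supp (c, a) \<inter> cball 0 r \<noteq> {} \<longrightarrow> ((c, a) \<in> A \<longleftrightarrow> (c, a) \<in> B))"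
  unfolding patch_at_def by auto

lemma tile_supp_shift:
  assumes "tile_supp (c, a) \<inter> cball 0 r \<noteq> {}"
  shows "tile_supp (c - v, a) \<inter> cball 0 (r + norm v) \<noteq> {}"
proof -
  obtain p where p: "p \<in> tile_supp (c, a)" "norm p \<le> r" using assms by auto
  have "p - v \<in> tile_supp (c - v, a)" using p(1) by (simp add: mem_tile_supp)
  moreover have "norm (p - v) \<le> r + norm v" using p(2) norm_triangle_ineq4[of p v] by linarith
  ultimately show ?thesis by (auto simp: disjoint_iff)
qed

lemma tile_supp_mono:
  "tile_supp (c, a) \<inter> cball 0 r \<noteq> {} \<Longrightarrow> r \<le> r' \<Longrightarrow> tile_supp (c, a) \<inter> cball 0 r' \<noteq> {}"
  by auto

lemma tiling_close_refl: "0 < e \<Longrightarrow> tiling_close e S S"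
  unfolding tiling_close_def by (intro exI[of _ 0]) simp

lemma tiling_close_sym: "tiling_close e S T \<Longrightarrow> tiling_close e T S"
  unfolding tiling_close_def by metis

text \<open>Composing the shifts costs at most \<open>d\<close> in the radius, and
  \<open>d \<le> 1/2\<close> gives \<open>1 / (2 * d) + d \<le> 1 / d\<close>.\<close>

lemma tiling_close_trans:
  assumes d: "0 < d" "d \<le> 1/2" and RS: "tiling_close d R S" and ST: "tiling_close d S T"
  shows "tiling_close (2 * d) R T"
proof -
  obtain x y where xy: "norm x \<le> d" "norm y \<le> d"
      "patch_at (1/d) (translate x R) = patch_at (1/d) (translate y S)"
    using RS unfolding tiling_close_def by blast
  obtain u v where uv: "norm u \<le> d" "norm v \<le> d"
      "patch_at (1/d) (translate u S) = patch_at (1/d) (translate v T)"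
    using ST unfolding tiling_close_def by blast
  have "d * (2 * d) \<le> 1 * (2 * (1/2))" using d by (intro mult_mono) auto
  then have r: "1 / (2 * d) + d \<le> 1 / d" using d(1) by (simp add: field_simps)
  have "(c, a) \<in> translate (x + u) R \<longleftrightarrow> (c, a) \<in> translate (v + y) T"
    if m: "tile_supp (c, a) \<inter> cball 0 (1 / (2 * d)) \<noteq> {}" for c a
  proof -
    have mm: "tile_supp (c - w, a) \<inter> cball 0 (1/d) \<noteq> {}" if "norm w \<le> d" for w
      by (rule tile_supp_mono[OF tile_supp_shift[OF m]]) (use r that in linarith)
    have "(c, a) \<in> translate (x + u) R \<longleftrightarrow> (c - u, a) \<in> translate x R"
      by (simp add: mem_translate algebra_simps)
    also have "\<dots> \<longleftrightarrow> (c - u, a) \<in> translate y S"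
      using xy(3) mm[OF uv(1)] unfolding patch_at_eq_iff by blast
    also have "\<dots> \<longleftrightarrow> (c - y, a) \<in> translate u S"
      by (simp add: mem_translate algebra_simps)
    also have "\<dots> \<longleftrightarrow> (c - y, a) \<in> translate v T"
      using uv(3) mm[OF xy(2)] unfolding patch_at_eq_iff by blast
    also have "\<dots> \<longleftrightarrow> (c, a) \<in> translate (v + y) T"
      by (simp add: mem_translate algebra_simps)
    finally show ?thesis .
  qed
  then have "patch_at (1 / (2 * d)) (translate (x + u) R) = patch_at (1 / (2 * d)) (translate (v + y) T)"
    unfolding patch_at_eq_iff by blast
  moreover have "norm (x + u) \<le> 2 * d" "norm (v + y) \<le> 2 * d"
    using xy uv norm_triangle_ineq[of x u] norm_triangle_ineq[of v y] by linarith+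
  ultimately show ?thesis unfolding tiling_close_def by blast
qed

text \<open>Closeness at scale \<open>e\<close> puts into \<open>T\<close> a copy of each given tile
  of \<open>S\<close>, displaced by at most \<open>2 * e\<close>, once \<open>e\<close> is small.
  Small displacements of such copies agree by integrality, so a nonzero one contradicts a still
  smaller scale.\<close>

lemma close_subset:
  assumes T: "T \<in> chair_tilings" and cl: "\<And>e. 0 < e \<Longrightarrow> tiling_close e S T"
  shows "S \<subseteq> T"
proof -
  have pT: "patchy T" using T unfolding chair_tilings_iff gridded_def by blast
  have "(c, a) \<in> T" if ca: "(c, a) \<in> S" for c a
  proof -
    \<comment> \<open>The second bound keeps the displaced centre in the ball of radius
      \<open>1 / e\<close>; the bound 1/8 keeps the difference of two displacements below 1.\<close>
    define e0 where "e0 = min (1/8) (1 / (norm c + 1))"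
    have e0: "e0 > 0" "e0 \<le> 1/8" unfolding e0_def by (auto intro!: divide_pos_pos add_nonneg_pos)
    have shift: "\<exists>w. norm w \<le> 2 * e \<and> (c + w, a) \<in> T" if e: "0 < e" "e \<le> e0" for e
    proof -
      obtain x y where xy: "norm x \<le> e" "norm y \<le> e"
          "patch_at (1/e) (translate x S) = patch_at (1/e) (translate y T)"
        using cl[OF e(1)] unfolding tiling_close_def by blast
      have "e \<le> 1 / (norm c + 1)" using e(2) unfolding e0_def by simp
      then have "e * (norm c + 1) \<le> 1"
        using pos_le_divide_eq[of "norm c + 1" e 1] add_nonneg_pos[of "norm c" 1] by simp
      then have "norm c + 1 \<le> 1 / e"
        using pos_le_divide_eq[OF e(1), of "norm c + 1" 1] by (simp add: mult.commute)
      moreover have "norm (c + x) \<le> norm c + e" using xy(1) norm_triangle_ineq[of c x] by linarith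
      ultimately have "norm (c + x) \<le> 1/e" using e e0 by linarith
      then have "tile_supp (c + x, a) \<inter> cball 0 (1/e) \<noteq> {}"
        by (auto simp: disjoint_iff mem_tile_supp intro!: exI[of _ "c + x"])
      moreover have "(c + x, a) \<in> translate x S" using ca by (simp add: mem_translate)
      ultimately have "(c + x, a) \<in> translate y T" using xy(3) unfolding patch_at_eq_iff by blast
      then have "(c + (x - y), a) \<in> T" by (simp add: mem_translate algebra_simps)
      moreover have "norm (x - y) \<le> 2 * e" using xy norm_triangle_ineq4[of x y] by linarith
      ultimately show ?thesis by blast
    qed
    obtain w where w: "norm w \<le> 2 * e0" "(c + w, a) \<in> T" using shift[of e0] e0 by auto
    show ?thesis
    proof (cases "w = 0")
      case False
      \<comment> \<open>At this scale a displacement is at most half as long as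
        \<open>w\<close>.\<close>
      define e1 where "e1 = min e0 (norm w / 4)"
      have e1: "0 < e1" "e1 \<le> e0" "e1 \<le> norm w / 4" using False e0 unfolding e1_def by auto
      obtain u where u: "norm u \<le> 2 * e1" "(c + u, a) \<in> T" using shift[OF e1(1,2)] by blast
      have i: "int_vec (w - u)" using patchyD(1)[OF pT w(2) u(2)] by simp
      have "norm (w - u) < 1"
        using w(1) u(1) e1(2) e0(2) norm_triangle_ineq4[of w u] by linarith
      then have "\<bar>(w - u)$i\<bar> < 1" for i using component_le_norm_cart[of "w - u" i] by linarith
      then have "w - u = 0" using int_vec_small[OF i] by blast
      then have "norm w \<le> 2 * e1" using u(1) by simp
      then have "norm w \<le> 0" using e1(3) by linarith
      then show ?thesis using False by simp
    qed (use w in simp)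
  qed
  then show ?thesis by auto
qed

lemma close_all_eq:
  assumes "S \<in> chair_tilings" "T \<in> chair_tilings" "\<And>e. 0 < e \<Longrightarrow> tiling_close e S T"
  shows "S = T"
  using close_subset[OF assms(2,3)] close_subset[OF assms(1) tiling_close_sym[OF assms(3)]] by blast

lemma Hausdorff_chair_space: "Hausdorff_space chair_space"
  unfolding Hausdorff_space_def topspace_chair_space
proof (intro allI impI)
  fix S T assume ST: "S \<in> chair_tilings \<and> T \<in> chair_tilings \<and> S \<noteq> T"
  \<comment> \<open>Closeness is transitive only up to a factor 2, which does not make its balls
    open. \<open>N Q e\<close> is the interior of the ball: the tilings around which some smaller
    ball stays inside.\<close>
  define N where "N Q e = {R \<in> chair_tilings. \<exists>d>0. \<forall>R'\<in>chair_tilings.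
      tiling_close d R R' \<longrightarrow> tiling_close e Q R'}" for Q e
  have N_open: "openin chair_space (N Q e)" for Q e
    unfolding openin_chair_space
  proof (intro conjI ballI)
    show "N Q e \<subseteq> chair_tilings" unfolding N_def by blast
    fix R assume "R \<in> N Q e"
    then obtain d where d: "d > 0" "\<And>R'. R' \<in> chair_tilings \<Longrightarrow> tiling_close d R R' \<Longrightarrow> tiling_close e Q R'"
      unfolding N_def by blast
    define h where "h = min (1/2) (d/2)"
    have h: "0 < h" "h \<le> 1/2" "2 * h \<le> d" using d(1) unfolding h_def by auto
    have "R1 \<in> N Q e" if R1: "R1 \<in> chair_tilings" "tiling_close h R R1" for R1
    proof -
      have "tiling_close e Q R'" if R': "R' \<in> chair_tilings" "tiling_close h R1 R'" for R'
      proof -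
        have "tiling_close (2 * h) R R'" by (rule tiling_close_trans[OF h(1,2) R1(2) R'(2)])
        then have "tiling_close d R R'" by (rule tiling_close_mono) (use h in auto)
        then show ?thesis by (rule d(2)[OF R'(1)])
      qed
      then show ?thesis using R1(1) h(1) unfolding N_def by blast
    qed
    then show "\<exists>\<epsilon>>0. \<forall>T\<in>chair_tilings. tiling_close \<epsilon> R T \<longrightarrow> T \<in> N Q e" using h(1) by blast
  qed
  obtain e where e: "0 < e" "\<not> tiling_close e S T" using close_all_eq ST by blast
  define h where "h = min (1/2) (e/2)"
  have h: "0 < h" "h \<le> 1/2" "2 * h \<le> e" using e(1) unfolding h_def by auto
  have mem: "Q \<in> N Q h" if "Q \<in> chair_tilings" for Q using that h(1) unfolding N_def by blast
  have close: "tiling_close h Q R" if "R \<in> N Q h" for Q R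
    using that tiling_close_refl unfolding N_def by blast
  have "disjnt (N S h) (N T h)"
    unfolding disjnt_iff
  proof (intro allI notI)
    fix R assume "R \<in> N S h \<and> R \<in> N T h"
    then have "tiling_close h S R" "tiling_close h R T" using close tiling_close_sym by blast+
    then have "tiling_close (2 * h) S T" by (rule tiling_close_trans[OF h(1,2)])
    then have "tiling_close e S T" by (rule tiling_close_mono) (use h in auto)
    then show False using e(2) by blast
  qed
  then show "\<exists>U V. openin chair_space U \<and> openin chair_space V \<and> S \<in> U \<and> T \<in> V \<and> disjnt U V"
    using N_open mem ST by blast
qed

subsection \<open>Topology of the solenoid\<close>

lemma continuous_map_RZ_iff:
  "continuous_map RZ X f \<longleftrightarrow> continuous_map euclideanreal X (\<lambda>x. f (RZ_class x))"
  using continuous_compose_quotient_map_eq[OF quotient_map_RZ_class, of X f] by (simp add: o_def)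

lemma continuous_map_RZ_class: "continuous_map euclideanreal RZ RZ_class"
  using quotient_map_RZ_class by (rule quotient_imp_continuous_map)

text \<open>The map \<open>x \<mapsto> cis (2 * pi * x)\<close> descends to a continuous injection
  into the complex plane.\<close>

lemma Hausdorff_RZ: "Hausdorff_space RZ"
proof -
  define h where "h C = cis (2 * pi * (SOME x. x \<in> C))" for C :: "real set"
  have h: "h (RZ_class x) = cis (2 * pi * x)" for x
  proof -
    have "(SOME y. y \<in> RZ_class x) \<in> RZ_class x" by (rule someI[of _ x]) (simp add: mem_RZ_class)
    then obtain k where "(SOME y. y \<in> RZ_class x) = x + of_int k" unfolding RZ_class_def by blast
    then show ?thesis by (simp add: h_def ring_distribs flip: cis_mult)
  qed
  have "continuous_map RZ euclidean h"
    unfolding continuous_map_RZ_iff h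
    by (simp add: cis_conv_exp) (intro continuous_intros)
  moreover have "inj_on h (topspace RZ)"
  proof (rule inj_onI)
    fix C D assume "C \<in> topspace RZ" "D \<in> topspace RZ" and e: "h C = h D"
    then obtain x y where xy: "C = RZ_class x" "D = RZ_class y" by (auto simp: topspace_RZ)
    then have "exp (\<i> * complex_of_real (2 * pi * x)) = exp (\<i> * complex_of_real (2 * pi * y))"
      using e h by (simp add: cis_conv_exp)
    then obtain n :: int where "\<i> * complex_of_real (2 * pi * x) = \<i> * complex_of_real (2 * pi * y) + of_int (2 * n) * of_real pi * \<i>"
      unfolding exp_eq by auto
    then have "\<i> * complex_of_real (2 * pi * x) = \<i> * complex_of_real (2 * pi * y + 2 * n * pi)"
      by (simp add: algebra_simps)
    then have "2 * pi * x = 2 * pi * y + 2 * n * pi" by (simp only: mult_left_cancel[OF complex_i_not_zero] of_real_eq_iff)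
    then have "2 * pi * (x - y) = 2 * pi * n" by (simp add: algebra_simps)
    then have "x - y = of_int n" by simp
    then show "C = D" using xy by (simp add: RZ_class_eq_iff)
  qed
  ultimately show ?thesis using Hausdorff_space_injective_preimage Hausdorff_space_euclidean by blast
qed

lemma compact_RZ: "compact_space RZ"
proof -
  have "compactin RZ (RZ_class ` {0..1})"
    by (rule image_compactin[OF _ continuous_map_RZ_class]) simp
  moreover have "RZ_class ` {0..1} = topspace RZ"
  proof -
    have "RZ_class x \<in> RZ_class ` {0..1}" for x
    proof -
      have "RZ_class x = RZ_class (frac x)" by (simp add: RZ_class_eq_iff frac_def)
      moreover have "frac x \<in> {0..1}" using frac_lt_1[of x] by (simp add: less_imp_le)
      ultimately show ?thesis by blast
    qed
    then show ?thesis by (auto simp: topspace_RZ)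
  qed
  ultimately show ?thesis unfolding compact_space_def by simp
qed

lemma continuous_RZ_double: "continuous_map RZ RZ RZ_double"
  unfolding continuous_map_RZ_iff RZ_double_class
  using continuous_map_compose[of euclideanreal euclideanreal "\<lambda>x. 2 * x" RZ RZ_class] continuous_map_RZ_class
  by (simp add: o_def continuous_intros)

lemma compact_dyadic_solenoid: "compact_space dyadic_solenoid"
proof -
  let ?X = "product_topology (\<lambda>_::nat. RZ) UNIV"
  have cpt: "compact_space ?X" unfolding compact_space_product_topology using compact_RZ by blast
  have "closedin ?X {s \<in> topspace ?X. s n = RZ_double (s (Suc n))}" for n
  proof (rule closedin_continuous_maps_eq[OF Hausdorff_RZ])
    show "continuous_map ?X RZ (\<lambda>s. s n)" by (rule continuous_map_product_projection) simp
    have "continuous_map ?X RZ (\<lambda>s. s (Suc n))" by (rule continuous_map_product_projection) simp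
    from continuous_map_compose[OF this continuous_RZ_double]
    show "continuous_map ?X RZ (\<lambda>s. RZ_double (s (Suc n)))" by (simp add: o_def)
  qed
  then have "closedin ?X (\<Inter>n. {s \<in> topspace ?X. s n = RZ_double (s (Suc n))})" by blast
  moreover have "(\<Inter>n. {s \<in> topspace ?X. s n = RZ_double (s (Suc n))})
      = topspace ?X \<inter> {s. \<forall>n. s n = RZ_double (s (Suc n))}" by blast
  ultimately have "compactin ?X (topspace ?X \<inter> {s. \<forall>n. s n = RZ_double (s (Suc n))})"
    using closedin_compact_space[OF cpt] by simp
  then show ?thesis unfolding dyadic_solenoid_def compactin_subspace by (metis subtopology_restrict)
qed

text \<open>Conditions on finitely many coordinates thereby reduce to a condition on the last of
  them.\<close>

lemma solenoid_power:
  assumes "s \<in> topspace dyadic_solenoid" "w \<in> s (i + k)"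
  shows "s i = RZ_class (2 ^ k * w)"
  using assms(2)
proof (induction k arbitrary: w)
  case 0
  then show ?case using class_eqI[OF solenoid_class[OF assms(1)], of "RZ_class w" w i] by (simp add: mem_RZ_class)
next
  case (Suc k)
  then have "2 * w \<in> s (i + k)" using mem_solenoid_double[OF assms(1), of "2 * w" "i + k"] by auto
  from Suc.IH[OF this] show ?case by (simp add: mult_ac)
qed

text \<open>A basic open set of the product restricts finitely many coordinates, all of them
  continuous functions of coordinate \<open>N\<close>.\<close>

lemma solenoid_nbhd:
  assumes U: "openin dyadic_solenoid U" and s: "s \<in> U"
  shows "\<exists>n. \<exists>z\<in>s n. \<exists>d>0. \<forall>t\<in>topspace dyadic_solenoid. (\<exists>w\<in>t n. \<bar>w - z\<bar> < d) \<longrightarrow> t \<in> U"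
proof -
  let ?X = "product_topology (\<lambda>_::nat. RZ) UNIV" and ?L = "{s. \<forall>n. s n = RZ_double (s (Suc n))}"
  have ts: "topspace dyadic_solenoid = topspace ?X \<inter> ?L" unfolding dyadic_solenoid_def by simp
  have sX: "s \<in> topspace dyadic_solenoid" using openin_subset[OF U] s by blast
  obtain W where W: "openin ?X W" "U = W \<inter> ?L"
    using U unfolding dyadic_solenoid_def openin_subtopology by blast
  then obtain V where V: "s \<in> PiE UNIV V" "\<And>i. openin RZ (V i)" "finite {i. V i \<noteq> topspace RZ}"
      "PiE UNIV V \<subseteq> W"
    using product_topology_open_contains_basis[OF W(1), of s] s by auto
  let ?F = "{i. V i \<noteq> topspace RZ}"
  obtain N where N: "\<And>i. i \<in> ?F \<Longrightarrow> i \<le> N" using V(3) by (meson finite_nat_set_iff_bounded_le)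
  obtain z where z: "z \<in> s N" using class_nonempty[OF solenoid_class[OF sX]] by blast
  have "\<forall>i\<in>?F. eventually (\<lambda>w. RZ_class (2 ^ (N - i) * w) \<in> V i) (nhds z)"
  proof
    fix i assume i: "i \<in> ?F"
    have "s i = RZ_class (2 ^ (N - i) * z)" using solenoid_power[OF sX, of z i "N - i"] z N[OF i] by simp
    moreover have "s i \<in> V i" using V(1) by blast
    ultimately have a: "2 ^ (N - i) * z \<in> RZ_class -` V i" by simp
    have b: "open (RZ_class -` V i)" using V(2) unfolding openin_RZ by blast
    have c: "((\<lambda>w. 2 ^ (N - i) * w) \<longlongrightarrow> 2 ^ (N - i) * z) (nhds z)"
      by (intro tendsto_intros) (simp add: filterlim_ident)
    show "eventually (\<lambda>w. RZ_class (2 ^ (N - i) * w) \<in> V i) (nhds z)"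
      using topological_tendstoD[OF c b a] by simp
  qed
  then have "eventually (\<lambda>w. \<forall>i\<in>?F. RZ_class (2 ^ (N - i) * w) \<in> V i) (nhds z)"
    by (rule eventually_ball_finite[OF V(3)])
  then obtain d where d: "d > 0" "\<And>w. \<bar>w - z\<bar> < d \<Longrightarrow> \<forall>i\<in>?F. RZ_class (2 ^ (N - i) * w) \<in> V i"
    unfolding eventually_nhds_metric by (auto simp: dist_real_def)
  have "t \<in> U" if t: "t \<in> topspace dyadic_solenoid" and w: "w \<in> t N" "\<bar>w - z\<bar> < d" for t w
  proof -
    have "t i \<in> V i" for i
    proof (cases "i \<in> ?F")
      case True
      then have "t i = RZ_class (2 ^ (N - i) * w)" using solenoid_power[OF t, of w i "N - i"] w N by simp
      then show ?thesis using d(2)[OF w(2)] True by simp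
    next
      case False
      then show ?thesis using solenoid_class[OF t] topspace_RZ by auto
    qed
    then have "t \<in> W" using V(4) by (auto simp: PiE_UNIV_domain)
    then show ?thesis using W(2) t unfolding ts by blast
  qed
  then show ?thesis using z d(1) by blast
qed

lemma openin_solenoid_coordinate:
  assumes "open V"
  shows "openin dyadic_solenoid {t \<in> topspace dyadic_solenoid. \<exists>w\<in>t n. w \<in> V}"
proof -
  have "continuous_map dyadic_solenoid RZ (\<lambda>s. s n)"
    unfolding dyadic_solenoid_def
    by (intro continuous_map_from_subtopology continuous_map_product_projection) simp
  moreover have "openin RZ (RZ_class ` V)"
  proof -
    have "RZ_class -` (RZ_class ` V) = (\<Union>k::int. (\<lambda>x. x + of_int k) ` V)"
    proof (intro equalityI subsetI)
      fix x assume "x \<in> RZ_class -` (RZ_class ` V)"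
      then obtain y where y: "y \<in> V" "RZ_class x = RZ_class y" by blast
      then obtain k where "x - y = of_int k" unfolding RZ_class_eq_iff by (auto elim: Ints_cases)
      then have "x = y + of_int k" by simp
      then show "x \<in> (\<Union>k::int. (\<lambda>x. x + of_int k) ` V)" using y(1) by blast
    next
      fix x assume "x \<in> (\<Union>k::int. (\<lambda>x. x + of_int k) ` V)"
      then obtain k :: int and y where "y \<in> V" "x = y + of_int k" by blast
      then have "RZ_class x = RZ_class y" by (simp add: RZ_class_eq_iff)
      then show "x \<in> RZ_class -` (RZ_class ` V)" using \<open>y \<in> V\<close> by blast
    qed
    moreover have "open ((\<lambda>x. x + of_int k) ` V)" for k :: int
      using open_translation[OF assms, of "of_int k"] by (simp add: add.commute)
    ultimately show ?thesis unfolding openin_RZ by auto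
  qed
  ultimately have "openin dyadic_solenoid {t \<in> topspace dyadic_solenoid. t n \<in> RZ_class ` V}"
    by (rule openin_continuous_map_preimage)
  moreover have "t n \<in> RZ_class ` V \<longleftrightarrow> (\<exists>w\<in>t n. w \<in> V)" if t: "t \<in> topspace dyadic_solenoid" for t
  proof
    assume "t n \<in> RZ_class ` V"
    then obtain w where "w \<in> V" "t n = RZ_class w" by blast
    then show "\<exists>w\<in>t n. w \<in> V" by (intro bexI[of _ w]) (auto simp: mem_RZ_class)
  next
    assume "\<exists>w\<in>t n. w \<in> V"
    then obtain w where w: "w \<in> t n" "w \<in> V" by blast
    then have "t n = RZ_class w" using solenoid_power[OF t, of w n 0] by simp
    then show "t n \<in> RZ_class ` V" using w by blast
  qed
  then have "{t \<in> topspace dyadic_solenoid. t n \<in> RZ_class ` V}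
      = {t \<in> topspace dyadic_solenoid. \<exists>w\<in>t n. w \<in> V}" by blast
  ultimately show ?thesis by simp
qed

text \<open>The solenoid is connected because this line is dense in it.\<close>

definition sol_line :: "real \<Rightarrow> nat \<Rightarrow> real set" where
  "sol_line x n = RZ_class (x / 2 ^ n)"

lemma sol_line_in: "sol_line x \<in> topspace dyadic_solenoid"
  unfolding solenoid_iff sol_line_def by (simp add: RZ_double_class)

lemma connected_dyadic_solenoid: "connected_space dyadic_solenoid"
proof -
  have "continuous_map euclideanreal RZ (\<lambda>x. sol_line x n)" for n
    using continuous_map_compose[of euclideanreal euclideanreal "\<lambda>x. x / 2 ^ n" RZ RZ_class] continuous_map_RZ_class
    unfolding sol_line_def by (simp add: o_def continuous_intros)
  then have "continuous_map euclideanreal (product_topology (\<lambda>_. RZ) UNIV) sol_line"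
    unfolding continuous_map_componentwise_UNIV by blast
  moreover have "\<forall>n. sol_line x n = RZ_double (sol_line x (Suc n))" for x
    using sol_line_in[of x] unfolding solenoid_iff by blast
  then have "sol_line \<in> topspace euclideanreal \<rightarrow> {s. \<forall>n. s n = RZ_double (s (Suc n))}" by blast
  ultimately have "continuous_map euclideanreal dyadic_solenoid sol_line"
    unfolding dyadic_solenoid_def by (rule continuous_map_into_subtopology)
  then have "connectedin dyadic_solenoid (range sol_line)"
    by (rule connectedin_continuous_map_image) simp
  moreover have "dyadic_solenoid closure_of (range sol_line) = topspace dyadic_solenoid"
    unfolding dense_intersects_open
  proof (intro allI impI)
    fix U assume U: "openin dyadic_solenoid U \<and> U \<noteq> {}"
    then obtain s where "s \<in> U" by blast
    from solenoid_nbhd[OF conjunct1[OF U] this] obtain n z d where z: "d > 0"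
        "\<forall>t\<in>topspace dyadic_solenoid. (\<exists>w\<in>t n. \<bar>w - z\<bar> < d) \<longrightarrow> t \<in> U"
      by (elim exE bexE conjE)
    \<comment> \<open>The line attains every value of coordinate \<open>n\<close>, so it meets each
      such neighbourhood.\<close>
    have "z \<in> sol_line (2 ^ n * z) n" by (simp add: sol_line_def mem_RZ_class)
    then have "\<exists>w\<in>sol_line (2 ^ n * z) n. \<bar>w - z\<bar> < d" using z(1) by (intro bexI[of _ z]) auto
    then have "sol_line (2 ^ n * z) \<in> U" using z(2) sol_line_in by blast
    then show "range sol_line \<inter> U \<noteq> {}" by blast
  qed
  ultimately show ?thesis using connectedin_closure_of connectedin_topspace by metis
qed

subsection \<open>The homeomorphism\<close>

text \<open>Points that are close in coordinate \<open>Suc n\<close> have the same strip at level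
  \<open>n\<close> up to a small horizontal shift, and a high strip contains everything seen in the
  ball of radius \<open>1/e\<close>.\<close>

lemma continuous_sol_tiling: "continuous_map dyadic_solenoid chair_space sol_tiling"
  unfolding continuous_map_def topspace_chair_space
proof (intro conjI allI impI)
  show "sol_tiling \<in> topspace dyadic_solenoid \<rightarrow> chair_tilings"
    using sol_tiling_sym unfolding sym_tilings_def by blast
  fix U assume U: "openin chair_space U"
  let ?S = "{s \<in> topspace dyadic_solenoid. sol_tiling s \<in> U}"
  show "openin dyadic_solenoid ?S"
    unfolding openin_subopen[of _ ?S]
  proof
    fix s assume "s \<in> ?S"
    then have s: "s \<in> topspace dyadic_solenoid" "sol_tiling s \<in> U" by auto
    obtain e where e: "e > 0" "\<And>T. T \<in> chair_tilings \<Longrightarrow> tiling_close e (sol_tiling s) T \<Longrightarrow> T \<in> U"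
      using U s(2) unfolding openin_chair_space by blast
    \<comment> \<open>A tile meeting the ball has its centre at height at most
      \<open>1/e + 1/2\<close>, inside the strip of level \<open>n\<close>.\<close>
    obtain n where n: "1/e + 1 < 2 ^ n" using real_arch_pow[of 2 "1/e + 1"] by auto
    obtain z where z: "z \<in> s (Suc n)" using class_nonempty[OF solenoid_class[OF s(1)]] by blast
    \<comment> \<open>The strip shifts by \<open>2 ^ Suc n\<close> times the difference in
      coordinate \<open>Suc n\<close>.\<close>
    define d where "d = e / 2 ^ Suc n"
    have d: "d > 0" using e(1) unfolding d_def by simp
    let ?N = "{t \<in> topspace dyadic_solenoid. \<exists>w\<in>t (Suc n). w \<in> ball z d}"
    have "sol_tiling t \<in> U" if tN: "t \<in> ?N" for t
    proof -
      obtain w where t: "t \<in> topspace dyadic_solenoid" and w1: "w \<in> t (Suc n)" "w \<in> ball z d"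
        using tN by blast
      then have w: "w \<in> t (Suc n)" "\<bar>w - z\<bar> < d" unfolding mem_ball dist_real_def by linarith+
      define x :: "real^2" where "x = vector [2 ^ Suc n * (w - z), 0]"
      have lev: "level t n = translate x (level s n)"
        using level_translate[OF s(1) t z w(1)] unfolding x_def .
      have near: "\<bar>c$2\<bar> < 2 ^ n" if m: "tile_supp (c, a) \<inter> cball 0 (1/e) \<noteq> {}" for c and a :: arrow
      proof -
        obtain p where p: "p \<in> tile_supp (c, a)" "norm p \<le> 1/e" using m by auto
        have "\<bar>p$2\<bar> \<le> 1/e" using component_le_norm_cart[of p 2] p(2) by linarith
        then have "p$2 \<le> 1/e" "- (1/e) \<le> p$2" unfolding abs_le_iff by linarith+
        then show ?thesis using p(1) n unfolding mem_tile_supp abs_less_iff by simp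
      qed
      have "(c, a) \<in> translate x (sol_tiling s) \<longleftrightarrow> (c, a) \<in> translate 0 (sol_tiling t)"
        if m: "tile_supp (c, a) \<inter> cball 0 (1/e) \<noteq> {}" for c a
      proof -
        have "\<bar>(c - x)$2\<bar> < 2 ^ n" "\<bar>c$2\<bar> < 2 ^ n" using near[OF m] by (simp_all add: x_def)
        then have "(c - x, a) \<in> sol_tiling s \<longleftrightarrow> (c - x, a) \<in> level s n" "(c, a) \<in> sol_tiling t \<longleftrightarrow> (c, a) \<in> level t n"
          using sol_tiling_strip[OF s(1)] sol_tiling_strip[OF t] unfolding sol_tiling_def by blast+
        then show ?thesis unfolding lev mem_translate by simp
      qed
      then have "patch_at (1/e) (translate x (sol_tiling s)) = patch_at (1/e) (translate 0 (sol_tiling t))"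
        unfolding patch_at_eq_iff by blast
      moreover have "norm x \<le> e"
      proof -
        have "norm x = \<bar>2 ^ Suc n * (w - z)\<bar>"
          unfolding norm_eq_sqrt_inner x_def by (simp add: inner_vec_def sum_2 power2_eq_square[symmetric])
        also have "\<dots> = 2 ^ Suc n * \<bar>w - z\<bar>" by (simp add: abs_mult)
        also have "\<dots> \<le> 2 ^ Suc n * d" using w(2) by (intro mult_left_mono) auto
        finally show ?thesis by (simp add: d_def)
      qed
      ultimately have "tiling_close e (sol_tiling s) (sol_tiling t)"
        using e(1) unfolding tiling_close_def by (metis less_imp_le norm_zero)
      then show ?thesis using e(2) sol_tiling_sym[OF t] unfolding sym_tilings_def by blast
    qed
    then have "?N \<subseteq> ?S" by blast
    moreover have "z \<in> ball z d" using d by simp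
    then have "s \<in> ?N" using s(1) z by blast
    ultimately show "\<exists>T. openin dyadic_solenoid T \<and> s \<in> T \<and> T \<subseteq> ?S"
      using openin_solenoid_coordinate[of "ball z d" "Suc n"] by blast
  qed
qed

lemma act_tiling_one: "act_tiling (mat 1) T = T"
proof -
  have "act_tile (mat 1) t = t" for t
    unfolding act_tile_def by (simp add: act_arrow_eqI)
  then show ?thesis unfolding act_tiling_def by simp
qed

lemma fixed_space_H5: "fixed_space H5 = subtopology chair_space {T. act_tiling refl_x T = T}"
  unfolding fixed_space_def H5_eq by (simp add: act_tiling_one)

lemma fixed_space_H6: "fixed_space H6 = subtopology chair_space {T. act_tiling refl_y T = T}"
  unfolding fixed_space_def H6_eq by (simp add: act_tiling_one)

lemma topspace_H5: "topspace (fixed_space H5) = sym_tilings"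
  unfolding fixed_space_H5 sym_tilings_def by (auto simp: topspace_chair_space)

lemma homeomorphic_map_sol_tiling: "homeomorphic_map dyadic_solenoid (fixed_space H5) sol_tiling"
proof (rule continuous_imp_homeomorphic_map)
  show "continuous_map dyadic_solenoid (fixed_space H5) sol_tiling"
    unfolding fixed_space_H5 continuous_map_in_subtopology
    using continuous_sol_tiling sol_tiling_sym unfolding sym_tilings_def by auto
  show "Hausdorff_space (fixed_space H5)"
    unfolding fixed_space_H5 by (intro Hausdorff_space_subtopology Hausdorff_chair_space)
  show "sol_tiling ` topspace dyadic_solenoid = topspace (fixed_space H5)"
    unfolding topspace_H5 using sol_tiling_sym sol_tiling_surj by blast
  show "inj_on sol_tiling (topspace dyadic_solenoid)"
    using sol_tiling_inj by (auto intro: inj_onI)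
qed (rule compact_dyadic_solenoid)

subsection \<open>Rotation by a right angle\<close>

lemma norm_rot90 [simp]: "norm (rot90 *v v) = norm v"
  unfolding norm_eq_sqrt_inner rot90_mult by (simp add: inner_vec_def sum_2)

lemma act_rot90_close:
  assumes "tiling_close e S T"
  shows "tiling_close e (act_tiling rot90 S) (act_tiling rot90 T)"
proof -
  obtain x y where xy: "norm x \<le> e" "norm y \<le> e"
      "patch_at (1/e) (translate x S) = patch_at (1/e) (translate y T)"
    using assms unfolding tiling_close_def by blast
  have "tile_supp (act_tile rot90 t) \<inter> cball 0 r \<noteq> {} \<longleftrightarrow> tile_supp t \<inter> cball 0 r \<noteq> {}" for t r
  proof -
    have m: "rot90 *v p \<in> tile_supp (act_tile rot90 t) \<longleftrightarrow> p \<in> tile_supp t" for p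
      unfolding mem_tile_supp act_tile_def by (auto simp: rot90_mult)
    have surj: "\<exists>q. p = rot90 *v q" for p
      using chair_sym_rot90 unfolding chair_sym_def by (metis bij_pointE)
    show ?thesis
    proof
      assume "tile_supp (act_tile rot90 t) \<inter> cball 0 r \<noteq> {}"
      then obtain p where "p \<in> tile_supp (act_tile rot90 t)" "norm p \<le> r" by auto
      then obtain q where "q \<in> tile_supp t" "norm q \<le> r" using surj[of p] m by auto
      then show "tile_supp t \<inter> cball 0 r \<noteq> {}" by auto
    next
      assume "tile_supp t \<inter> cball 0 r \<noteq> {}"
      then obtain q where "q \<in> tile_supp t" "norm q \<le> r" by auto
      then have "rot90 *v q \<in> tile_supp (act_tile rot90 t)" "norm (rot90 *v q) \<le> r" using m by auto
      then show "tile_supp (act_tile rot90 t) \<inter> cball 0 r \<noteq> {}" by (auto simp: disjoint_iff)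
    qed
  qed
  moreover have "{t \<in> f ` P. Q t} = f ` {t \<in> P. Q (f t)}" for f :: "tile \<Rightarrow> tile" and P Q
    by blast
  ultimately have pa: "patch_at r (act_tiling rot90 P) = act_tiling rot90 (patch_at r P)" for r P
    unfolding patch_at_def act_tiling_def by simp
  have "patch_at (1/e) (translate (rot90 *v x) (act_tiling rot90 S))
      = patch_at (1/e) (translate (rot90 *v y) (act_tiling rot90 T))"
    using xy(3) by (simp add: pa flip: act_translate)
  then show ?thesis using xy(1,2) unfolding tiling_close_def by (metis norm_rot90)
qed

lemma act_rot90_four: "act_tiling rot90 (act_tiling rot90 (act_tiling rot90 (act_tiling rot90 T))) = T"
proof -
  have "act_tile rot90 (act_tile rot90 (act_tile rot90 (act_tile rot90 t))) = t" for t
    by (cases t; cases "snd t") (auto simp: act_tile_def rot90_mult vec2_eq_iff act_arrow_rot90)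
  then show ?thesis unfolding act_tiling_def by (simp add: image_image)
qed

lemma homeomorphic_map_rot90: "homeomorphic_map chair_space chair_space (act_tiling rot90)"
proof -
  let ?r = "act_tiling rot90"
  have c: "continuous_map chair_space chair_space ?r"
    unfolding continuous_map_def topspace_chair_space
  proof (intro conjI allI impI)
    show "?r \<in> chair_tilings \<rightarrow> chair_tilings" using act_chair_tilings[OF chair_sym_rot90] by blast
    fix U assume U: "openin chair_space U"
    show "openin chair_space {T \<in> chair_tilings. ?r T \<in> U}"
      unfolding openin_chair_space
    proof (intro conjI ballI)
      fix S assume "S \<in> {T \<in> chair_tilings. ?r T \<in> U}"
      then obtain e where "e > 0" "\<And>T. T \<in> chair_tilings \<Longrightarrow> tiling_close e (?r S) T \<Longrightarrow> T \<in> U"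
        using U unfolding openin_chair_space by blast
      then show "\<exists>e>0. \<forall>T\<in>chair_tilings. tiling_close e S T \<longrightarrow> T \<in> {T \<in> chair_tilings. ?r T \<in> U}"
        using act_rot90_close act_chair_tilings[OF chair_sym_rot90] by blast
    qed blast
  qed
  \<comment> \<open>Four quarter turns give the identity, so three of them give the inverse.\<close>
  have "continuous_map chair_space chair_space (?r \<circ> (?r \<circ> ?r))"
    using c by (intro continuous_map_compose)
  then have "homeomorphic_maps chair_space chair_space ?r (?r \<circ> (?r \<circ> ?r))"
    unfolding homeomorphic_maps_def using c by (simp add: act_rot90_four)
  then show ?thesis using homeomorphic_map_maps by blast
qed

text \<open>Conjugation by the quarter turn exchanges the two reflections, so the rotation carries
  each fixed space onto the other.\<close>

lemma act_rot90_refl: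
  "act_tiling rot90 (act_tiling refl_x T) = act_tiling refl_y (act_tiling rot90 T)"
  "act_tiling rot90 (act_tiling refl_y T) = act_tiling refl_x (act_tiling rot90 T)"
proof -
  have y: "refl_y *v v = vector [- v$1, v$2]" for v
    by (simp add: refl_y_def vec2_eq_iff matrix_vector_mult_def sum_2)
  have "act_tile rot90 (act_tile refl_x t) = act_tile refl_y (act_tile rot90 t)"
    "act_tile rot90 (act_tile refl_y t) = act_tile refl_x (act_tile rot90 t)" for t
    by (cases t; cases "snd t"; simp add: act_tile_def rot90_mult refl_x_mult y
        act_arrow_rot90 act_arrow_refl_x act_arrow_refl_y)+
  then show "act_tiling rot90 (act_tiling refl_x T) = act_tiling refl_y (act_tiling rot90 T)"
    "act_tiling rot90 (act_tiling refl_y T) = act_tiling refl_x (act_tiling rot90 T)"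
    unfolding act_tiling_def by (simp_all add: image_image)
qed

lemma act_rot90_eq_iff: "act_tiling rot90 S = act_tiling rot90 T \<longleftrightarrow> S = T"
  by (metis act_rot90_four)

lemma homeomorphic_map_H5_H6: "homeomorphic_map (fixed_space H5) (fixed_space H6) (act_tiling rot90)"
  unfolding fixed_space_H5 fixed_space_H6
  by (rule homeomorphic_map_subtopologies_alt[OF homeomorphic_map_rot90])
    (simp add: act_rot90_eq_iff flip: act_rot90_refl)

lemma homeomorphic_map_H6_H5: "homeomorphic_map (fixed_space H6) (fixed_space H5) (act_tiling rot90)"
  unfolding fixed_space_H5 fixed_space_H6
  by (rule homeomorphic_map_subtopologies_alt[OF homeomorphic_map_rot90])
    (simp add: act_rot90_eq_iff flip: act_rot90_refl)

subsection \<open>Direct limits detected by an invariant\<close>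

text \<open>An invariant that is constant along transition maps and separates elements up to a
  common later index has the classes of the limit as its fibres; addition of values then gives the
  group law.\<close>

lemma direct_limit_iso:
  fixes f :: "'i \<Rightarrow> 'g \<Rightarrow> rat"
  assumes directed: "\<And>i j. i \<in> I \<Longrightarrow> j \<in> I \<Longrightarrow> \<exists>k\<in>I. R i k \<and> R j k"
    and \<phi>: "\<And>i k x. i \<in> I \<Longrightarrow> k \<in> I \<Longrightarrow> R i k \<Longrightarrow> x \<in> carrier (G i) \<Longrightarrow>
            \<phi> i k x \<in> carrier (G k) \<and> f k (\<phi> i k x) = f i x"
    and mult: "\<And>k x y. k \<in> I \<Longrightarrow> x \<in> carrier (G k) \<Longrightarrow> y \<in> carrier (G k) \<Longrightarrow>
            x \<otimes>\<^bsub>G k\<^esub> y \<in> carrier (G k) \<and> f k (x \<otimes>\<^bsub>G k\<^esub> y) = f k x + f k y"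
    and inj: "\<And>i j x y. i \<in> I \<Longrightarrow> j \<in> I \<Longrightarrow> x \<in> carrier (G i) \<Longrightarrow> y \<in> carrier (G j) \<Longrightarrow>
            f i x = f j y \<Longrightarrow> \<exists>k\<in>I. R i k \<and> R j k \<and> \<phi> i k x = \<phi> j k y"
    and surj: "(\<lambda>(i, x). f i x) ` (SIGMA i:I. carrier (G i)) = D"
  shows "direct_limit I R G \<phi> \<cong> \<lparr>carrier = D, monoid.mult = (+), one = 0\<rparr>"
proof -
  let ?S = "SIGMA i:I. carrier (G i)" and ?L = "direct_limit I R G \<phi>"
  let ?D = "\<lparr>carrier = D, monoid.mult = (+), one = 0\<rparr> :: rat monoid"
  define F where "F = (\<lambda>(i, x). f i x)"
  define Fib where "Fib v = {p \<in> ?S. F p = v}" for v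
  have rel: "dirlim_rel I R G \<phi> = {(p, q). p \<in> ?S \<and> q \<in> ?S \<and> F p = F q}"
  proof -
    have eq: "(\<exists>k\<in>I. R i k \<and> R j k \<and> \<phi> i k x = \<phi> j k y) \<longleftrightarrow> f i x = f j y"
      if "i \<in> I" "j \<in> I" "x \<in> carrier (G i)" "y \<in> carrier (G j)" for i j x y
    proof
      assume "\<exists>k\<in>I. R i k \<and> R j k \<and> \<phi> i k x = \<phi> j k y"
      then obtain k where k: "k \<in> I" "R i k" "R j k" "\<phi> i k x = \<phi> j k y" by blast
      show "f i x = f j y"
        using \<phi>[OF that(1) k(1,2) that(3)] \<phi>[OF that(2) k(1,3) that(4)] k(4) by simp
    qed (rule inj[OF that])
    have "((i, x), (j, y)) \<in> dirlim_rel I R G \<phi> \<longleftrightarrow> i \<in> I \<and> x \<in> carrier (G i) \<and> j \<in> I \<and>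
        y \<in> carrier (G j) \<and> (\<exists>k\<in>I. R i k \<and> R j k \<and> \<phi> i k x = \<phi> j k y)" for i x j y
      unfolding dirlim_rel_def by blast
    then have "((i, x), (j, y)) \<in> dirlim_rel I R G \<phi> \<longleftrightarrow> i \<in> I \<and> x \<in> carrier (G i) \<and> j \<in> I \<and>
        y \<in> carrier (G j) \<and> f i x = f j y" for i x j y
      using eq by meson
    then show ?thesis unfolding F_def by auto
  qed
  have img: "dirlim_rel I R G \<phi> `` {p} = Fib (F p)" if "p \<in> ?S" for p
    using that unfolding rel Fib_def by auto
  have D: "D = F ` ?S" using surj unfolding F_def by simp
  have carr: "carrier ?L = Fib ` D"
    unfolding direct_limit_def D by (auto simp: quotient_def img)
  have ne: "Fib v \<noteq> {}" if "v \<in> D" for v using that unfolding D Fib_def by auto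
  define h where "h A = F (SOME p. p \<in> A)" for A
  have h: "h (Fib v) = v" if "v \<in> D" for v
  proof -
    have "(SOME p. p \<in> Fib v) \<in> Fib v" using ne[OF that] by (simp add: some_in_eq)
    then show ?thesis unfolding h_def Fib_def by simp
  qed
  \<comment> \<open>The product is a union over all representatives and upper bounds; each choice
    contributes the same fibre.\<close>
  have m: "Fib u \<otimes>\<^bsub>?L\<^esub> Fib v = Fib (u + v) \<and> u + v \<in> D" if uv: "u \<in> D" "v \<in> D" for u v
  proof -
    have e: "dirlim_rel I R G \<phi> `` {(k, \<phi> i k x \<otimes>\<^bsub>G k\<^esub> \<phi> j k y)} = Fib (u + v) \<and> u + v \<in> D"
      if "(i, x) \<in> Fib u" "(j, y) \<in> Fib v" "k \<in> I" "R i k" "R j k" for i x j y k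
    proof -
      have a: "i \<in> I" "x \<in> carrier (G i)" "f i x = u" "j \<in> I" "y \<in> carrier (G j)" "f j y = v"
        using that(1,2) unfolding Fib_def F_def by auto
      note b = \<phi>[OF a(1) that(3,4) a(2)] \<phi>[OF a(4) that(3,5) a(5)]
      note c = mult[OF that(3) conjunct1[OF b(1)] conjunct1[OF b(2)]]
      have "(k, \<phi> i k x \<otimes>\<^bsub>G k\<^esub> \<phi> j k y) \<in> ?S" using c that(3) by blast
      moreover have "F (k, \<phi> i k x \<otimes>\<^bsub>G k\<^esub> \<phi> j k y) = u + v" using b c a(3,6) unfolding F_def by simp
      ultimately show ?thesis using img unfolding D by (metis image_eqI)
    qed
    obtain i x j y where p: "(i, x) \<in> Fib u" "(j, y) \<in> Fib v" using ne uv by (metis ex_in_conv surj_pair)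
    then have "i \<in> I" "j \<in> I" unfolding Fib_def by auto
    then obtain k where k: "k \<in> I" "R i k" "R j k" using directed by blast
    have "Fib u \<otimes>\<^bsub>?L\<^esub> Fib v = \<Union>{dirlim_rel I R G \<phi> `` {(k, \<phi> i k x \<otimes>\<^bsub>G k\<^esub> \<phi> j k y)} | i x j y k.
          (i, x) \<in> Fib u \<and> (j, y) \<in> Fib v \<and> k \<in> I \<and> R i k \<and> R j k}"
      unfolding direct_limit_def by simp
    also have "{dirlim_rel I R G \<phi> `` {(k, \<phi> i k x \<otimes>\<^bsub>G k\<^esub> \<phi> j k y)} | i x j y k.
          (i, x) \<in> Fib u \<and> (j, y) \<in> Fib v \<and> k \<in> I \<and> R i k \<and> R j k} = {Fib (u + v)}"
    proof (intro equalityI subsetI)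
      fix A assume "A \<in> {dirlim_rel I R G \<phi> `` {(k, \<phi> i k x \<otimes>\<^bsub>G k\<^esub> \<phi> j k y)} | i x j y k.
          (i, x) \<in> Fib u \<and> (j, y) \<in> Fib v \<and> k \<in> I \<and> R i k \<and> R j k}"
      then obtain i x j y k where "A = dirlim_rel I R G \<phi> `` {(k, \<phi> i k x \<otimes>\<^bsub>G k\<^esub> \<phi> j k y)}"
        "(i, x) \<in> Fib u" "(j, y) \<in> Fib v" "k \<in> I" "R i k" "R j k" by blast
      then show "A \<in> {Fib (u + v)}" using e[of i x j y k] by simp
    next
      fix A assume "A \<in> {Fib (u + v)}"
      then have "A = dirlim_rel I R G \<phi> `` {(k, \<phi> i k x \<otimes>\<^bsub>G k\<^esub> \<phi> j k y)}" using e[OF p k] by simp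
      then show "A \<in> {dirlim_rel I R G \<phi> `` {(k, \<phi> i k x \<otimes>\<^bsub>G k\<^esub> \<phi> j k y)} | i x j y k.
          (i, x) \<in> Fib u \<and> (j, y) \<in> Fib v \<and> k \<in> I \<and> R i k \<and> R j k}" using p k by blast
    qed
    finally show ?thesis using e[OF p k] by simp
  qed
  have "h \<in> iso ?L ?D"
    unfolding iso_def
  proof (intro CollectI conjI)
    show "h \<in> hom ?L ?D"
      by (rule homI) (auto simp: carr h m)
    show "bij_betw h (carrier ?L) (carrier ?D)"
      unfolding carr bij_betw_def by (auto simp: inj_on_def h image_image)
  qed
  then show ?thesis by (rule is_isoI)
qed

subsection \<open>One-dimensional cocycles\<close>

abbreviation cocycles1 :: "'a set set \<Rightarrow> ('a set list \<Rightarrow> int) set" where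
  "cocycles1 \<U> \<equiv> carrier (cech_cocycles \<U> 1)"

lemma nerve1: "[U, V] \<in> nerve_simplices \<U> 1 \<longleftrightarrow> U \<in> \<U> \<and> V \<in> \<U> \<and> U \<inter> V \<noteq> {}"
  unfolding nerve_simplices_def by auto

lemma nerve1E:
  assumes "s \<in> nerve_simplices \<U> 1"
  obtains U V where "s = [U, V]" "U \<in> \<U>" "V \<in> \<U>" "U \<inter> V \<noteq> {}"
proof -
  have "length s = 2" using assms unfolding nerve_simplices_def by simp
  then obtain U V where s: "s = [U, V]" by (auto simp: length_Suc_conv numeral_2_eq_2)
  show ?thesis using that[OF s] assms[unfolded s nerve1] by blast
qed

lemma nerve2: "[U, V, W] \<in> nerve_simplices \<U> (Suc 1) \<longleftrightarrow>
    U \<in> \<U> \<and> V \<in> \<U> \<and> W \<in> \<U> \<and> U \<inter> V \<inter> W \<noteq> {}"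
  unfolding nerve_simplices_def by (auto simp: Int_assoc)

lemma nerve2E:
  assumes "s \<in> nerve_simplices \<U> (Suc 1)"
  obtains U V W where "s = [U, V, W]"
proof -
  have "length s = 3" using assms unfolding nerve_simplices_def by simp
  then show ?thesis using that by (auto simp: length_Suc_conv numeral_3_eq_3)
qed

lemma cech_delta_1: "[U, V, W] \<in> nerve_simplices \<U> (Suc 1) \<Longrightarrow>
    cech_delta \<U> 1 c [U, V, W] = c [V, W] - c [U, W] + c [U, V]"
  unfolding cech_delta_def by (simp add: numeral_2_eq_2)

lemma cech_delta_0: "[U, V] \<in> nerve_simplices \<U> 1 \<Longrightarrow>
    cech_delta \<U> 0 b [U, V] = b [V] - b [U]"
  unfolding cech_delta_def by simp

lemma cocycles1_iff:
  "c \<in> cocycles1 \<U> \<longleftrightarrow> (\<forall>s. s \<notin> nerve_simplices \<U> 1 \<longrightarrow> c s = 0) \<and>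
     (\<forall>U\<in>\<U>. \<forall>V\<in>\<U>. \<forall>W\<in>\<U>. U \<inter> V \<inter> W \<noteq> {} \<longrightarrow> c [U, W] = c [U, V] + c [V, W])"
proof -
  have "cech_delta \<U> 1 c = (\<lambda>_. 0) \<longleftrightarrow>
     (\<forall>U\<in>\<U>. \<forall>V\<in>\<U>. \<forall>W\<in>\<U>. U \<inter> V \<inter> W \<noteq> {} \<longrightarrow> c [U, W] = c [U, V] + c [V, W])" (is "?L \<longleftrightarrow> ?R")
  proof
    assume L: ?L
    show ?R
    proof (intro ballI impI)
      fix U V W assume "U \<in> \<U>" "V \<in> \<U>" "W \<in> \<U>" "U \<inter> V \<inter> W \<noteq> {}"
      then have "cech_delta \<U> 1 c [U, V, W] = c [V, W] - c [U, W] + c [U, V]"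
        by (intro cech_delta_1) (simp only: nerve2, blast)
      then show "c [U, W] = c [U, V] + c [V, W]" unfolding L by simp
    qed
  next
    assume R: ?R
    have "cech_delta \<U> 1 c s = 0" for s
    proof (cases "s \<in> nerve_simplices \<U> (Suc 1)")
      case True
      then obtain U V W where s: "s = [U, V, W]" by (rule nerve2E)
      have "c [U, W] = c [U, V] + c [V, W]" using R True unfolding s nerve2 by blast
      then show ?thesis using cech_delta_1[OF True[unfolded s], of c] s by simp
    qed (simp add: cech_delta_def)
    then show ?L by blast
  qed
  then show ?thesis unfolding cech_cocycles_def cech_cochains_def by simp
qed

lemma cocycle_add: "c \<in> cocycles1 \<U> \<Longrightarrow> U \<in> \<U> \<Longrightarrow> V \<in> \<U> \<Longrightarrow> W \<in> \<U> \<Longrightarrow> U \<inter> V \<inter> W \<noteq> {} \<Longrightarrow>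
    c [U, W] = c [U, V] + c [V, W]"
  unfolding cocycles1_iff by blast

lemma cocycle_refl: "c \<in> cocycles1 \<U> \<Longrightarrow> U \<in> \<U> \<Longrightarrow> U \<noteq> {} \<Longrightarrow> c [U, U] = 0"
  using cocycle_add[of c \<U> U U U] by simp

lemma cocycle_sym:
  assumes "c \<in> cocycles1 \<U>" "U \<in> \<U>" "V \<in> \<U>" "U \<inter> V \<noteq> {}"
  shows "c [V, U] = - c [U, V]"
proof -
  have "U \<inter> V \<inter> U \<noteq> {}" "U \<noteq> {}" using assms(4) by blast+
  then show ?thesis
    using cocycle_add[OF assms(1,2,3,2)] cocycle_refl[OF assms(1,2)] by linarith
qed

lemma cocycles1_add: "c \<in> cocycles1 \<U> \<Longrightarrow> d \<in> cocycles1 \<U> \<Longrightarrow> (\<lambda>s. c s + d s) \<in> cocycles1 \<U>"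
  unfolding cocycles1_iff by (simp add: algebra_simps)

lemma cocycles1_diff: "c \<in> cocycles1 \<U> \<Longrightarrow> d \<in> cocycles1 \<U> \<Longrightarrow> (\<lambda>s. c s - d s) \<in> cocycles1 \<U>"
  unfolding cocycles1_iff by (simp add: algebra_simps)

text \<open>A 0-cochain lives on one-element lists; here it becomes a function \<open>b\<close> on
  sets, and \<open>b'\<close> restores the vanishing off the nerve.\<close>

lemma coboundaries1_iff:
  "h \<in> cech_coboundaries \<U> 1 \<longleftrightarrow>
     (\<exists>b. h = (\<lambda>s. if s \<in> nerve_simplices \<U> 1 then b (s ! 1) - b (s ! 0) else 0))"
    (is "?L \<longleftrightarrow> ?R")
proof
  assume ?L
  then obtain b where b: "h = cech_delta \<U> 0 b" by auto
  have "h s = (if s \<in> nerve_simplices \<U> 1 then b [s ! 1] - b [s ! 0] else 0)" for s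
  proof (cases "s \<in> nerve_simplices \<U> 1")
    case True
    then obtain U V where "s = [U, V]" by (rule nerve1E)
    then show ?thesis using cech_delta_0[of U V \<U> b] True b by simp
  qed (simp add: b cech_delta_def)
  then show ?R by (intro exI[of _ "\<lambda>U. b [U]"]) blast
next
  assume ?R
  then obtain b where b: "h = (\<lambda>s. if s \<in> nerve_simplices \<U> 1 then b (s ! 1) - b (s ! 0) else 0)" by blast
  define b' where "b' s = (if s \<in> nerve_simplices \<U> 0 then b (s ! 0) else 0)" for s :: "'a set list"
  have "h s = cech_delta \<U> 0 b' s" for s
  proof (cases "s \<in> nerve_simplices \<U> 1")
    case True
    then obtain U V where s: "s = [U, V]" "U \<in> \<U>" "V \<in> \<U>" "U \<inter> V \<noteq> {}" by (rule nerve1E)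
    then have "[U] \<in> nerve_simplices \<U> 0" "[V] \<in> nerve_simplices \<U> 0"
      unfolding nerve_simplices_def by auto
    then show ?thesis using cech_delta_0[of U V \<U> b'] True b s by (simp add: b'_def)
  qed (simp add: b cech_delta_def)
  moreover have "b' \<in> cech_cochains \<U> 0" unfolding cech_cochains_def b'_def by simp
  ultimately show ?L by auto
qed

lemma coboundaries1_add:
  assumes "h \<in> cech_coboundaries \<U> 1" "k \<in> cech_coboundaries \<U> 1"
  shows "(\<lambda>s. h s + k s) \<in> cech_coboundaries \<U> 1"
proof -
  obtain b b' where "h = (\<lambda>s. if s \<in> nerve_simplices \<U> 1 then b (s ! 1) - b (s ! 0) else 0)"
    "k = (\<lambda>s. if s \<in> nerve_simplices \<U> 1 then b' (s ! 1) - b' (s ! 0) else 0)"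
    using assms unfolding coboundaries1_iff by blast
  then show ?thesis unfolding coboundaries1_iff by (intro exI[of _ "\<lambda>U. b U + b' U"]) auto
qed

lemma coboundaries1_minus:
  assumes "h \<in> cech_coboundaries \<U> 1"
  shows "(\<lambda>s. - h s) \<in> cech_coboundaries \<U> 1"
proof -
  obtain b where "h = (\<lambda>s. if s \<in> nerve_simplices \<U> 1 then b (s ! 1) - b (s ! 0) else 0)"
    using assms unfolding coboundaries1_iff by blast
  then show ?thesis unfolding coboundaries1_iff by (intro exI[of _ "\<lambda>U. - b U"]) auto
qed

lemma coboundaries1_zero: "(\<lambda>_. 0) \<in> cech_coboundaries \<U> 1"
  unfolding coboundaries1_iff by (intro exI[of _ "\<lambda>_. 0"]) auto

lemma coboundaries1_cocycles: "cech_coboundaries \<U> 1 \<subseteq> cocycles1 \<U>"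
proof
  fix h assume "h \<in> cech_coboundaries \<U> 1"
  then obtain b where b: "h = (\<lambda>s. if s \<in> nerve_simplices \<U> 1 then b (s ! 1) - b (s ! 0) else 0)"
    unfolding coboundaries1_iff by blast
  show "h \<in> cocycles1 \<U>"
    unfolding cocycles1_iff
  proof (intro conjI ballI impI)
    fix U V W assume "U \<in> \<U>" "V \<in> \<U>" "W \<in> \<U>" "U \<inter> V \<inter> W \<noteq> {}"
    then have "[U, V] \<in> nerve_simplices \<U> 1" "[V, W] \<in> nerve_simplices \<U> 1" "[U, W] \<in> nerve_simplices \<U> 1"
      unfolding nerve1 by blast+
    then show "h [U, W] = h [U, V] + h [V, W]" unfolding b by simp
  qed (simp add: b)
qed

section \<open>Cohomology classes in degree one and their behaviour under refinement\<close>

definition cob_class :: "'a set set \<Rightarrow> ('a set list \<Rightarrow> int) \<Rightarrow> ('a set list \<Rightarrow> int) set" where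
  "cob_class \<U> c = {\<lambda>s. h s + c s | h. h \<in> cech_coboundaries \<U> 1}"

lemma mult_cocycles: "x \<otimes>\<^bsub>cech_cocycles \<U> 1\<^esub> y = (\<lambda>s. x s + y s)"
  unfolding cech_cocycles_def by simp

lemma r_coset_eq_cob_class: "cech_coboundaries \<U> 1 #>\<^bsub>cech_cocycles \<U> 1\<^esub> c = cob_class \<U> c"
  unfolding r_coset_def cob_class_def mult_cocycles by blast

lemma carrier_nerve_cohomology: "carrier (nerve_cohomology 1 \<U>) = cob_class \<U> ` cocycles1 \<U>"
  unfolding nerve_cohomology_def FactGroup_def RCOSETS_def r_coset_eq_cob_class by auto

lemma cob_classI: "h \<in> cech_coboundaries \<U> 1 \<Longrightarrow> x = (\<lambda>s. h s + c s) \<Longrightarrow> x \<in> cob_class \<U> c"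
  unfolding cob_class_def by blast

lemma cob_class_self: "c \<in> cob_class \<U> c"
  by (rule cob_classI[OF coboundaries1_zero]) simp

lemma cob_class_eqI:
  assumes "(\<lambda>s. c s - d s) \<in> cech_coboundaries \<U> 1" shows "cob_class \<U> c = cob_class \<U> d"
proof -
  have sub: "cob_class \<U> c \<subseteq> cob_class \<U> d" if "(\<lambda>s. c s - d s) \<in> cech_coboundaries \<U> 1" for c d
  proof
    fix x assume "x \<in> cob_class \<U> c"
    then obtain h where h: "h \<in> cech_coboundaries \<U> 1" "x = (\<lambda>s. h s + c s)" unfolding cob_class_def by blast
    have "(\<lambda>s. h s + (c s - d s)) \<in> cech_coboundaries \<U> 1" by (rule coboundaries1_add[OF h(1) that])
    moreover have "x = (\<lambda>s. (h s + (c s - d s)) + d s)" using h(2) by auto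
    ultimately show "x \<in> cob_class \<U> d" by (rule cob_classI)
  qed
  have "(\<lambda>s. d s - c s) \<in> cech_coboundaries \<U> 1" using coboundaries1_minus[OF assms] by simp
  then show ?thesis using sub assms by blast
qed

lemma mult_nerve_cohomology:
  "cob_class \<U> c \<otimes>\<^bsub>nerve_cohomology 1 \<U>\<^esub> cob_class \<U> d = cob_class \<U> (\<lambda>s. c s + d s)"
proof -
  have "cob_class \<U> c \<otimes>\<^bsub>nerve_cohomology 1 \<U>\<^esub> cob_class \<U> d
      = {\<lambda>s. x s + y s | x y. x \<in> cob_class \<U> c \<and> y \<in> cob_class \<U> d}"
    unfolding nerve_cohomology_def FactGroup_def set_mult_def mult_cocycles by auto
  also have "\<dots> = cob_class \<U> (\<lambda>s. c s + d s)"
  proof (intro equalityI subsetI)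
    fix z assume "z \<in> {\<lambda>s. x s + y s | x y. x \<in> cob_class \<U> c \<and> y \<in> cob_class \<U> d}"
    then obtain h k where hk: "h \<in> cech_coboundaries \<U> 1" "k \<in> cech_coboundaries \<U> 1"
        "z = (\<lambda>s. (h s + c s) + (k s + d s))" unfolding cob_class_def by blast
    have "z = (\<lambda>s. (h s + k s) + (c s + d s))" using hk(3) by auto
    then show "z \<in> cob_class \<U> (\<lambda>s. c s + d s)"
      by (rule cob_classI[OF coboundaries1_add[OF hk(1,2)]])
  next
    fix z assume "z \<in> cob_class \<U> (\<lambda>s. c s + d s)"
    then obtain h where h: "h \<in> cech_coboundaries \<U> 1" "z = (\<lambda>s. h s + (c s + d s))"
      unfolding cob_class_def by blast
    then have "z = (\<lambda>s. (h s + c s) + d s)" by auto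
    moreover have "(\<lambda>s. h s + c s) \<in> cob_class \<U> c" using cob_classI[OF h(1) refl] .
    ultimately show "z \<in> {\<lambda>s. x s + y s | x y. x \<in> cob_class \<U> c \<and> y \<in> cob_class \<U> d}"
      using cob_class_self[of d \<U>] by (intro CollectI exI conjI)
  qed
  finally show ?thesis .
qed

lemma refinement_map:
  assumes "refined_by \<U> \<V>" "V \<in> \<V>"
  shows "refinement_map \<U> V \<in> \<U>" "V \<subseteq> refinement_map \<U> V"
proof -
  have "\<exists>U. U \<in> \<U> \<and> V \<subseteq> U" using assms unfolding refined_by_def by blast
  from someI_ex[OF this] show "refinement_map \<U> V \<in> \<U>" "V \<subseteq> refinement_map \<U> V"
    unfolding refinement_map_def by blast+
qed

lemma pullback_apply:
  "U \<in> \<V> \<Longrightarrow> V \<in> \<V> \<Longrightarrow> U \<inter> V \<noteq> {} \<Longrightarrow>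
     cech_pullback 1 \<U> \<V> c [U, V] = c [refinement_map \<U> U, refinement_map \<U> V]"
  using nerve1[of U V \<V>] unfolding cech_pullback_def by simp

lemma pullback_cocycle:
  assumes r: "refined_by \<U> \<V>" and c: "c \<in> cocycles1 \<U>"
  shows "cech_pullback 1 \<U> \<V> c \<in> cocycles1 \<V>"
  unfolding cocycles1_iff
proof (intro conjI ballI impI)
  fix U V W assume m: "U \<in> \<V>" "V \<in> \<V>" "W \<in> \<V>" "U \<inter> V \<inter> W \<noteq> {}"
  have ne: "U \<inter> W \<noteq> {}" "U \<inter> V \<noteq> {}" "V \<inter> W \<noteq> {}" using m(4) by blast+
  note p = pullback_apply[OF m(1,3) ne(1), where c = c] pullback_apply[OF m(1,2) ne(2), where c = c]
    pullback_apply[OF m(2,3) ne(3), where c = c]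
  show "cech_pullback 1 \<U> \<V> c [U, W] = cech_pullback 1 \<U> \<V> c [U, V] + cech_pullback 1 \<U> \<V> c [V, W]"
    unfolding p using m refinement_map[OF r] by (intro cocycle_add[OF c]) blast+
qed (simp add: cech_pullback_def)

lemma pullback_coboundary:
  assumes r: "refined_by \<U> \<V>" and h: "h \<in> cech_coboundaries \<U> 1"
  shows "cech_pullback 1 \<U> \<V> h \<in> cech_coboundaries \<V> 1"
proof -
  obtain b where b: "h = (\<lambda>s. if s \<in> nerve_simplices \<U> 1 then b (s ! 1) - b (s ! 0) else 0)"
    using h unfolding coboundaries1_iff by blast
  have "cech_pullback 1 \<U> \<V> h s = (if s \<in> nerve_simplices \<V> 1
      then b (refinement_map \<U> (s ! 1)) - b (refinement_map \<U> (s ! 0)) else 0)" for s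
  proof (cases "s \<in> nerve_simplices \<V> 1")
    case True
    then obtain U V where s: "s = [U, V]" "U \<in> \<V>" "V \<in> \<V>" "U \<inter> V \<noteq> {}" by (rule nerve1E)
    have "[refinement_map \<U> U, refinement_map \<U> V] \<in> nerve_simplices \<U> 1"
      unfolding nerve1 using refinement_map[OF r] s by blast
    then show ?thesis using True s by (simp add: cech_pullback_def b)
  qed (simp add: cech_pullback_def)
  then show ?thesis unfolding coboundaries1_iff by (intro exI[of _ "\<lambda>U. b (refinement_map \<U> U)"]) blast
qed

text \<open>The union over representatives collapses to one coset because pullback preserves
  coboundaries.\<close>

lemma transition_cob_class:
  assumes r: "refined_by \<U> \<V>" and c: "c \<in> cocycles1 \<U>"
  shows "cech_transition 1 \<U> \<V> (cob_class \<U> c) = cob_class \<V> (cech_pullback 1 \<U> \<V> c)"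
proof -
  have "cob_class \<V> (cech_pullback 1 \<U> \<V> x) = cob_class \<V> (cech_pullback 1 \<U> \<V> c)"
    if x: "x \<in> cob_class \<U> c" for x
  proof (rule cob_class_eqI)
    obtain h where h: "h \<in> cech_coboundaries \<U> 1" "x = (\<lambda>s. h s + c s)" using x unfolding cob_class_def by blast
    have "(\<lambda>s. cech_pullback 1 \<U> \<V> x s - cech_pullback 1 \<U> \<V> c s) = cech_pullback 1 \<U> \<V> h"
      unfolding cech_pullback_def h(2) by auto
    then show "(\<lambda>s. cech_pullback 1 \<U> \<V> x s - cech_pullback 1 \<U> \<V> c s) \<in> cech_coboundaries \<V> 1"
      using pullback_coboundary[OF r h(1)] by simp
  qed
  then show ?thesis
    unfolding cech_transition_def r_coset_eq_cob_class using cob_class_self by blast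
qed

subsection \<open>Arc covers of a solenoid\<close>

text \<open>Projection to a fixed coordinate doubles lengths with each further level, so the number
  of arcs has to grow faster than \<open>2 ^ n\<close> for the arcs to shrink there. Having at least
  four arcs keeps non-neighbouring arcs disjoint.\<close>

definition arcs :: "nat \<Rightarrow> nat" where
  "arcs n = 4 ^ Suc n"

lemma arcs_pos: "0 < real (arcs n)"
  unfolding arcs_def by simp

lemma arcs_Suc: "arcs (Suc n) = 4 * arcs n"
  unfolding arcs_def by simp

lemma int_near_floor:
  fixes x :: real
  assumes "\<bar>x - of_int i\<bar> < 1" shows "i = \<lfloor>x\<rfloor> \<or> i = \<lfloor>x\<rfloor> + 1"
  using assms unfolding abs_less_iff by linarith

lemma sum_lessThan_double: "(\<Sum>i<2 * k. f i) = (\<Sum>j<k. f (2 * j) + f (2 * j + 1))" for f :: "nat \<Rightarrow> int"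
  by (induction k) (simp_all add: algebra_simps)

text \<open>The computation uses only coordinate functions with values in the circle, so it runs
  directly on any space homeomorphic to the solenoid. \<open>p_open\<close> and
  \<open>p_nbhd\<close> say that conditions on single coordinates form a base of the
  topology.\<close>

locale solenoid_coordinates =
  fixes X :: "'a topology" and p :: "nat \<Rightarrow> 'a \<Rightarrow> real set"
  assumes p_class: "x \<in> topspace X \<Longrightarrow> p n x \<in> range RZ_class"
    and p_double: "x \<in> topspace X \<Longrightarrow> w \<in> p (Suc n) x \<Longrightarrow> 2 * w \<in> p n x"
    and p_surj: "\<exists>x\<in>topspace X. z \<in> p n x"
    and p_open: "open V \<Longrightarrow> openin X {x \<in> topspace X. \<exists>w\<in>p n x. w \<in> V}"
    and p_nbhd: "openin X U \<Longrightarrow> x \<in> U \<Longrightarrow>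
        \<exists>n. \<exists>z\<in>p n x. \<exists>d>0. \<forall>y\<in>topspace X. (\<exists>w\<in>p n y. \<bar>w - z\<bar> < d) \<longrightarrow> y \<in> U"
    and X_compact: "compact_space X"
begin

lemma p_diff:
  assumes "x \<in> topspace X" "v \<in> p n x" "w \<in> p n x" obtains m :: int where "w = v + of_int m"
proof -
  obtain z where "p n x = RZ_class z" using p_class[OF assms(1)] by blast
  then have "w - z \<in> \<int>" "v - z \<in> \<int>" using assms(2,3) by (simp_all add: mem_RZ_class)
  then have "(w - z) - (v - z) \<in> \<int>" by (rule Ints_diff)
  then obtain m where "w - v = of_int m" by (auto elim: Ints_cases)
  then have "w = v + of_int m" by simp
  then show ?thesis using that by blast
qed

lemma p_add:
  assumes "x \<in> topspace X" "v \<in> p n x" shows "v + of_int m \<in> p n x"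
proof -
  obtain z where z: "p n x = RZ_class z" using p_class[OF assms(1)] by blast
  then have "v - z \<in> \<int>" using assms(2) by (simp add: mem_RZ_class)
  then have "(v - z) + of_int m \<in> \<int>" by (intro Ints_add) auto
  then show ?thesis using z by (simp add: mem_RZ_class algebra_simps)
qed

lemma p_ex: "x \<in> topspace X \<Longrightarrow> \<exists>w. w \<in> p n x"
proof -
  assume "x \<in> topspace X"
  then obtain z where "p n x = RZ_class z" using p_class by blast
  then have "z \<in> p n x" by (simp add: mem_RZ_class)
  then show ?thesis ..
qed

lemma p_power: "x \<in> topspace X \<Longrightarrow> w \<in> p (n + k) x \<Longrightarrow> 2 ^ k * w \<in> p n x"
proof (induction k arbitrary: w)
  case (Suc k)
  then have "2 * w \<in> p (n + k) x" using p_double by simp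
  from Suc.IH[OF Suc.prems(1) this] show ?case by (simp add: mult_ac)
qed simp

definition arc :: "nat \<Rightarrow> int \<Rightarrow> 'a set" where
  "arc n i = {x \<in> topspace X. \<exists>w\<in>p n x. \<bar>real (arcs n) * w - of_int i\<bar> < 1}"

definition arc_cover :: "nat \<Rightarrow> 'a set set" where
  "arc_cover n = range (arc n)"

lemma arc_in_cover: "arc n i \<in> arc_cover n"
  unfolding arc_cover_def by blast

lemma arc_periodic: "arc n (i + int (arcs n) * m) = arc n i"
proof -
  have sub: "arc n i \<subseteq> arc n (i + int (arcs n) * m)" for i m
  proof
    fix x assume "x \<in> arc n i"
    then obtain w where w: "x \<in> topspace X" "w \<in> p n x" "\<bar>real (arcs n) * w - of_int i\<bar> < 1"
      unfolding arc_def by blast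
    have "real (arcs n) * (w + of_int m) - of_int (i + int (arcs n) * m) = real (arcs n) * w - of_int i"
      by (simp add: algebra_simps)
    then show "x \<in> arc n (i + int (arcs n) * m)"
      unfolding arc_def using w p_add[OF w(1,2), of m] by (intro CollectI conjI bexI[of _ "w + of_int m"]) simp_all
  qed
  show ?thesis using sub[of i m] sub[of "i + int (arcs n) * m" "- m"] by simp
qed

lemma arc_mod: "arc n (i mod int (arcs n)) = arc n i"
  using arc_periodic[of n "i mod int (arcs n)" "i div int (arcs n)"] by simp

lemma openin_arc: "openin X (arc n i)"
proof -
  have "open {w. \<bar>real (arcs n) * w - of_int i\<bar> < 1}"
    by (intro open_Collect_less continuous_intros)
  from p_open[OF this] show ?thesis unfolding arc_def by simp
qed

text \<open>An integer change of lift brings the index of the arc within 1 of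
  \<open>arcs n * w\<close>. A point thus lies in at most two arcs of a level, which makes the nerve
  a cycle.\<close>

lemma arc_mem_near:
  assumes "x \<in> topspace X" "w \<in> p n x" "x \<in> arc n j"
  shows "arc n j = arc n \<lfloor>real (arcs n) * w\<rfloor> \<or> arc n j = arc n (\<lfloor>real (arcs n) * w\<rfloor> + 1)"
proof -
  obtain v where v: "v \<in> p n x" "\<bar>real (arcs n) * v - of_int j\<bar> < 1"
    using assms(3) unfolding arc_def by blast
  obtain m where m: "w = v + of_int m" using p_diff[OF assms(1) v(1) assms(2)] .
  have "real (arcs n) * w - of_int (j + int (arcs n) * m) = real (arcs n) * v - of_int j"
    by (simp add: m algebra_simps)
  then have "\<bar>real (arcs n) * w - of_int (j + int (arcs n) * m)\<bar> < 1" using v(2) by (simp only:)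
  from int_near_floor[OF this] show ?thesis unfolding arc_periodic[of n j m, symmetric] by (elim disjE) simp_all
qed

lemma arc_cover_open: "arc_cover n \<in> open_covers X"
proof -
  have "x \<in> \<Union>(arc_cover n)" if x: "x \<in> topspace X" for x
  proof -
    obtain w where w: "w \<in> p n x" using p_ex[OF x] by blast
    have "\<bar>real (arcs n) * w - of_int \<lfloor>real (arcs n) * w\<rfloor>\<bar> < 1"
      using floor_correct[of "real (arcs n) * w"] by linarith
    then have "x \<in> arc n \<lfloor>real (arcs n) * w\<rfloor>" unfolding arc_def using x w by blast
    then show ?thesis using arc_in_cover by blast
  qed
  moreover have "\<Union>(arc_cover n) \<subseteq> topspace X"
    unfolding arc_cover_def using openin_subset[OF openin_arc] by (intro UN_least)
  ultimately have "\<Union>(arc_cover n) = topspace X" by (intro equalityI subsetI) blast+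
  moreover have "\<forall>U\<in>arc_cover n. openin X U" unfolding arc_cover_def using openin_arc by simp
  ultimately show ?thesis unfolding open_covers_def by simp
qed

lemma arc_Int_Suc: "arc n i \<inter> arc n (i + 1) \<noteq> {}"
proof -
  obtain x where x: "x \<in> topspace X" "(of_int i + 1/2) / real (arcs n) \<in> p n x" using p_surj by blast
  have "real (arcs n) * ((of_int i + 1/2) / real (arcs n)) = of_int i + 1/2" using arcs_pos[of n] by simp
  then have "x \<in> arc n i" "x \<in> arc n (i + 1)"
    unfolding arc_def using x by (auto intro!: bexI[OF _ x(2)])
  then show ?thesis by blast
qed

lemma arc_nonempty: "arc n i \<noteq> {}"
  using arc_Int_Suc by blast

text \<open>A point over the centre \<open>i / arcs n\<close> lies in no arc whose index differs
  from \<open>i\<close> modulo \<open>arcs n\<close>.\<close>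

lemma arc_eqD:
  assumes "arc n i = arc n j" shows "i mod int (arcs n) = j mod int (arcs n)"
proof -
  obtain x where x: "x \<in> topspace X" "of_int i / real (arcs n) \<in> p n x" using p_surj by blast
  have e: "real (arcs n) * (of_int i / real (arcs n)) = of_int i" using arcs_pos[of n] by simp
  then have "x \<in> arc n i" unfolding arc_def using x by (auto intro!: bexI[OF _ x(2)])
  then obtain v where v: "v \<in> p n x" "\<bar>real (arcs n) * v - of_int j\<bar> < 1"
    using assms unfolding arc_def by blast
  obtain m where m: "v = of_int i / real (arcs n) + of_int m" using p_diff[OF x v(1)] .
  have "real (arcs n) * v = of_int (i + int (arcs n) * m)"
    unfolding m ring_distribs e by simp
  then have "\<bar>of_int (i + int (arcs n) * m - j) :: real\<bar> < 1" using v(2) by simp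
  then have "j = i + int (arcs n) * m" by linarith
  then show ?thesis by simp
qed

text \<open>Doubling the lift and dividing the number of arcs by 4 halves position and radius;
  rounding an odd index down costs 1/2, just what the halved radius leaves.\<close>

lemma arc_Suc_subset: "arc (Suc n) i \<subseteq> arc n (i div 2)"
proof
  fix x assume "x \<in> arc (Suc n) i"
  then obtain w where w: "x \<in> topspace X" "w \<in> p (Suc n) x" "\<bar>real (arcs (Suc n)) * w - of_int i\<bar> < 1"
    unfolding arc_def by blast
  have "i = 2 * (i div 2) \<or> i = 2 * (i div 2) + 1" by presburger
  then have "real_of_int i = 2 * of_int (i div 2) \<or> real_of_int i = 2 * of_int (i div 2) + 1"
    by (metis of_int_add of_int_mult of_int_numeral of_int_1)
  moreover have "real (arcs (Suc n)) * w = 2 * (real (arcs n) * (2 * w))" unfolding arcs_Suc by simp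
  ultimately have "\<bar>real (arcs n) * (2 * w) - of_int (i div 2)\<bar> < 1"
    using w(3) unfolding abs_less_iff by linarith
  then show "x \<in> arc n (i div 2)" unfolding arc_def using w(1) p_double[OF w(1,2)] by blast
qed

text \<open>Indexing by integers with period \<open>arcs n\<close> follows the cycle of arcs and
  turns the passage to the next level into \<open>i div 2\<close>.\<close>

definition refinement :: "'a set set \<Rightarrow> nat \<Rightarrow> (int \<Rightarrow> 'a set) \<Rightarrow> bool" where
  "refinement \<U> n \<rho> \<longleftrightarrow> (\<forall>i. \<rho> i \<in> \<U> \<and> arc n i \<subseteq> \<rho> i \<and> \<rho> (i + int (arcs n)) = \<rho> i)"

lemma refinementD:
  assumes "refinement \<U> n \<rho>"
  shows "\<rho> i \<in> \<U>" "arc n i \<subseteq> \<rho> i" "\<rho> (i + int (arcs n)) = \<rho> i"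
  using assms unfolding refinement_def by blast+

lemma refinement_Suc:
  assumes r: "refinement \<U> n \<rho>" shows "refinement \<U> (Suc n) (\<lambda>i. \<rho> (i div 2))"
  unfolding refinement_def
proof (intro allI conjI)
  fix i
  show "\<rho> (i div 2) \<in> \<U>" using refinementD(1)[OF r] .
  show "arc (Suc n) i \<subseteq> \<rho> (i div 2)" using arc_Suc_subset refinementD(2)[OF r] by blast
  have "(i + int (arcs (Suc n))) div 2 = i div 2 + int (arcs n) + int (arcs n)"
    unfolding arcs_Suc by simp
  then show "\<rho> ((i + int (arcs (Suc n))) div 2) = \<rho> (i div 2)"
    using refinementD(3)[OF r, of "i div 2"] refinementD(3)[OF r, of "i div 2 + int (arcs n)"]
    by (simp only:)
qed

lemma refinement_add: "refinement \<U> n \<rho> \<Longrightarrow> \<exists>\<sigma>. refinement \<U> (n + k) \<sigma>"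
  by (induction k) (auto dest: refinement_Suc)

lemma refined_by_refinement:
  "refined_by \<U> (arc_cover n) \<longleftrightarrow> (\<exists>\<rho>. refinement \<U> n \<rho>)"
proof
  assume r: "refined_by \<U> (arc_cover n)"
  have "arc n (i + int (arcs n)) = arc n i" for i using arc_periodic[of n i 1] by simp
  then have "refinement \<U> n (\<lambda>i. refinement_map \<U> (arc n i))"
    unfolding refinement_def using refinement_map[OF r arc_in_cover] by simp
  then show "\<exists>\<rho>. refinement \<U> n \<rho>" by (rule exI[of "refinement \<U> n"])
next
  assume "\<exists>\<rho>. refinement \<U> n \<rho>"
  then show "refined_by \<U> (arc_cover n)"
    unfolding refined_by_def arc_cover_def refinement_def by blast
qed

lemma refinement_arc: "refinement (arc_cover n) n (arc n)"
  unfolding refinement_def using arc_in_cover arc_periodic[of n _ 1] by simp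

text \<open>A Lebesgue number argument: each point has a neighbourhood \<open>K\<close> such that
  all sufficiently fine arcs meeting \<open>K\<close> lie in members of the cover, and compactness
  gives one level for all points.\<close>

lemma arc_covers_cofinal:
  assumes \<U>: "\<U> \<in> open_covers X"
  shows "\<exists>n \<rho>. refinement \<U> n \<rho>"
proof -
  define good where "good K \<longleftrightarrow> openin X K \<and>
    (\<exists>N. \<forall>m\<ge>N. \<forall>i. arc m i \<inter> K \<noteq> {} \<longrightarrow> (\<exists>U\<in>\<U>. arc m i \<subseteq> U))" for K
  have ex_good: "\<exists>K. good K \<and> x \<in> K" if x: "x \<in> topspace X" for x
  proof -
    obtain U where U: "U \<in> \<U>" "x \<in> U" "openin X U"
      using \<U> x unfolding open_covers_def by blast
    from p_nbhd[OF U(3,2)] obtain n z d where z: "z \<in> p n x" "d > 0"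
        "\<forall>y\<in>topspace X. (\<exists>w\<in>p n y. \<bar>w - z\<bar> < d) \<longrightarrow> y \<in> U" by (elim exE bexE conjE)
    \<comment> \<open>The other half of \<open>d\<close> is reserved for the width of the
      arcs.\<close>
    let ?K = "{y \<in> topspace X. \<exists>w\<in>p n y. w \<in> {w. \<bar>w - z\<bar> < d / 2}}"
    have "open {w. \<bar>w - z\<bar> < d / 2}" by (intro open_Collect_less continuous_intros)
    then have K: "openin X ?K" by (rule p_open)
    obtain N0 where N0: "2 / d < 2 ^ N0" using real_arch_pow[of 2 "2 / d"] by auto
    have "\<exists>U\<in>\<U>. arc m i \<subseteq> U" if m: "m \<ge> max n N0" and ne: "arc m i \<inter> ?K \<noteq> {}" for m i
    proof -
      obtain k where k: "m = n + k" using m le_Suc_ex[of n m] by auto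
      obtain y0 w0 u0 where y0: "y0 \<in> topspace X" "w0 \<in> p m y0" "\<bar>real (arcs m) * w0 - of_int i\<bar> < 1"
          "u0 \<in> p n y0" "\<bar>u0 - z\<bar> < d / 2"
        using ne unfolding arc_def by blast
      have "2 ^ k * w0 \<in> p n y0" using p_power[OF y0(1)] y0(2) k by simp
      \<comment> \<open>\<open>l\<close> moves the projected lift of \<open>y0\<close> next to
        \<open>z\<close>; the same \<open>l\<close> serves the whole arc, whose points have lifts
        close to \<open>w0\<close>.\<close>
      from p_diff[OF y0(1) this y0(4)] obtain l where l: "u0 = 2 ^ k * w0 + of_int l" .
      have "y \<in> U" if y: "y \<in> arc m i" for y
      proof -
        obtain w where w: "y \<in> topspace X" "w \<in> p m y" "\<bar>real (arcs m) * w - of_int i\<bar> < 1"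
          using y unfolding arc_def by blast
        have "2 ^ k * w \<in> p n y" using p_power[OF w(1)] w(2) k by simp
        from p_add[OF w(1) this] have u: "2 ^ k * w + of_int l \<in> p n y" .
        have "\<bar>(real (arcs m) * w - of_int i) - (real (arcs m) * w0 - of_int i)\<bar> < 2"
          using w(3) y0(3) by linarith
        then have "\<bar>real (arcs m) * (w - w0)\<bar> < 2" by (simp add: right_diff_distrib)
        then have a: "real (arcs m) * \<bar>w - w0\<bar> < 2" by (simp add: abs_mult)
        \<comment> \<open>The \<open>4 ^ Suc m\<close> arcs pay for both the stretching by
          \<open>2 ^ k\<close> down to coordinate \<open>n\<close> and the precision
          \<open>2 ^ N0\<close>.\<close>
        have "(2::real) ^ k * 2 ^ N0 * 2 \<le> 2 ^ m * 2 ^ m * 2"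
          by (intro mult_mono power_increasing) (use k m in auto)
        also have "\<dots> \<le> real (arcs m)" unfolding arcs_def
          by (simp add: power_mult_distrib[symmetric])
        finally have "2 ^ k * 2 ^ N0 * 2 * \<bar>w - w0\<bar> \<le> real (arcs m) * \<bar>w - w0\<bar>"
          by (rule mult_right_mono) simp
        then have b: "2 ^ N0 * (2 ^ k * \<bar>w - w0\<bar>) < 1" using a by (simp add: mult_ac)
        have "2 / d * (2 ^ k * \<bar>w - w0\<bar>) \<le> 2 ^ N0 * (2 ^ k * \<bar>w - w0\<bar>)"
          using N0 by (intro mult_right_mono) auto
        then have "2 / d * (2 ^ k * \<bar>w - w0\<bar>) < 1" using b by linarith
        then have c: "2 ^ k * \<bar>w - w0\<bar> < d / 2" using z(2) by (simp add: field_simps)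
        have "(2 ^ k * w + of_int l) - u0 = 2 ^ k * (w - w0)" unfolding l by (simp add: right_diff_distrib)
        then have "\<bar>(2 ^ k * w + of_int l) - u0\<bar> < d / 2" using c by (simp add: abs_mult)
        then have "\<bar>(2 ^ k * w + of_int l) - z\<bar> < d" using y0(5) by linarith
        then show "y \<in> U" using z(3) w(1) u by blast
      qed
      then show ?thesis using U(1) by blast
    qed
    then have "good ?K" unfolding good_def using K by blast
    moreover have "x \<in> ?K" using x z(1,2) by (auto intro!: bexI[OF _ z(1)])
    ultimately show ?thesis by blast
  qed
  have good_open: "openin X K" if "good K" for K using that unfolding good_def by (rule conjunct1)
  have "\<Union>{K. good K} = topspace X"
  proof (intro equalityI subsetI)
    fix x assume "x \<in> \<Union>{K. good K}"
    then obtain K where "good K" "x \<in> K" by blast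
    then show "x \<in> topspace X" using openin_subset[OF good_open] by blast
  next
    fix x assume "x \<in> topspace X"
    from ex_good[OF this] show "x \<in> \<Union>{K. good K}" by blast
  qed
  moreover have "\<forall>K\<in>{K. good K}. openin X K" using good_open by blast
  ultimately obtain \<F> where F: "finite \<F>" "\<F> \<subseteq> {K. good K}" "\<Union>\<F> = topspace X"
    using X_compact unfolding compact_space by meson
  have "\<forall>K\<in>\<F>. \<exists>N. \<forall>m\<ge>N. \<forall>i. arc m i \<inter> K \<noteq> {} \<longrightarrow> (\<exists>U\<in>\<U>. arc m i \<subseteq> U)"
    using F(2) unfolding good_def by blast
  then obtain N where N: "\<And>K m i. K \<in> \<F> \<Longrightarrow> N K \<le> m \<Longrightarrow> arc m i \<inter> K \<noteq> {} \<Longrightarrow> \<exists>U\<in>\<U>. arc m i \<subseteq> U"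
    by metis
  obtain m where m: "\<forall>K\<in>\<F>. N K \<le> m"
    using F(1) by (metis finite_imageI finite_nat_set_iff_bounded_le image_eqI)
  have "\<exists>U\<in>\<U>. arc m i \<subseteq> U" for i
  proof -
    obtain x where x: "x \<in> arc m i" using arc_nonempty by blast
    then have "x \<in> topspace X" unfolding arc_def by blast
    then obtain K where "K \<in> \<F>" "x \<in> K" using F(3) by blast
    then show ?thesis using N[of K m i] m x by blast
  qed
  then have "refined_by \<U> (arc_cover m)" unfolding refined_by_def arc_cover_def by blast
  then show ?thesis using refined_by_refinement by blast
qed

end

context solenoid_coordinates
begin

subsection \<open>The winding number of a cocycle\<close>

definition holonomy :: "nat \<Rightarrow> (int \<Rightarrow> 'a set) \<Rightarrow> ('a set list \<Rightarrow> int) \<Rightarrow> int" where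
  "holonomy n \<rho> c = (\<Sum>i<arcs n. c [\<rho> (int i), \<rho> (int i + 1)])"

lemma sum_periodic_telescope:
  fixes b :: "int \<Rightarrow> int"
  assumes "b (int m) = b 0" shows "(\<Sum>i<m. b (int i + 1) - b (int i)) = 0"
proof -
  have "(\<Sum>i<m. b (int (Suc i)) - b (int i)) = b (int m) - b (int 0)"
    by (rule sum_lessThan_telescope)
  then show ?thesis using assms by (simp add: add.commute)
qed

text \<open>Edges from \<open>\<rho> i\<close> to \<open>\<sigma> i\<close> join the two chains.
  Each square between them splits into two triangles with nonempty intersection, and the joining
  terms cancel around the period.\<close>

lemma holonomy_unique:
  assumes c: "c \<in> cocycles1 \<U>" and r: "refinement \<U> n \<rho>" and s: "refinement \<U> n \<sigma>"
  shows "holonomy n \<rho> c = holonomy n \<sigma> c"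
proof -
  define b where "b i = c [\<rho> i, \<sigma> i]" for i
  note rD = refinementD[OF r] and sD = refinementD[OF s]
  have "c [\<sigma> i, \<sigma> (i + 1)] - c [\<rho> i, \<rho> (i + 1)] = b (i + 1) - b i" for i
  proof -
    have 1: "\<rho> i \<inter> \<rho> (i + 1) \<inter> \<sigma> (i + 1) \<noteq> {}" and 2: "\<rho> i \<inter> \<sigma> i \<inter> \<sigma> (i + 1) \<noteq> {}"
      using arc_Int_Suc[of n i] rD(2)[of i] rD(2)[of "i + 1"] sD(2)[of i] sD(2)[of "i + 1"] by blast+
    show ?thesis
      using cocycle_add[OF c rD(1) rD(1) sD(1) 1] cocycle_add[OF c rD(1) sD(1) sD(1) 2]
      unfolding b_def by linarith
  qed
  then have "holonomy n \<sigma> c - holonomy n \<rho> c = (\<Sum>i<arcs n. b (int i + 1) - b (int i))"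
    unfolding holonomy_def by (simp flip: sum_subtractf)
  also have "\<dots> = 0"
    by (rule sum_periodic_telescope) (use rD(3)[of 0] sD(3)[of 0] in \<open>simp add: b_def\<close>)
  finally show ?thesis by simp
qed

text \<open>The finer cycle has \<open>4 * arcs n\<close> steps. Halving the index makes every other
  step constant, with value 0, and the remaining \<open>2 * arcs n\<close> steps run twice around
  the coarser cycle.\<close>

lemma holonomy_Suc:
  assumes c: "c \<in> cocycles1 \<U>" and r: "refinement \<U> n \<rho>"
  shows "holonomy (Suc n) (\<lambda>i. \<rho> (i div 2)) c = 2 * holonomy n \<rho> c"
proof -
  note rD = refinementD[OF r]
  define g where "g j = c [\<rho> (int j), \<rho> (int j + 1)]" for j
  have z: "c [\<rho> i, \<rho> i] = 0" for i
    using cocycle_refl[OF c rD(1)] rD(2)[of i] arc_nonempty[of n i] by blast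
  have "holonomy (Suc n) (\<lambda>i. \<rho> (i div 2)) c
      = (\<Sum>i<2 * (arcs n + arcs n). c [\<rho> (int i div 2), \<rho> ((int i + 1) div 2)])"
    unfolding holonomy_def arcs_Suc by (simp add: mult_2[symmetric])
  also have "\<dots> = (\<Sum>j<arcs n + arcs n. g j)"
    unfolding sum_lessThan_double
  proof (rule sum.cong)
    fix j
    have "int (2 * j) div 2 = int j" "(int (2 * j) + 1) div 2 = int j"
      "int (2 * j + 1) div 2 = int j" "(int (2 * j + 1) + 1) div 2 = int j + 1" by simp_all
    then show "c [\<rho> (int (2 * j) div 2), \<rho> ((int (2 * j) + 1) div 2)]
        + c [\<rho> (int (2 * j + 1) div 2), \<rho> ((int (2 * j + 1) + 1) div 2)] = g j"
      by (simp only: z g_def)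
  qed simp
  also have "\<dots> = (\<Sum>j<arcs n. g j) + (\<Sum>j<arcs n. g (j + arcs n))"
  proof -
    have "(\<Sum>j<k + m. g j) = (\<Sum>j<k. g j) + (\<Sum>j<m. g (j + k))" for k m
      by (induction m) (simp_all add: add.commute)
    then show ?thesis .
  qed
  also have "(\<Sum>j<arcs n. g (j + arcs n)) = (\<Sum>j<arcs n. g j)"
  proof (rule sum.cong)
    fix j
    show "g (j + arcs n) = g j"
      using rD(3)[of "int j"] rD(3)[of "int j + 1"] unfolding g_def by (simp add: algebra_simps)
  qed simp
  finally show ?thesis unfolding holonomy_def g_def by simp
qed

lemma holonomy_lift:
  assumes c: "c \<in> cocycles1 \<U>" and r: "refinement \<U> n \<rho>"
  shows "\<exists>\<sigma>. refinement \<U> (n + k) \<sigma> \<and> holonomy (n + k) \<sigma> c = 2 ^ k * holonomy n \<rho> c"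
proof (induction k)
  case 0
  show ?case using r by auto
next
  case (Suc k)
  then obtain \<sigma> where "refinement \<U> (n + k) \<sigma>" "holonomy (n + k) \<sigma> c = 2 ^ k * holonomy n \<rho> c" by blast
  then have "refinement \<U> (n + Suc k) (\<lambda>i. \<sigma> (i div 2))"
    "holonomy (n + Suc k) (\<lambda>i. \<sigma> (i div 2)) c = 2 ^ Suc k * holonomy n \<rho> c"
    using refinement_Suc holonomy_Suc[OF c] by simp_all
  then show ?case by (intro exI[of _ "\<lambda>i. \<sigma> (i div 2)"] conjI)
qed

text \<open>Both refinements are lifted to level \<open>n + m\<close>, where the holonomy is
  independent of the choice.\<close>

lemma holonomy_scaled_unique:
  assumes c: "c \<in> cocycles1 \<U>" and r: "refinement \<U> n \<rho>" and s: "refinement \<U> m \<sigma>"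
  shows "(of_int (holonomy n \<rho> c) / 2 ^ n :: rat) = of_int (holonomy m \<sigma> c) / 2 ^ m"
proof -
  obtain \<rho>' where r': "refinement \<U> (n + m) \<rho>'" "holonomy (n + m) \<rho>' c = 2 ^ m * holonomy n \<rho> c"
    using holonomy_lift[OF c r] by blast
  obtain \<sigma>' where s': "refinement \<U> (m + n) \<sigma>'" "holonomy (m + n) \<sigma>' c = 2 ^ n * holonomy m \<sigma> c"
    using holonomy_lift[OF c s] by blast
  have "refinement \<U> (n + m) \<sigma>'" using s'(1) by (simp only: add.commute)
  from holonomy_unique[OF c r'(1) this]
  have e: "2 ^ m * holonomy n \<rho> c = 2 ^ n * holonomy m \<sigma> c"
    using r'(2) s'(2) by (simp only: add.commute[of m n])
  have "(of_int (2 ^ m * holonomy n \<rho> c) :: rat) = of_int (2 ^ n * holonomy m \<sigma> c)" unfolding e ..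
  then show ?thesis by (simp add: field_simps)
qed

text \<open>For a cocycle all levels and refinements give the same quotient, so the choice only
  names it.\<close>

definition winding :: "'a set set \<Rightarrow> ('a set list \<Rightarrow> int) \<Rightarrow> rat" where
  "winding \<U> c = (SOME q. \<exists>n \<rho>. refinement \<U> n \<rho> \<and> q = of_int (holonomy n \<rho> c) / 2 ^ n)"

lemma winding_eq:
  assumes c: "c \<in> cocycles1 \<U>" and r: "refinement \<U> n \<rho>"
  shows "winding \<U> c = of_int (holonomy n \<rho> c) / 2 ^ n"
  unfolding winding_def
proof (rule someI2)
  show "\<exists>m \<sigma>. refinement \<U> m \<sigma> \<and> of_int (holonomy n \<rho> c) / (2 ^ n :: rat) = of_int (holonomy m \<sigma> c) / 2 ^ m"
    using r by blast
  fix q :: rat assume "\<exists>m \<sigma>. refinement \<U> m \<sigma> \<and> q = of_int (holonomy m \<sigma> c) / 2 ^ m"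
  then obtain m \<sigma> where m: "refinement \<U> m \<sigma>" "q = of_int (holonomy m \<sigma> c) / 2 ^ m" by blast
  show "q = of_int (holonomy n \<rho> c) / 2 ^ n"
    unfolding m(2) by (rule holonomy_scaled_unique[OF c m(1) r])
qed

lemma winding_add:
  assumes U: "\<U> \<in> open_covers X" and c: "c \<in> cocycles1 \<U>" and d: "d \<in> cocycles1 \<U>"
  shows "winding \<U> (\<lambda>s. c s + d s) = winding \<U> c + winding \<U> d"
proof -
  obtain n \<rho> where r: "refinement \<U> n \<rho>" using arc_covers_cofinal[OF U] by blast
  have "holonomy n \<rho> (\<lambda>s. c s + d s) = holonomy n \<rho> c + holonomy n \<rho> d"
    unfolding holonomy_def by (rule sum.distrib)
  then show ?thesis
    unfolding winding_eq[OF c r] winding_eq[OF d r] winding_eq[OF cocycles1_add[OF c d] r]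
    by (simp add: add_divide_distrib)
qed

lemma winding_coboundary:
  assumes U: "\<U> \<in> open_covers X" and h: "h \<in> cech_coboundaries \<U> 1"
  shows "winding \<U> h = 0"
proof -
  obtain n \<rho> where r: "refinement \<U> n \<rho>" using arc_covers_cofinal[OF U] by blast
  note rD = refinementD[OF r]
  obtain b where b: "h = (\<lambda>s. if s \<in> nerve_simplices \<U> 1 then b (s ! 1) - b (s ! 0) else 0)"
    using h unfolding coboundaries1_iff by blast
  have "[\<rho> i, \<rho> (i + 1)] \<in> nerve_simplices \<U> 1" for i
    unfolding nerve1 using rD arc_Int_Suc[of n i] by blast
  then have "h [\<rho> i, \<rho> (i + 1)] = b (\<rho> (i + 1)) - b (\<rho> i)" for i
    unfolding b by simp
  then have "holonomy n \<rho> h = (\<Sum>i<arcs n. b (\<rho> (int i + 1)) - b (\<rho> (int i)))"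
    unfolding holonomy_def by simp
  also have "\<dots> = 0"
    by (rule sum_periodic_telescope[of "\<lambda>i. b (\<rho> i)"]) (use rD(3)[of 0] in simp)
  finally have z: "holonomy n \<rho> h = 0" .
  have "h \<in> cocycles1 \<U>" using h coboundaries1_cocycles by blast
  from winding_eq[OF this r] show ?thesis by (simp add: z)
qed

text \<open>A refinement into \<open>\<V>\<close> followed by the refinement map is one into
  \<open>\<U>\<close>, and the two sums agree term by term.\<close>

lemma winding_pullback:
  assumes r: "refined_by \<U> \<V>" and V: "\<V> \<in> open_covers X" and c: "c \<in> cocycles1 \<U>"
  shows "winding \<V> (cech_pullback 1 \<U> \<V> c) = winding \<U> c"
proof -
  obtain n \<rho> where p: "refinement \<V> n \<rho>" using arc_covers_cofinal[OF V] by blast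
  note pD = refinementD[OF p]
  have q: "refinement \<U> n (\<lambda>i. refinement_map \<U> (\<rho> i))"
    unfolding refinement_def
  proof (intro allI conjI)
    fix i
    show "refinement_map \<U> (\<rho> i) \<in> \<U>" by (rule refinement_map(1)[OF r pD(1)])
    show "arc n i \<subseteq> refinement_map \<U> (\<rho> i)" using refinement_map(2)[OF r pD(1)] pD(2) by blast
    show "refinement_map \<U> (\<rho> (i + int (arcs n))) = refinement_map \<U> (\<rho> i)" by (simp only: pD(3))
  qed
  have "cech_pullback 1 \<U> \<V> c [\<rho> i, \<rho> (i + 1)] = c [refinement_map \<U> (\<rho> i), refinement_map \<U> (\<rho> (i + 1))]" for i
    by (rule pullback_apply[OF pD(1) pD(1)]) (use pD(2) arc_Int_Suc[of n i] in blast)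
  then have "holonomy n \<rho> (cech_pullback 1 \<U> \<V> c) = holonomy n (\<lambda>i. refinement_map \<U> (\<rho> i)) c"
    unfolding holonomy_def by (simp only:)
  then show ?thesis
    unfolding winding_eq[OF c q] winding_eq[OF pullback_cocycle[OF r c] p] by (simp only:)
qed

lemma arc_pair_cases:
  assumes "U \<in> arc_cover n" "V \<in> arc_cover n" "U \<inter> V \<noteq> {}"
  obtains i where "U = arc n i" "V = arc n i" | i where "U = arc n i" "V = arc n (i + 1)"
    | i where "V = arc n i" "U = arc n (i + 1)"
proof -
  obtain x where x: "x \<in> U" "x \<in> V" using assms(3) by blast
  obtain i j where ij: "U = arc n i" "V = arc n j" using assms(1,2) unfolding arc_cover_def by blast
  have X: "x \<in> topspace X" using x(1) unfolding ij arc_def by blast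
  then obtain w where w: "w \<in> p n x" using p_ex by blast
  show ?thesis
    using arc_mem_near[OF X w x(1)[unfolded ij]] arc_mem_near[OF X w x(2)[unfolded ij]] that
    unfolding ij by metis
qed

text \<open>A cocycle on an arc cover without holonomy is the coboundary of its partial sums.\<close>

lemma holonomy_zero_coboundary:
  assumes c: "c \<in> cocycles1 (arc_cover n)" and h: "holonomy n (arc n) c = 0"
  shows "c \<in> cech_coboundaries (arc_cover n) 1"
proof -
  let ?M = "int (arcs n)"
  have M: "?M > 0" using arcs_pos[of n] by linarith
  \<comment> \<open>Reducing the index first makes the partial sum a function of the arc.\<close>
  define B where "B i = (\<Sum>j<nat (i mod ?M). c [arc n (int j), arc n (int j + 1)])" for i
  have B_Suc: "B (i + 1) - B i = c [arc n i, arc n (i + 1)]" for i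
  proof -
    define k where "k = nat (i mod ?M)"
    have k: "int k = i mod ?M" "k < arcs n" unfolding k_def using M by (auto simp: nat_less_iff)
    have a: "c [arc n i, arc n (i + 1)] = c [arc n (int k), arc n (int k + 1)]"
    proof -
      have "arc n i = arc n (int k)" unfolding k(1) by (rule arc_mod[symmetric])
      moreover have "arc n (i + 1) = arc n (int k + 1)"
        unfolding k(1) by (metis arc_mod mod_add_left_eq)
      ultimately show ?thesis by simp
    qed
    have bi: "B i = (\<Sum>j<k. c [arc n (int j), arc n (int j + 1)])" unfolding B_def k_def ..
    have m: "(i + 1) mod ?M = (int k + 1) mod ?M" unfolding k(1) by (simp add: mod_add_left_eq)
    show ?thesis
    proof (cases "Suc k = arcs n")
      \<comment> \<open>At the end of the cycle the partial sum falls back to 0; vanishing holonomy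
        accounts for the jump.\<close>
      case True
      then have "(i + 1) mod ?M = 0" unfolding m by (metis mod_self of_nat_Suc add.commute)
      then have "B (i + 1) = 0" unfolding B_def by simp
      moreover have "holonomy n (arc n) c = B i + c [arc n (int k), arc n (int k + 1)]"
        unfolding holonomy_def bi True[symmetric] by simp
      ultimately show ?thesis using h a by simp
    next
      case False
      then have "(int k + 1) mod ?M = int (Suc k)" using k(2) by simp
      then have "nat ((i + 1) mod ?M) = Suc k" unfolding m by (simp only: nat_int)
      then have "B (i + 1) = (\<Sum>j<Suc k. c [arc n (int j), arc n (int j + 1)])"
        unfolding B_def by (simp only:)
      then show ?thesis unfolding bi a by simp
    qed
  qed
  define b where "b U = B (SOME i. U = arc n i)" for U
  have b: "b (arc n i) = B i" for i
  proof -
    have "arc n i = arc n (SOME j. arc n i = arc n j)" by (rule someI[of _ i]) simp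
    from arc_eqD[OF this] show ?thesis unfolding b_def B_def by simp
  qed
  have "c s = (if s \<in> nerve_simplices (arc_cover n) 1 then b (s ! 1) - b (s ! 0) else 0)" for s
  proof (cases "s \<in> nerve_simplices (arc_cover n) 1")
    case True
    then obtain U V where s: "s = [U, V]" "U \<in> arc_cover n" "V \<in> arc_cover n" "U \<inter> V \<noteq> {}" by (rule nerve1E)
    have "c [U, V] = b V - b U"
    proof (rule arc_pair_cases[OF s(2-4)])
      fix i assume "U = arc n i" "V = arc n i"
      then show ?thesis using cocycle_refl[OF c arc_in_cover arc_nonempty] by simp
    next
      fix i assume "U = arc n i" "V = arc n (i + 1)"
      then show ?thesis using B_Suc[of i] b by simp
    next
      fix i assume i: "V = arc n i" "U = arc n (i + 1)"
      have "c [arc n (i + 1), arc n i] = - c [arc n i, arc n (i + 1)]"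
        by (rule cocycle_sym[OF c arc_in_cover arc_in_cover arc_Int_Suc])
      then show ?thesis using B_Suc[of i] b i by simp
    qed
    then show ?thesis using True s(1) by simp
  next
    case False
    then show ?thesis using c unfolding cocycles1_iff by simp
  qed
  then show ?thesis unfolding coboundaries1_iff by (intro exI[of _ b] ext)
qed

text \<open>The cocycle is concentrated on the edge that closes the cycle, from the last arc to arc
  0, so one turn collects exactly its weight \<open>m\<close>.\<close>

lemma winding_surj:
  "\<exists>c\<in>cocycles1 (arc_cover n). winding (arc_cover n) c = of_int m / 2 ^ n"
proof -
  let ?M = "int (arcs n)"
  define P where "P = arc n (?M - 1)"
  define Q where "Q = arc n 0"
  have M: "?M \<ge> 4" unfolding arcs_def by simp
  have mod_M: "(?M - 1) mod ?M = ?M - 1" by (rule mod_pos_pos_trivial) (use M in linarith)+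
  have PQ: "P \<noteq> Q"
  proof
    assume "P = Q"
    from arc_eqD[OF this[unfolded P_def Q_def]] show False unfolding mod_M mod_0 using M by linarith
  qed
  have Q': "arc n (?M - 1 + 1) = Q" using arc_periodic[of n 0 1] unfolding Q_def by simp
  have PQ_int: "P \<inter> Q \<noteq> {}" using arc_Int_Suc[of n "?M - 1"] unfolding Q' P_def .
  define c where "c s = (if s = [P, Q] then m else if s = [Q, P] then - m else 0)" for s
  \<comment> \<open>Arcs with a common point are at most two distinct sets \<open>E\<close>,
    \<open>F\<close>; there the cocycle identity is just antisymmetry.\<close>
  have c_cases: "c [U, W] = c [U, V] + c [V, W]" if "U \<in> {E, F}" "V \<in> {E, F}" "W \<in> {E, F}" for U V W E F
    using that PQ unfolding c_def by auto
  have c: "c \<in> cocycles1 (arc_cover n)"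
    unfolding cocycles1_iff
  proof (intro conjI allI ballI impI)
    fix s assume "s \<notin> nerve_simplices (arc_cover n) 1"
    moreover have "[P, Q] \<in> nerve_simplices (arc_cover n) 1" "[Q, P] \<in> nerve_simplices (arc_cover n) 1"
      unfolding nerve1 using PQ_int arc_in_cover P_def Q_def by auto
    ultimately show "c s = 0" unfolding c_def by auto
  next
    fix U V W assume m: "U \<in> arc_cover n" "V \<in> arc_cover n" "W \<in> arc_cover n" "U \<inter> V \<inter> W \<noteq> {}"
    obtain x where x: "x \<in> U" "x \<in> V" "x \<in> W" using m(4) by blast
    obtain i j k where ij: "U = arc n i" "V = arc n j" "W = arc n k" using m(1-3) unfolding arc_cover_def by blast
    have X: "x \<in> topspace X" using x(1) unfolding ij arc_def by blast
    then obtain w where w: "w \<in> p n x" using p_ex by blast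
    show "c [U, W] = c [U, V] + c [V, W]"
      by (rule c_cases[of _ "arc n \<lfloor>real (arcs n) * w\<rfloor>" "arc n (\<lfloor>real (arcs n) * w\<rfloor> + 1)"])
        (use arc_mem_near[OF X w x(1)[unfolded ij]] arc_mem_near[OF X w x(2)[unfolded ij]]
          arc_mem_near[OF X w x(3)[unfolded ij]] in \<open>simp_all add: ij\<close>)
  qed
  have c_arc: "c [arc n (int i), arc n (int i + 1)] = (if i = arcs n - 1 then m else 0)" if i: "i < arcs n" for i
  proof (cases "i = arcs n - 1")
    case True
    then have "int i = ?M - 1" using M by linarith
    then show ?thesis using True Q' unfolding c_def P_def by simp
  next
    case False
    then have i': "int i + 1 < ?M" using i by linarith
    have "arc n (int i) \<noteq> P"
    proof
      assume "arc n (int i) = P"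
      from arc_eqD[OF this[unfolded P_def]] show False unfolding mod_M using i' by simp
    qed
    \<comment> \<open>The reversed edge would require 1 and \<open>arcs n - 1\<close> to agree
      modulo \<open>arcs n\<close>, impossible with at least four arcs.\<close>
    moreover have "arc n (int i) \<noteq> Q \<or> arc n (int i + 1) \<noteq> P"
    proof (rule ccontr)
      assume "\<not> ?thesis"
      then have "arc n (int i) = arc n 0" "arc n (int i + 1) = arc n (?M - 1)"
        unfolding P_def Q_def by blast+
      from this[THEN arc_eqD] show False unfolding mod_M using i' M by simp
    qed
    ultimately show ?thesis using False unfolding c_def by auto
  qed
  have "holonomy n (arc n) c = (\<Sum>i<arcs n. if i = arcs n - 1 then m else 0)"
    unfolding holonomy_def using c_arc by (intro sum.cong) auto
  also have "\<dots> = m" using M by (subst sum.delta) auto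
  finally have "holonomy n (arc n) c = m" .
  then have "winding (arc_cover n) c = of_int m / 2 ^ n"
    using winding_eq[OF c refinement_arc] by simp
  then show ?thesis using c by blast
qed

text \<open>Classes with equal winding number are pulled back to a common arc cover, where their
  difference has zero holonomy and is a coboundary.\<close>

lemma cech_cohomology_dyadic: "cech_cohomology 1 X \<cong> dyadic_rationals"
proof -
  define f where "f \<U> C = winding \<U> (SOME c. c \<in> C)" for \<U> and C :: "('a set list \<Rightarrow> int) set"
  have f: "f \<U> (cob_class \<U> c) = winding \<U> c" if U: "\<U> \<in> open_covers X" and c: "c \<in> cocycles1 \<U>" for \<U> c
  proof -
    have "(SOME x. x \<in> cob_class \<U> c) \<in> cob_class \<U> c" by (rule someI[of _ c]) (rule cob_class_self)
    then obtain h where h: "h \<in> cech_coboundaries \<U> 1" "(SOME x. x \<in> cob_class \<U> c) = (\<lambda>s. h s + c s)"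
      unfolding cob_class_def by blast
    have "h \<in> cocycles1 \<U>" using h(1) coboundaries1_cocycles by blast
    from winding_add[OF U this c] show ?thesis
      unfolding f_def h(2) winding_coboundary[OF U h(1)] by simp
  qed
  have common: "\<exists>n. refined_by \<U> (arc_cover n) \<and> refined_by \<V> (arc_cover n)"
    if U: "\<U> \<in> open_covers X" and V: "\<V> \<in> open_covers X" for \<U> \<V>
  proof -
    obtain n \<rho> where r: "refinement \<U> n \<rho>" using arc_covers_cofinal[OF U] by blast
    obtain m \<sigma> where s: "refinement \<V> m \<sigma>" using arc_covers_cofinal[OF V] by blast
    have "refined_by \<U> (arc_cover (n + m))" "refined_by \<V> (arc_cover (m + n))"
      unfolding refined_by_refinement by (rule refinement_add[OF r], rule refinement_add[OF s])
    then show ?thesis by (metis add.commute)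
  qed
  have "direct_limit (open_covers X) refined_by (nerve_cohomology 1) (cech_transition 1)
      \<cong> \<lparr>carrier = {of_int m / 2 ^ n :: rat | (m::int) (n::nat). True}, monoid.mult = (+), one = 0\<rparr>"
  proof (rule direct_limit_iso[where f = f])
    fix \<U> \<V> assume "\<U> \<in> open_covers X" "\<V> \<in> open_covers X"
    from common[OF this] show "\<exists>\<W>\<in>open_covers X. refined_by \<U> \<W> \<and> refined_by \<V> \<W>"
      using arc_cover_open by blast
  next
    fix \<U> \<V> C
    assume U: "\<U> \<in> open_covers X" and V: "\<V> \<in> open_covers X" and r: "refined_by \<U> \<V>"
      and "C \<in> carrier (nerve_cohomology 1 \<U>)"
    then obtain c where c: "c \<in> cocycles1 \<U>" "C = cob_class \<U> c" unfolding carrier_nerve_cohomology by blast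
    have t: "cech_transition 1 \<U> \<V> C = cob_class \<V> (cech_pullback 1 \<U> \<V> c)"
      unfolding c(2) by (rule transition_cob_class[OF r c(1)])
    note pc = pullback_cocycle[OF r c(1)]
    show "cech_transition 1 \<U> \<V> C \<in> carrier (nerve_cohomology 1 \<V>) \<and> f \<V> (cech_transition 1 \<U> \<V> C) = f \<U> C"
    proof
      show "cech_transition 1 \<U> \<V> C \<in> carrier (nerve_cohomology 1 \<V>)"
        unfolding t carrier_nerve_cohomology by (rule imageI[OF pc])
      show "f \<V> (cech_transition 1 \<U> \<V> C) = f \<U> C"
        unfolding t f[OF V pc] unfolding c(2) f[OF U c(1)] by (rule winding_pullback[OF r V c(1)])
    qed
  next
    fix \<U> C D
    assume U: "\<U> \<in> open_covers X" and "C \<in> carrier (nerve_cohomology 1 \<U>)" "D \<in> carrier (nerve_cohomology 1 \<U>)"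
    then obtain c d where c: "c \<in> cocycles1 \<U>" "C = cob_class \<U> c" and d: "d \<in> cocycles1 \<U>" "D = cob_class \<U> d"
      unfolding carrier_nerve_cohomology by blast
    note cd = cocycles1_add[OF c(1) d(1)]
    have t: "C \<otimes>\<^bsub>nerve_cohomology 1 \<U>\<^esub> D = cob_class \<U> (\<lambda>s. c s + d s)"
      unfolding c(2) d(2) by (rule mult_nerve_cohomology)
    show "C \<otimes>\<^bsub>nerve_cohomology 1 \<U>\<^esub> D \<in> carrier (nerve_cohomology 1 \<U>) \<and>
        f \<U> (C \<otimes>\<^bsub>nerve_cohomology 1 \<U>\<^esub> D) = f \<U> C + f \<U> D"
    proof
      show "C \<otimes>\<^bsub>nerve_cohomology 1 \<U>\<^esub> D \<in> carrier (nerve_cohomology 1 \<U>)"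
        unfolding t carrier_nerve_cohomology by (rule imageI[OF cd])
      show "f \<U> (C \<otimes>\<^bsub>nerve_cohomology 1 \<U>\<^esub> D) = f \<U> C + f \<U> D"
        unfolding t f[OF U cd] unfolding c(2) d(2) f[OF U c(1)] f[OF U d(1)]
        by (rule winding_add[OF U c(1) d(1)])
    qed
  next
    fix \<U> \<V> C D
    assume U: "\<U> \<in> open_covers X" and V: "\<V> \<in> open_covers X"
      and C: "C \<in> carrier (nerve_cohomology 1 \<U>)" and D: "D \<in> carrier (nerve_cohomology 1 \<V>)"
      and e: "f \<U> C = f \<V> D"
    obtain c where c: "c \<in> cocycles1 \<U>" "C = cob_class \<U> c" using C unfolding carrier_nerve_cohomology by blast
    obtain d where d: "d \<in> cocycles1 \<V>" "D = cob_class \<V> d" using D unfolding carrier_nerve_cohomology by blast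
    obtain n where n: "refined_by \<U> (arc_cover n)" "refined_by \<V> (arc_cover n)" using common[OF U V] by blast
    let ?c = "cech_pullback 1 \<U> (arc_cover n) c" and ?d = "cech_pullback 1 \<V> (arc_cover n) d"
    note pc = pullback_cocycle[OF n(1) c(1)] and pd = pullback_cocycle[OF n(2) d(1)]
    have "winding (arc_cover n) ?c = winding (arc_cover n) ?d"
      unfolding winding_pullback[OF n(1) arc_cover_open c(1)] winding_pullback[OF n(2) arc_cover_open d(1)]
      using e unfolding c(2) d(2) f[OF U c(1)] f[OF V d(1)] .
    then have "holonomy n (arc n) ?c = holonomy n (arc n) ?d"
      unfolding winding_eq[OF pc refinement_arc] winding_eq[OF pd refinement_arc] by simp
    then have "holonomy n (arc n) (\<lambda>s. ?c s - ?d s) = 0"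
      unfolding holonomy_def sum_subtractf by simp
    from holonomy_zero_coboundary[OF cocycles1_diff[OF pc pd] this]
    have "cob_class (arc_cover n) ?c = cob_class (arc_cover n) ?d" by (rule cob_class_eqI)
    then have "cech_transition 1 \<U> (arc_cover n) C = cech_transition 1 \<V> (arc_cover n) D"
      unfolding c(2) d(2) transition_cob_class[OF n(1) c(1)] transition_cob_class[OF n(2) d(1)] .
    then show "\<exists>\<W>\<in>open_covers X. refined_by \<U> \<W> \<and> refined_by \<V> \<W> \<and>
        cech_transition 1 \<U> \<W> C = cech_transition 1 \<V> \<W> D"
      using n arc_cover_open by blast
  next
    show "(\<lambda>(\<U>, C). f \<U> C) ` (SIGMA \<U>:open_covers X. carrier (nerve_cohomology 1 \<U>))
        = {of_int m / 2 ^ n :: rat | (m::int) (n::nat). True}"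
    proof (intro equalityI subsetI)
      fix q assume "q \<in> (\<lambda>(\<U>, C). f \<U> C) ` (SIGMA \<U>:open_covers X. carrier (nerve_cohomology 1 \<U>))"
      then obtain \<U> c where U: "\<U> \<in> open_covers X" and c: "c \<in> cocycles1 \<U>" and q: "q = f \<U> (cob_class \<U> c)"
        unfolding carrier_nerve_cohomology by auto
      obtain n \<rho> where r: "refinement \<U> n \<rho>" using arc_covers_cofinal[OF U] by blast
      show "q \<in> {of_int m / 2 ^ n :: rat | (m::int) (n::nat). True}"
        unfolding q f[OF U c] winding_eq[OF c r] by blast
    next
      fix q :: rat assume "q \<in> {of_int m / 2 ^ n :: rat | (m::int) (n::nat). True}"
      then obtain m :: int and n :: nat where q: "q = of_int m / 2 ^ n" by blast
      obtain c where c: "c \<in> cocycles1 (arc_cover n)" "winding (arc_cover n) c = of_int m / 2 ^ n"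
        using winding_surj by blast
      have "q = (\<lambda>(\<U>, C). f \<U> C) (arc_cover n, cob_class (arc_cover n) c)"
        using f[OF arc_cover_open c(1)] c(2) q by simp
      moreover have "(arc_cover n, cob_class (arc_cover n) c) \<in> (SIGMA \<U>:open_covers X. carrier (nerve_cohomology 1 \<U>))"
        unfolding carrier_nerve_cohomology using arc_cover_open c(1) by blast
      ultimately show "q \<in> (\<lambda>(\<U>, C). f \<U> C) ` (SIGMA \<U>:open_covers X. carrier (nerve_cohomology 1 \<U>))"
        by (rule image_eqI)
    qed
  qed
  then show ?thesis unfolding cech_cohomology_def dyadic_rationals_def .
qed

end

subsection \<open>The symmetric chair tilings\<close>

text \<open>The inverse \<open>g\<close> of the homeomorphism supplies the coordinate functions of
  \<open>X\<close>.\<close>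

lemma cech_cohomology_homeomorphic_solenoid:
  assumes "homeomorphic_map dyadic_solenoid X f"
  shows "cech_cohomology 1 X \<cong> dyadic_rationals"
proof -
  obtain g where fg: "homeomorphic_maps dyadic_solenoid X f g"
    using assms unfolding homeomorphic_map_maps by blast
  then have cf: "continuous_map dyadic_solenoid X f" and cg: "continuous_map X dyadic_solenoid g"
    and gf: "\<And>s. s \<in> topspace dyadic_solenoid \<Longrightarrow> g (f s) = s"
    and fg': "\<And>x. x \<in> topspace X \<Longrightarrow> f (g x) = x"
    unfolding homeomorphic_maps_def by blast+
  have f_in: "f s \<in> topspace X" if "s \<in> topspace dyadic_solenoid" for s
    using cf that unfolding continuous_map_def by blast
  have g_in: "g x \<in> topspace dyadic_solenoid" if "x \<in> topspace X" for x
    using cg that unfolding continuous_map_def by blast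
  interpret solenoid_coordinates X "\<lambda>n x. g x n"
  proof
    fix x n assume x: "x \<in> topspace X"
    show "g x n \<in> range RZ_class" by (rule solenoid_class[OF g_in[OF x]])
    show "2 * w \<in> g x n" if "w \<in> g x (Suc n)" for w
      unfolding mem_solenoid_double[OF g_in[OF x]] using that by blast
  next
    fix z n
    have "g (f (sol_line (2 ^ n * z))) = sol_line (2 ^ n * z)" by (rule gf[OF sol_line_in])
    then have "z \<in> g (f (sol_line (2 ^ n * z))) n" by (simp add: sol_line_def mem_RZ_class)
    then show "\<exists>x\<in>topspace X. z \<in> g x n" using f_in[OF sol_line_in] by blast
  next
    fix V :: "real set" and n assume "open V"
    from openin_continuous_map_preimage[OF cg openin_solenoid_coordinate[OF this, of n]]
    have "openin X {x \<in> topspace X. g x \<in> {t \<in> topspace dyadic_solenoid. \<exists>w\<in>t n. w \<in> V}}" .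
    moreover have "{x \<in> topspace X. g x \<in> {t \<in> topspace dyadic_solenoid. \<exists>w\<in>t n. w \<in> V}}
        = {x \<in> topspace X. \<exists>w\<in>g x n. w \<in> V}"
      using g_in by blast
    ultimately show "openin X {x \<in> topspace X. \<exists>w\<in>g x n. w \<in> V}" by simp
  next
    fix U x assume U: "openin X U" and x: "x \<in> U"
    have X: "x \<in> topspace X" using openin_subset[OF U] x by blast
    have O: "openin dyadic_solenoid {s \<in> topspace dyadic_solenoid. f s \<in> U}"
      by (rule openin_continuous_map_preimage[OF cf U])
    have "g x \<in> {s \<in> topspace dyadic_solenoid. f s \<in> U}" using g_in[OF X] fg'[OF X] x by simp
    from solenoid_nbhd[OF O this] obtain n z d where z: "z \<in> g x n" "d > 0"
      "\<forall>t\<in>topspace dyadic_solenoid. (\<exists>w\<in>t n. \<bar>w - z\<bar> < d) \<longrightarrow> t \<in> {s \<in> topspace dyadic_solenoid. f s \<in> U}"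
      by (elim exE bexE conjE)
    have "y \<in> U" if y: "y \<in> topspace X" "\<exists>w\<in>g y n. \<bar>w - z\<bar> < d" for y
    proof -
      have "f (g y) \<in> U" using z(3) g_in[OF y(1)] y(2) by blast
      then show ?thesis by (simp add: fg'[OF y(1)])
    qed
    then show "\<exists>n. \<exists>z\<in>g x n. \<exists>d>0. \<forall>y\<in>topspace X. (\<exists>w\<in>g y n. \<bar>w - z\<bar> < d) \<longrightarrow> y \<in> U"
      using z(1,2) by (intro exI[of _ n] bexI[OF _ z(1)] exI[of _ d] conjI ballI impI)
  next
    show "compact_space X"
      using compact_dyadic_solenoid homeomorphic_compact_space homeomorphic_map_imp_homeomorphic_space[OF assms]
      by blast
  qed
  show ?thesis by (rule cech_cohomology_dyadic)
qed

theorem mainTheorem2: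
  shows "fixed_space H5 homeomorphic_space fixed_space H6
    \<and> homeomorphic_map (fixed_space H5) (fixed_space H6) (act_tiling rot90)
    \<and> homeomorphic_map (fixed_space H6) (fixed_space H5) (act_tiling rot90)
    \<and> connected_space (fixed_space H5)
    \<and> fixed_space H5 homeomorphic_space dyadic_solenoid
    \<and> cech_cohomology 1 (fixed_space H5) \<cong> dyadic_rationals"
proof (intro conjI)
  have hom: "dyadic_solenoid homeomorphic_space fixed_space H5"
    by (rule homeomorphic_map_imp_homeomorphic_space[OF homeomorphic_map_sol_tiling])
  show "fixed_space H5 homeomorphic_space fixed_space H6"
    by (rule homeomorphic_map_imp_homeomorphic_space[OF homeomorphic_map_H5_H6])
  show "connected_space (fixed_space H5)"
    using connected_dyadic_solenoid homeomorphic_connected_space[OF hom] by blast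
  show "fixed_space H5 homeomorphic_space dyadic_solenoid"
    by (rule homeomorphic_space_sym[THEN iffD1, OF hom])
  show "cech_cohomology 1 (fixed_space H5) \<cong> dyadic_rationals"
    by (rule cech_cohomology_homeomorphic_solenoid[OF homeomorphic_map_sol_tiling])
qed (rule homeomorphic_map_H5_H6 homeomorphic_map_H6_H5)+

end
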